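(* Let $n\ge3$, let $\Omega=\{y'=(y_1,\dots,y_{n-1})\in\mathbb{R}^{n-1}:y_2^2+\cdots+y_{n-1}^2<1\}$, let $q(y')=\sqrt{1-y_2^2-\cdots-y_{n-1}^2}$, and let $S=\{(y',q(y')):y'\in\Omega\}$ be the top half of the cylinder in $\mathbb{R}^n$. Let $k\in\{2,\dots,n-1\}$ and let $A=\operatorname{Diag}(1,\dots,1,-1,\dots,-1)$ be the $n\times n$ diagonal matrix whose first $k$ diagonal entries are $1$ and whose remaining $n-k$ diagonal entries are $-1$. Let $\mathcal{R}:\mathcal{E}'(\mathbb{R}^n\setminus S)\to\mathcal{D}'(\Omega\times(0,\infty))$ be the Radon transform $$\mathcal{R}f(y',t)=\int_{\mathbb{R}}\int_{\mathbb{R}^n}|\nabla_x\psi|\,f(x)\,e^{i\psi(y',t,x,\omega)}\,dx\,d\omega,\qquad \psi(y',t,x,\omega)=\omega\big(t-x_T^TAx_T\big),\quad x_T=x-(y',q(y')).$$ Then $\mathcal{R}$ is a Fourier integral operator associated to a canonical relation $C$ for which the left projection $\pi_L$ has a cusp singularity and the right projection $\pi_R$ has a fold singularity.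
   Context: Points of $\mathbb{R}^n$ are regarded as column vectors. The functions/distributions $f$ have support disjoint from $S$, and $t>0$ throughout. The integral defining $\mathcal{R}$ is understood as an oscillatory integral. A Fourier integral operator (FIO) with nondegenerate phase function $\varphi(u,v;\theta)$ and symbol amplitude $a(u,v;\theta)$ is a continuous linear operator $\mathcal{E}'(V)\to\mathcal{D}'(U)$ with kernel $\int e^{i\varphi}a\,d\theta$; its canonical relation is $\{(u,d_u\varphi;v,-d_v\varphi): (u,v;\theta)\in\operatorname{supp}(a),\ d_\theta\varphi=0\}$. Canonical relation of $\mathcal{R}$: $C=\{(y',t,d_{y'}\psi,\omega;\,x,-d_x\psi):\ \partial_\omega\psi=0\}$, parametrized by $(y',x,\omega)$ with $y'\in\Omega$, $x\in\mathbb{R}^n\setminus S$, $\omega\in\mathbb{R}\setminus\{0\}$, and $t=x_T^TAx_T>0$. With $B$ the $(n-1)\times n$ matrix $B=(I_{n-1}\,|\,\nabla q(y'))$, the projections are $$\pi_L(y',x,\omega)=(y',\,x_T^TAx_T,\,2\omega BAx_T,\,\omega)\in T^*(\Omega\times(0,\infty)),\qquad \pi_R(y',x,\omega)=(x,\,2\omega Ax_T)\in T^*\mathbb{R}^n .$$ For a smooth map $f$ between manifolds of equal dimension $N$ (in local coordinates), let $S_1(f)=\{p:\det(df_p)=0,\ d(\det(df))_p\ne0\}$, a smooth hypersurface; one says $df$ drops rank simply by $1$ there. Fold: $p\in S_1(f)$ is a fold point if $\ker(df_p)$ is transversal to $T_pS_1(f)$. "$f$ has a fold singularity" means every point where $\det(df)=0$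 lies in $S_1(f)$ and is a fold point. Local normal form: $(x_1,\dots,x_N)\mapsto(x_1,\dots,x_{N-1},x_N^2)$. Cusp: let $p\in S_1(f)$ with $\ker(df_p)\subset T_pS_1(f)$. Let $v$ be a (nowhere vanishing, smooth) vector field along $S_1(f)$ near $p$ with $v\in\ker(df)$ at all points of $S_1(f)$, and let $K$ be a smooth function with $K|_{S_1(f)}=0$ and $dK|_{S_1(f)}\neq0$. Then $v(K)=dK(v)$ vanishes at $p$, and $p$ is a cusp point if $dK(v)$ has a simple zero at $p$. Concretely, in suitable local coordinates centered at $p=0$ in which $f(x)=(x_1,\dots,x_{N-1},h(x))$ with $h(0)=0$ and $S_1(f)=\{\partial h/\partial x_N=0,\ d(\partial h/\partial x_N)\ne0\}$, the point $0$ is a cusp point if $\frac{\partial^2h}{\partial x_N^2}(0)=0$, $\frac{\partial^3h}{\partial x_N^3}(0)\neq0$, and the matrix $\big[d(\frac{\partial h}{\partial x_N})(0)\ \ d(\frac{\partial^2h}{\partial x_N^2})(0)\big]$ has rank $2$. Local normal form: $(x_1,\dots,x_N)\mapsto(x_1,\dots,x_{N-1},x_{N-1}x_N+x_N^3)$. "$f$ has a cusp singularity" means every point where $\det(df)=0$ lies in $S_1(f)$ and is either a fold point or a cusp point (the cusp points being exactly those where $\ker(df_p)\subset T_pS_1(f)$).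
   Formalization: Cusp is meant only invariantly: dK(v) has a simple zero on S_1. The coordinate test's extra condition that the third derivative of h in x_N be nonzero (and the cusp normal form) is dropped: it fails here, as π_L is constant on line segments at singular points with y_2²+…+y_k²=1/2. *)

theory Defs
  imports "HOL-Analysis.Analysis"
begin

section \<open>Smooth functions\<close>

fun iter_deriv :: "'a::real_normed_vector list \<Rightarrow> ('a \<Rightarrow> 'b::real_normed_vector) \<Rightarrow> 'a \<Rightarrow> 'b" where
  "iter_deriv [] f = f"
| "iter_deriv (v # vs) f = (\<lambda>x. frechet_derivative (iter_deriv vs f) (at x) v)"

text \<open>On a finite-dimensional space, all iterated directional derivatives being differentiable
  on the open set \<open>W\<close> is exactly \<open>C\<^sup>\<infinity>\<close> on \<open>W\<close>.\<close>

definition smooth_on :: "'a::real_normed_vector set \<Rightarrow> ('a \<Rightarrow> 'b::real_normed_vector) \<Rightarrow> bool" where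
  "smooth_on W f \<longleftrightarrow> open W \<and> (\<forall>vs. \<forall>x\<in>W. iter_deriv vs f differentiable (at x))"

definition grad :: "('a::euclidean_space \<Rightarrow> real) \<Rightarrow> 'a \<Rightarrow> 'a" where
  "grad f x = (\<Sum>b\<in>Basis. frechet_derivative f (at x) b *\<^sub>R b)"

definition supp :: "('a::topological_space \<Rightarrow> 'b::zero) \<Rightarrow> 'a set" where
  "supp f = closure {x. f x \<noteq> 0}"

section \<open>Test functions and distributions\<close>

definition test_functions :: "'a::euclidean_space set \<Rightarrow> ('a \<Rightarrow> complex) set" where
  "test_functions U = {g. smooth_on UNIV g \<and> compact (supp g) \<and> supp g \<subseteq> U}"

text \<open>\<open>C\<^sup>\<infinity>(V)\<close> for a set \<open>V\<close> that need not be open: functions smooth on some open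
  neighbourhood of \<open>V\<close>.\<close>

definition smooth_functions :: "'a::euclidean_space set \<Rightarrow> ('a \<Rightarrow> complex) set" where
  "smooth_functions V = {h. \<exists>W. V \<subseteq> W \<and> smooth_on W h}"

text \<open>\<open>deriv_bound N K h M\<close> says that the seminorm
  \<open>max\<^bsub>|\<alpha>| \<le> N\<^esub> sup\<^bsub>K\<^esub> |\<partial>\<^sup>\<alpha> h|\<close> is at most \<open>M\<close>.\<close>

definition deriv_bound ::
  "nat \<Rightarrow> 'a::euclidean_space set \<Rightarrow> ('a \<Rightarrow> complex) \<Rightarrow> real \<Rightarrow> bool" where
  "deriv_bound N K h M \<longleftrightarrow> M \<ge> 0 \<and>
     (\<forall>vs x. set vs \<subseteq> Basis \<and> length vs \<le> N \<and> x \<in> K \<longrightarrow> norm (iter_deriv vs h x) \<le> M)"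

type_synonym 'a functional = "('a \<Rightarrow> complex) \<Rightarrow> complex"

definition linear_functional_on :: "('a \<Rightarrow> complex) set \<Rightarrow> 'a functional \<Rightarrow> bool" where
  "linear_functional_on T u \<longleftrightarrow>
     (\<forall>g\<in>T. \<forall>h\<in>T. u (\<lambda>x. g x + h x) = u g + u h) \<and>
     (\<forall>c. \<forall>g\<in>T. u (\<lambda>x. c * g x) = c * u g)"

text \<open>A functional is a total function on \<open>'a \<Rightarrow> complex\<close>; its values outside the relevant space of
  test functions carry no information and are never used.\<close>

definition distributions :: "'a::euclidean_space set \<Rightarrow> 'a functional set" where
  "distributions U = {u. linear_functional_on (test_functions U) u \<and>
     (\<forall>K. compact K \<and> K \<subseteq> U \<longrightarrow>
       (\<exists>C N. \<forall>g\<in>test_functions U. supp g \<subseteq> K \<longrightarrow>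
          (\<forall>M. deriv_bound N K g M \<longrightarrow> norm (u g) \<le> C * M)))}"

text \<open>\<open>\<E>'(V)\<close>, the dual of \<open>C\<^sup>\<infinity>(V)\<close>. For open \<open>V\<close> (take \<open>W = V\<close>) this is the usual dual of
  the Frechet space \<open>C\<^sup>\<infinity>(V)\<close>. For a general \<open>V\<close>, continuity on \<open>C\<^sup>\<infinity>(W)\<close> for every open
  \<open>W \<supseteq> V\<close> says that \<open>u\<close> is a distribution on the whole space with compact support contained
  in every such \<open>W\<close>, hence in \<open>V\<close>.\<close>

definition compact_distributions :: "'a::euclidean_space set \<Rightarrow> 'a functional set" where
  "compact_distributions V = {u. linear_functional_on (smooth_functions V) u \<and>
     (\<forall>W. open W \<and> V \<subseteq> W \<longrightarrow>
       (\<exists>K C N. compact K \<and> K \<subseteq> W \<and>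
          (\<forall>h M. smooth_on W h \<and> deriv_bound N K h M \<longrightarrow> norm (u h) \<le> C * M)))}"

text \<open>The weak-* topology on a set \<open>X\<close> of functionals: pointwise convergence on \<open>T\<close>.\<close>

definition weak_star :: "'a functional set \<Rightarrow> ('a \<Rightarrow> complex) set \<Rightarrow> 'a functional topology" where
  "weak_star X T = pullback_topology X (\<lambda>u. restrict u T) (product_topology (\<lambda>_. euclidean) T)"

text \<open>Weak-* continuity implies continuity for the strong dual topologies here, both sides being duals
  of barrelled spaces.\<close>

definition continuous_linear_operator ::
  "'v::euclidean_space set \<Rightarrow> 'u::euclidean_space set \<Rightarrow> ('v functional \<Rightarrow> 'u functional) \<Rightarrow> bool" where
  "continuous_linear_operator V U F \<longleftrightarrow>
     continuous_map (weak_star (compact_distributions V) (smooth_functions V))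
                    (weak_star (distributions U) (test_functions U)) F \<and>
     (\<forall>f1\<in>compact_distributions V. \<forall>f2\<in>compact_distributions V. \<forall>g\<in>test_functions U.
        F (\<lambda>h. f1 h + f2 h) g = F f1 g + F f2 g) \<and>
     (\<forall>c. \<forall>f\<in>compact_distributions V. \<forall>g\<in>test_functions U. F (\<lambda>h. c * f h) g = c * F f g)"

section \<open>Fourier integral operators\<close>

text \<open>\<open>W\<close> is an open set of pairs \<open>(u, v)\<close>; the phase is considered on \<open>W \<times> (\<real>\<^sup>N \<setminus> {0})\<close>.\<close>

definition cone_over :: "('u \<times> 'v) set \<Rightarrow> ('u \<times> 'v \<times> 'w::zero) set" where
  "cone_over W = {(u, v, \<theta>). (u, v) \<in> W \<and> \<theta> \<noteq> 0}"

definition phase_function ::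
  "('u::euclidean_space \<times> 'v::euclidean_space) set \<Rightarrow>
   ('u \<times> 'v \<times> 'w::euclidean_space \<Rightarrow> real) \<Rightarrow> bool" where
  "phase_function W \<phi> \<longleftrightarrow> smooth_on (cone_over W) \<phi> \<and>
     (\<forall>(u, v, \<theta>) \<in> cone_over W.
        (\<forall>s>0. \<phi> (u, v, s *\<^sub>R \<theta>) = s * \<phi> (u, v, \<theta>)) \<and>
        (grad (\<lambda>u. \<phi> (u, v, \<theta>)) u, grad (\<lambda>\<theta>. \<phi> (u, v, \<theta>)) \<theta>) \<noteq> 0 \<and>
        (grad (\<lambda>v. \<phi> (u, v, \<theta>)) v, grad (\<lambda>\<theta>. \<phi> (u, v, \<theta>)) \<theta>) \<noteq> 0)"

text \<open>Nondegeneracy: the differentials of \<open>\<partial>\<phi>/\<partial>\<theta>\<^sub>1, \<dots>, \<partial>\<phi>/\<partial>\<theta>\<^sub>N\<close> are linearly independent where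
  \<open>d\<^sub>\<theta>\<phi> = 0\<close>. The vector \<open>c\<close> holds the coefficients of a linear relation between them.\<close>

definition nondegenerate_phase ::
  "('u::euclidean_space \<times> 'v::euclidean_space) set \<Rightarrow>
   ('u \<times> 'v \<times> 'w::euclidean_space \<Rightarrow> real) \<Rightarrow> bool" where
  "nondegenerate_phase W \<phi> \<longleftrightarrow> phase_function W \<phi> \<and>
     (\<forall>(u, v, \<theta>) \<in> cone_over W. grad (\<lambda>\<theta>. \<phi> (u, v, \<theta>)) \<theta> = 0 \<longrightarrow>
        (\<forall>c. frechet_derivative (\<lambda>(u, v, \<theta>). c \<bullet> grad (\<lambda>\<theta>. \<phi> (u, v, \<theta>)) \<theta>) (at (u, v, \<theta>)) = (\<lambda>_. 0)
             \<longrightarrow> c = 0))"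

text \<open>Symbols of order \<open>m\<close>, with the usual estimates for \<open>|\<theta>| \<ge> 1\<close>. Smoothness in \<open>\<theta>\<close> at the
  origin is not required, only local boundedness of the \<open>(u, v)\<close>-derivatives: cutting the amplitude
  off near \<open>\<theta> = 0\<close> changes the kernel by a smooth function only. This admits positively
  homogeneous amplitudes such as \<open>|\<theta>|\<close>.\<close>

definition symbol ::
  "real \<Rightarrow> ('u::euclidean_space \<times> 'v::euclidean_space) set \<Rightarrow>
   ('u \<times> 'v \<times> 'w::euclidean_space \<Rightarrow> complex) \<Rightarrow> bool" where
  "symbol m W a \<longleftrightarrow> smooth_on (cone_over W) a \<and>
     (\<forall>K ds es. compact K \<and> K \<subseteq> W \<and> set ds \<subseteq> UNIV \<times> UNIV \<times> {0} \<and> set es \<subseteq> {0} \<times> {0} \<times> UNIV \<longrightarrow>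
        (\<exists>C. \<forall>(u, v) \<in> K. \<forall>\<theta>. norm \<theta> \<ge> 1 \<longrightarrow>
           norm (iter_deriv (ds @ es) a (u, v, \<theta>)) \<le> C * (1 + norm \<theta>) powr (m - length es))) \<and>
     (\<forall>K ds. compact K \<and> K \<subseteq> W \<and> set ds \<subseteq> UNIV \<times> UNIV \<times> {0} \<longrightarrow>
        (\<exists>C. \<forall>(u, v) \<in> K. \<forall>\<theta>. 0 < norm \<theta> \<and> norm \<theta> \<le> 1 \<longrightarrow>
           norm (iter_deriv ds a (u, v, \<theta>)) \<le> C))"

text \<open>The oscillatory integral of \<open>J\<close>, that is, the common limit of
  \<open>\<integral> \<kappa>(\<epsilon>\<theta>) J(\<theta>) d\<theta>\<close> as \<open>\<epsilon> \<rightarrow> 0+\<close>, for all cutoffs \<open>\<kappa>\<close>.\<close>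

definition has_osc_integral :: "('w::euclidean_space \<Rightarrow> complex) \<Rightarrow> complex \<Rightarrow> bool" where
  "has_osc_integral J l \<longleftrightarrow>
     (\<forall>\<kappa>\<in>test_functions UNIV. (\<forall>\<^sub>F \<theta> in nhds 0. \<kappa> \<theta> = 1) \<longrightarrow>
        ((\<lambda>\<epsilon>. LINT \<theta>|lborel. \<kappa> (\<epsilon> *\<^sub>R \<theta>) * J \<theta>) \<longlongrightarrow> l) (at_right 0))"

definition osc_integral :: "('w::euclidean_space \<Rightarrow> complex) \<Rightarrow> complex" where
  "osc_integral J = (THE l. has_osc_integral J l)"

text \<open>The inner integral in the pairing of the kernel \<open>\<integral> e\<^sup>i\<^sup>\<phi> a d\<theta>\<close> with a test function in \<open>u\<close>.\<close>

definition fibre_integral ::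
  "('u::euclidean_space \<times> 'v \<times> 'w \<Rightarrow> real) \<Rightarrow> ('u \<times> 'v \<times> 'w \<Rightarrow> complex) \<Rightarrow>
   ('u \<Rightarrow> complex) \<Rightarrow> 'v \<Rightarrow> 'w \<Rightarrow> complex" where
  "fibre_integral \<phi> a g v \<theta> =
     (LINT u|lborel. exp (\<i> * of_real (\<phi> (u, v, \<theta>))) * a (u, v, \<theta>) * g u)"

text \<open>\<open>F\<close> has Schwartz kernel \<open>\<integral> e\<^sup>i\<^sup>\<phi> a d\<theta>\<close>: for every test function \<open>g\<close>, the oscillatory integral
  \<open>h(v) = \<integral>\<integral> e\<^sup>i\<^sup>\<phi> a g(u) du d\<theta>\<close> is smooth near \<open>V\<close>, and \<open>\<langle>F f, g\<rangle> = \<langle>f, h\<rangle>\<close>. When \<open>f\<close> is a function,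
  \<open>\<langle>F f, g\<rangle>\<close> is thus the kernel paired with \<open>g \<otimes> f\<close>.\<close>

definition has_osc_kernel ::
  "'u::euclidean_space set \<Rightarrow> 'v::euclidean_space set \<Rightarrow>
   ('u \<times> 'v \<times> 'w::euclidean_space \<Rightarrow> real) \<Rightarrow> ('u \<times> 'v \<times> 'w \<Rightarrow> complex) \<Rightarrow>
   ('v functional \<Rightarrow> 'u functional) \<Rightarrow> bool" where
  "has_osc_kernel U V \<phi> a F \<longleftrightarrow>
     (\<forall>g\<in>test_functions U. \<exists>W h. V \<subseteq> W \<and> smooth_on W h \<and>
        (\<forall>v\<in>W. has_osc_integral (fibre_integral \<phi> a g v) (h v)) \<and>
        (\<forall>f\<in>compact_distributions V. F f g = f h))"

text \<open>\<open>V\<close> may fail to be open; phase and amplitude are then required to live on an open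
  neighbourhood \<open>W\<close> of \<open>U \<times> V\<close>. For open \<open>U\<close>, \<open>V\<close> one can take \<open>W = U \<times> V\<close>.\<close>

definition fourier_integral_operator ::
  "'u::euclidean_space set \<Rightarrow> 'v::euclidean_space set \<Rightarrow>
   ('u \<times> 'v \<times> 'w::euclidean_space \<Rightarrow> real) \<Rightarrow> ('u \<times> 'v \<times> 'w \<Rightarrow> complex) \<Rightarrow>
   ('v functional \<Rightarrow> 'u functional) \<Rightarrow> bool" where
  "fourier_integral_operator U V \<phi> a F \<longleftrightarrow>
     open U \<and>
     (\<exists>W m. open W \<and> U \<times> V \<subseteq> W \<and> nondegenerate_phase W \<phi> \<and> symbol m W a) \<and>
     continuous_linear_operator V U F \<and>
     has_osc_kernel U V \<phi> a F"

text \<open>\<open>T\<^sup>*\<real>\<^sup>N\<close> is represented as \<open>\<real>\<^sup>N \<times> \<real>\<^sup>N\<close>, covectors being identified with gradients. The support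
  of \<open>a\<close> is taken relative to \<open>U \<times> V \<times> (\<real>\<^sup>N \<setminus> {0})\<close>.\<close>

definition canonical_relation ::
  "'u::euclidean_space set \<Rightarrow> 'v::euclidean_space set \<Rightarrow>
   ('u \<times> 'v \<times> 'w::euclidean_space \<Rightarrow> real) \<Rightarrow> ('u \<times> 'v \<times> 'w \<Rightarrow> complex) \<Rightarrow>
   (('u \<times> 'u) \<times> ('v \<times> 'v)) set" where
  "canonical_relation U V \<phi> a =
     {((u, grad (\<lambda>u. \<phi> (u, v, \<theta>)) u), (v, - grad (\<lambda>v. \<phi> (u, v, \<theta>)) v)) | u v \<theta>.
        (u, v, \<theta>) \<in> cone_over (U \<times> V) \<inter> closure {p \<in> cone_over (U \<times> V). a p \<noteq> 0} \<and>
        grad (\<lambda>\<theta>. \<phi> (u, v, \<theta>)) \<theta> = 0}"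

section \<open>Fold and cusp singularities\<close>

typedef (overloaded) ('a::euclidean_space) basis_index = "Basis :: 'a set"
  by (rule exI[of _ "SOME b. b \<in> Basis"]) (rule some_in_eq[THEN iffD2, OF nonempty_Basis])

instance basis_index :: (euclidean_space) finite
proof
  have "(UNIV :: 'a basis_index set) = Abs_basis_index ` Basis"
    by (metis type_definition.Abs_image type_definition_basis_index)
  then show "finite (UNIV :: 'a basis_index set)" by (metis finite_Basis finite_imageI)
qed

text \<open>The Jacobian determinant for spaces of equal dimension, with respect to the standard bases.
  These are matched by an arbitrary bijection, on which only the sign depends.\<close>

definition basis_matching :: "'a::euclidean_space \<Rightarrow> 'b::euclidean_space" where
  "basis_matching = (SOME \<beta>. bij_betw \<beta> Basis Basis)"

definition jacobian_det :: "('a::euclidean_space \<Rightarrow> 'b::euclidean_space) \<Rightarrow> 'a \<Rightarrow> real" where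
  "jacobian_det f x =
     det (\<chi> (i :: 'a basis_index) (j :: 'a basis_index).
            frechet_derivative f (at x) (Rep_basis_index j) \<bullet> basis_matching (Rep_basis_index i))"

definition S1 :: "('a::euclidean_space \<Rightarrow> 'b::euclidean_space) \<Rightarrow> 'a set" where
  "S1 f = {p. jacobian_det f p = 0 \<and> frechet_derivative (jacobian_det f) (at p) \<noteq> (\<lambda>_. 0)}"

definition tangent_S1 :: "('a::euclidean_space \<Rightarrow> 'b::euclidean_space) \<Rightarrow> 'a \<Rightarrow> 'a set" where
  "tangent_S1 f p = {w. frechet_derivative (jacobian_det f) (at p) w = 0}"

definition ker_deriv :: "('a::euclidean_space \<Rightarrow> 'b::euclidean_space) \<Rightarrow> 'a \<Rightarrow> 'a set" where
  "ker_deriv f p = {w. frechet_derivative f (at p) w = 0}"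

definition fold_point :: "('a::euclidean_space \<Rightarrow> 'b::euclidean_space) \<Rightarrow> 'a \<Rightarrow> bool" where
  "fold_point f p \<longleftrightarrow> p \<in> S1 f \<and> {v + w | v w. v \<in> ker_deriv f p \<and> w \<in> tangent_S1 f p} = UNIV"

text \<open>The vector field \<open>v\<close> and the function \<open>K\<close> are given on an open neighbourhood \<open>N\<close> of \<open>p\<close>, but
  the conditions only involve the values of \<open>v\<close> and of \<open>dK(v)\<close> along \<open>S\<^sub>1(f)\<close>. The function \<open>dK(v)\<close>
  on the hypersurface \<open>S\<^sub>1(f)\<close> has a simple zero at \<open>p\<close> if it vanishes at \<open>p\<close> and its differential
  on the tangent space of \<open>S\<^sub>1(f)\<close> at \<open>p\<close> is nonzero. In adapted coordinates
  \<open>f(x) = (x\<^sub>1, \<dots>, x\<^bsub>N-1\<^esub>, h(x))\<close> this is \<open>\<partial>\<^sub>N\<^sup>2 h(p) = 0\<close> together with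
  linear independence of \<open>d(\<partial>\<^sub>N h)(p)\<close> and \<open>d(\<partial>\<^sub>N\<^sup>2 h)(p)\<close>. Unlike in dimension 2, it does not
  imply \<open>\<partial>\<^sub>N\<^sup>3 h(p) \<noteq> 0\<close>: the differential need not be nonzero on \<open>ker df\<close>.\<close>

definition cusp_point :: "('a::euclidean_space \<Rightarrow> 'b::euclidean_space) \<Rightarrow> 'a \<Rightarrow> bool" where
  "cusp_point f p \<longleftrightarrow> p \<in> S1 f \<and> ker_deriv f p \<subseteq> tangent_S1 f p \<and>
     (\<exists>N (v :: 'a \<Rightarrow> 'a) (K :: 'a \<Rightarrow> real).
        p \<in> N \<and> smooth_on N v \<and> smooth_on N K \<and>
        (\<forall>x \<in> N \<inter> S1 f. v x \<noteq> 0 \<and> v x \<in> ker_deriv f x \<and>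
           K x = 0 \<and> frechet_derivative K (at x) \<noteq> (\<lambda>_. 0)) \<and>
        frechet_derivative K (at p) (v p) = 0 \<and>
        (\<exists>w \<in> tangent_S1 f p.
           frechet_derivative (\<lambda>x. frechet_derivative K (at x) (v x)) (at p) w \<noteq> 0))"

definition fold_singularity ::
  "'a::euclidean_space set \<Rightarrow> ('a \<Rightarrow> 'b::euclidean_space) \<Rightarrow> bool" where
  "fold_singularity D f \<longleftrightarrow> DIM('a) = DIM('b) \<and> (\<exists>W. D \<subseteq> W \<and> smooth_on W f) \<and>
     (\<forall>p\<in>D. jacobian_det f p = 0 \<longrightarrow> fold_point f p)"

definition cusp_singularity ::
  "'a::euclidean_space set \<Rightarrow> ('a \<Rightarrow> 'b::euclidean_space) \<Rightarrow> bool" where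
  "cusp_singularity D f \<longleftrightarrow> DIM('a) = DIM('b) \<and> (\<exists>W. D \<subseteq> W \<and> smooth_on W f) \<and>
     (\<forall>p\<in>D. jacobian_det f p = 0 \<longrightarrow> fold_point f p \<or> cusp_point f p)"

definition smooth_parametrization ::
  "('a::euclidean_space \<Rightarrow> 'b::euclidean_space) \<Rightarrow> 'a set \<Rightarrow> 'b set \<Rightarrow> bool" where
  "smooth_parametrization \<Phi> D M \<longleftrightarrow> (\<exists>W. D \<subseteq> W \<and> smooth_on W \<Phi>) \<and>
     (\<exists>\<Psi>. homeomorphism D M \<Phi> \<Psi>) \<and>
     (\<forall>p\<in>D. inj (frechet_derivative \<Phi> (at p)))"

section \<open>The Radon transform with centers on a half cylinder\<close>

text \<open>A point \<open>x = (x', x\<^sub>n)\<close> of \<open>\<real>\<^sup>n\<close> is a pair in \<open>real ^ 'm \<times> real\<close> with \<open>n = CARD('m) + 1\<close>. The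
  linear order on \<open>'m\<close> numbers the coordinates of \<open>x'\<close> by \<open>1, \<dots>, n - 1\<close>.\<close>

type_synonym 'm space = "(real, 'm) vec \<times> real"

definition coord_index :: "'m::{finite,linorder} \<Rightarrow> nat" where
  "coord_index i = card {..i}"

definition Omega :: "(real, 'm::{finite,linorder}) vec set" where
  "Omega = {y. (\<Sum>i | coord_index i \<ge> 2. (y $ i)\<^sup>2) < 1}"

definition cyl_height :: "(real, 'm::{finite,linorder}) vec \<Rightarrow> real" where
  "cyl_height y = sqrt (1 - (\<Sum>i | coord_index i \<ge> 2. (y $ i)\<^sup>2))"

definition half_cylinder :: "'m::{finite,linorder} space set" where
  "half_cylinder = (\<lambda>y. (y, cyl_height y)) ` Omega"

definition diag_entry :: "nat \<Rightarrow> nat \<Rightarrow> real" where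
  "diag_entry k j = (if j \<le> k then 1 else -1)"

definition diag_A :: "nat \<Rightarrow> 'm::{finite,linorder} space \<Rightarrow> 'm space" where
  "diag_A k x = (\<chi> i. diag_entry k (coord_index i) * fst x $ i, diag_entry k (CARD('m) + 1) * snd x)"

text \<open>The matrix \<open>(I | \<nabla>q(y'))\<close> acting on column vectors.\<close>

definition matrix_B :: "(real, 'm::{finite,linorder}) vec \<Rightarrow> 'm space \<Rightarrow> (real, 'm) vec" where
  "matrix_B y x = fst x + snd x *\<^sub>R grad cyl_height y"

definition xT :: "(real, 'm::{finite,linorder}) vec \<Rightarrow> 'm space \<Rightarrow> 'm space" where
  "xT y x = x - (y, cyl_height y)"

definition psi :: "nat \<Rightarrow> 'm::{finite,linorder} space \<times> 'm space \<times> real \<Rightarrow> real" where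
  "psi k = (\<lambda>((y, t), x, \<omega>). \<omega> * (t - xT y x \<bullet> diag_A k (xT y x)))"

definition amplitude :: "nat \<Rightarrow> 'm::{finite,linorder} space \<times> 'm space \<times> real \<Rightarrow> complex" where
  "amplitude k = (\<lambda>(u, x, \<omega>). of_real (norm (grad (\<lambda>x. psi k (u, x, \<omega>)) x)))"

text \<open>\<open>\<langle>\<R>f, g\<rangle> = \<langle>f, \<integral>\<integral> |\<nabla>\<^sub>x\<psi>| e\<^sup>i\<^sup>\<psi> g(y', t) dy' dt d\<omega>\<rangle>\<close> for distributions \<open>f\<close> supported off \<open>S\<close>.\<close>

definition Radon :: "nat \<Rightarrow> 'm::{finite,linorder} space functional \<Rightarrow> 'm space functional" where
  "Radon k f g = f (\<lambda>x. osc_integral (fibre_integral (psi k) (amplitude k) g x))"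

definition param_domain :: "nat \<Rightarrow> ((real, 'm::{finite,linorder}) vec \<times> 'm space \<times> real) set" where
  "param_domain k = {(y, x, \<omega>). y \<in> Omega \<and> x \<notin> half_cylinder \<and> \<omega> \<noteq> 0 \<and> xT y x \<bullet> diag_A k (xT y x) > 0}"

definition pi_L :: "nat \<Rightarrow> (real, 'm::{finite,linorder}) vec \<times> 'm space \<times> real \<Rightarrow> 'm space \<times> 'm space" where
  "pi_L k = (\<lambda>(y, x, \<omega>).
     ((y, xT y x \<bullet> diag_A k (xT y x)), ((2 * \<omega>) *\<^sub>R matrix_B y (diag_A k (xT y x)), \<omega>)))"

definition pi_R :: "nat \<Rightarrow> (real, 'm::{finite,linorder}) vec \<times> 'm space \<times> real \<Rightarrow> 'm space \<times> 'm space" where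
  "pi_R k = (\<lambda>(y, x, \<omega>). (x, (2 * \<omega>) *\<^sub>R diag_A k (xT y x)))"

end

theory Submission
  imports Defs "HOL-Probability.Characteristic_Functions" "HOL-Probability.Sinc_Integral"
begin

text \<open>Write \<open>q\<close> for the height of the half cylinder over \<open>y\<close>, \<open>z = x - (y, q y)\<close> for the vector from the centre to \<open>x\<close>,
  \<open>Q (y, x) = z \<bullet> A z\<close>, and \<open>tail y\<close> for \<open>y\<close> without its first coordinate, so that \<open>q\<^sup>2 = 1 - |tail y|\<^sup>2\<close>.

  \<^bold>\<open>Fourier integral operator.\<close>  The phase is \<open>\<omega> (t - Q)\<close> and the amplitude is \<open>2 |\<omega>| |z|\<close>, a symbol of order \<open>1\<close>
  where \<open>z \<noteq> 0\<close>.  The point is that the transform \<open>h\<close> of a test function \<open>g\<close> is a smooth function of \<open>x\<close> whose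
  derivatives are bounded by finitely many derivatives of \<open>g\<close>; the mapping properties of the operator
  follow by duality.  Integration by parts in \<open>t\<close> trades \<open>(1 + \<omega>\<^sup>2)\<^sup>2\<close> for \<open>(1 - \<partial>\<^sub>t\<^sup>2)\<^sup>2\<close> on \<open>g\<close>, after which the integral
  over \<open>\<omega>\<close> converges absolutely and can be carried out first (\<open>osc_integral_kernel\<close>):
  \<open>h x = \<integral> E (t - Q (y, x)) 2 |z| (1 - \<partial>\<^sub>t\<^sup>2)\<^sup>2 g (y, t) dy dt\<close> with a function \<open>E\<close> of class \<open>C\<^sup>1\<close>.  A derivative in \<open>x\<close>
  that falls on \<open>E\<close> is \<open>- \<partial>Q\<close> times a derivative in \<open>t\<close>, which another integration by parts moves to \<open>g\<close>.  So the
  derivative of such an integral is a sum of two integrals of the same form with the same \<open>E\<close>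
  (\<open>kernel_integral_has_derivative\<close>), and both smoothness and the estimates follow by iteration.

  \<^bold>\<open>Singularities.\<close>  Let \<open>N = (tail y, q y)\<close> be the unit normal of the cylinder at \<open>(y, q y)\<close>, and \<open>L = N \<bullet> z\<close>, so
  that \<open>L = 0\<close> says that \<open>x\<close> lies on the tangent plane.  The differentials of both projections factor as \<open>G D H\<close> with \<open>G\<close> and \<open>H\<close> invertible and \<open>D\<close>
  the multiplication of a single coordinate by \<open>L\<close> (\<open>pi_R_factored\<close>, \<open>pi_L_factored\<close>).  Hence both Jacobian
  determinants are nonvanishing multiples of \<open>L\<close> (\<open>jacobian_det_factored\<close>), and as \<open>dL \<noteq> 0\<close> it only remains to
  differentiate \<open>L\<close> along the kernels.

  For \<open>pi_R\<close> the kernel is spanned by \<open>(z', 0, \<omega>)\<close>, and the derivative of \<open>L\<close> along it is \<open>z\<^sub>2\<^sup>2 + \<dots> + z\<^sub>n\<^sup>2\<close>.  This is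
  positive, since otherwise \<open>z\<close> would be parallel to the axis and \<open>x\<close> would lie on the half cylinder.  So
  there are only folds.

  For \<open>pi_L\<close> the kernel is spanned by \<open>(0, A N, 0)\<close>, and the derivative of \<open>L\<close> along it is \<open>N \<bullet> A N\<close>.  There is a fold
  where this is nonzero.  It is a function of \<open>y\<close> alone, equal to \<open>1\<close> if \<open>A\<close> is the identity; otherwise the last
  entry of \<open>A\<close> is \<open>-1\<close>, and it equals \<open>tail y \<bullet> (A' + 1) tail y - 1\<close>, where \<open>A'\<close> is the upper left block of \<open>A\<close>.
  At a zero its derivative in the direction \<open>(A' + 1) tail y\<close> is \<open>4\<close>; as \<open>x\<close> can be varied along with \<open>y\<close> so that \<open>L\<close>
  stays stationary, the zero is simple on the hypersurface \<open>L = 0\<close>, and the point is a cusp point.\<close>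

section \<open>Calculus of smooth functions\<close>

text \<open>Closure of smoothness under an operation is proved by induction on the order of differentiability,
  since each derivative rule expresses the derivative through the same operation, applied to functions
  of one order less.\<close>

primrec Ck :: "nat \<Rightarrow> 'a::real_normed_vector set \<Rightarrow> ('a \<Rightarrow> 'b::real_normed_vector) \<Rightarrow> bool" where
  "Ck 0 W f \<longleftrightarrow> (\<forall>x\<in>W. f differentiable (at x))"
| "Ck (Suc n) W f \<longleftrightarrow> (\<forall>x\<in>W. f differentiable (at x)) \<and>
     (\<forall>v. Ck n W (\<lambda>x. frechet_derivative f (at x) v))"

lemma iter_deriv_append: "iter_deriv (vs @ ws) f = iter_deriv vs (iter_deriv ws f)"
  by (induction vs) auto

lemma frechet_derivative_cong_open:
  assumes "open W" "x \<in> W" "\<And>y. y \<in> W \<Longrightarrow> f y = g y"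
  shows "frechet_derivative f (at x) = frechet_derivative g (at x)"
proof -
  have "(f has_derivative D) (at x) \<longleftrightarrow> (g has_derivative D) (at x)" for D
    using has_derivative_transform_within_open[OF _ assms(1,2), of f D UNIV g]
      has_derivative_transform_within_open[OF _ assms(1,2), of g D UNIV f] assms(3) by auto
  then show ?thesis unfolding frechet_derivative_def by simp
qed

lemma differentiable_cong_open:
  assumes "open W" "x \<in> W" "\<And>y. y \<in> W \<Longrightarrow> f y = g y" "f differentiable (at x)"
  shows "g differentiable (at x)"
  using assms has_derivative_transform_within_open unfolding differentiable_def by blast

lemma iter_deriv_cong_open:
  assumes "open W" "x \<in> W" "\<And>y. y \<in> W \<Longrightarrow> f y = g y"
  shows "iter_deriv vs f x = iter_deriv vs g x"
proof -
  have "\<forall>x\<in>W. iter_deriv vs f x = iter_deriv vs g x"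
  proof (induction vs)
    case (Cons v vs)
    then show ?case
      using frechet_derivative_cong_open[OF assms(1), of _ "iter_deriv vs f" "iter_deriv vs g"] by auto
  qed (use assms in auto)
  then show ?thesis using assms by blast
qed

text \<open>The last direction in the list is differentiated first, so that the lists are taken apart at
  their end.\<close>

lemma Ck_iff_iter_deriv:
  "Ck n W f \<longleftrightarrow> (\<forall>vs. length vs \<le> n \<longrightarrow> (\<forall>x\<in>W. iter_deriv vs f differentiable (at x)))"
proof (induction n arbitrary: f)
  case (Suc n)
  have "Ck (Suc n) W f \<longleftrightarrow> (\<forall>x\<in>W. f differentiable (at x)) \<and>
    (\<forall>v vs. length vs \<le> n \<longrightarrow> (\<forall>x\<in>W. iter_deriv (vs @ [v]) f differentiable (at x)))"
    by (auto simp: Suc iter_deriv_append)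
  also have "\<dots> \<longleftrightarrow> (\<forall>vs. length vs \<le> Suc n \<longrightarrow> (\<forall>x\<in>W. iter_deriv vs f differentiable (at x)))"
    (is "?l \<longleftrightarrow> ?r")
  proof
    assume l: ?l
    show ?r
    proof (intro allI impI)
      fix vs :: "'a list" assume "length vs \<le> Suc n"
      then show "\<forall>x\<in>W. iter_deriv vs f differentiable (at x)"
        using l by (cases vs rule: rev_cases) auto
    qed
  next
    assume r: ?r
    have "iter_deriv [] f = f" by simp
    with r[rule_format, of "[]"] r show ?l by auto
  qed
  finally show ?case .
qed auto

lemma smooth_on_iff_Ck: "smooth_on W f \<longleftrightarrow> open W \<and> (\<forall>n. Ck n W f)"
  unfolding smooth_on_def Ck_iff_iter_deriv by blast

lemma Ck_mono: "Ck n W f \<Longrightarrow> m \<le> n \<Longrightarrow> Ck m W f"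
  by (simp add: Ck_iff_iter_deriv)

lemma Ck_subset: "Ck n W f \<Longrightarrow> V \<subseteq> W \<Longrightarrow> Ck n V f"
  by (auto simp add: Ck_iff_iter_deriv)

lemma Ck_cong:
  assumes "open W" "\<And>x. x \<in> W \<Longrightarrow> f x = g x" "Ck n W f"
  shows "Ck n W g"
  unfolding Ck_iff_iter_deriv
proof (intro allI impI ballI)
  fix vs :: "'a list" and x assume "length vs \<le> n" "x \<in> W"
  then have "iter_deriv vs f differentiable (at x)" using assms(3) by (auto simp: Ck_iff_iter_deriv)
  moreover have "iter_deriv vs f y = iter_deriv vs g y" if "y \<in> W" for y
    using iter_deriv_cong_open[OF assms(1) that] assms(2) by blast
  ultimately show "iter_deriv vs g differentiable (at x)"
    using differentiable_cong_open[OF assms(1) \<open>x \<in> W\<close>] by blast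
qed

lemma Ck_differentiable: "Ck n W f \<Longrightarrow> x \<in> W \<Longrightarrow> f differentiable (at x)"
  by (cases n) auto

lemma Ck_has_derivative:
  "Ck n W f \<Longrightarrow> x \<in> W \<Longrightarrow> (f has_derivative frechet_derivative f (at x)) (at x)"
  using Ck_differentiable frechet_derivative_works by blast

lemma Ck_SucI:
  assumes "open W" "\<And>x. x \<in> W \<Longrightarrow> (f has_derivative f' x) (at x)" "\<And>v. Ck n W (\<lambda>x. f' x v)"
  shows "Ck (Suc n) W f"
proof -
  have "frechet_derivative f (at x) = f' x" if "x \<in> W" for x
    using assms(2)[OF that] frechet_derivative_at by metis
  then have "Ck n W (\<lambda>x. frechet_derivative f (at x) v)" for v
    using Ck_cong[OF assms(1) _ assms(3)[of v]] by auto
  then show ?thesis using assms(2) by (auto simp: differentiable_def)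
qed

lemma Ck_const: "Ck n W (\<lambda>_. c)"
  by (induction n arbitrary: c) (auto)

lemma Ck_linear:
  assumes "bounded_linear F"
  shows "Ck n UNIV F"
proof (cases n)
  case 0
  then show ?thesis using bounded_linear_imp_differentiable[OF assms] by auto
next
  case (Suc k)
  show ?thesis unfolding Suc
    by (rule Ck_SucI[OF open_UNIV bounded_linear_imp_has_derivative[OF assms] Ck_const])
qed

lemma Ck_add:
  assumes "open W"
  shows "Ck n W f \<Longrightarrow> Ck n W g \<Longrightarrow> Ck n W (\<lambda>x. f x + g x)"
proof (induction n arbitrary: f g)
  case (Suc n)
  show ?case
    by (rule Ck_SucI[OF assms has_derivative_add[OF Ck_has_derivative[OF Suc.prems(1)]
            Ck_has_derivative[OF Suc.prems(2)]]]) (use Suc in auto)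
qed auto

lemma Ck_bilinear:
  assumes "open W" "bounded_bilinear B"
  shows "Ck n W f \<Longrightarrow> Ck n W g \<Longrightarrow> Ck n W (\<lambda>x. B (f x) (g x))"
proof (induction n arbitrary: f g)
  case 0
  then show ?case
    using bounded_bilinear.FDERIV[OF assms(2) Ck_has_derivative[OF 0(1)] Ck_has_derivative[OF 0(2)]]
    by (auto simp: differentiable_def)
next
  case (Suc n)
  have *: "Ck n W f" "Ck n W g" using Suc.prems Ck_mono[of "Suc n" W _ n] by auto
  have D: "Ck n W (\<lambda>x. frechet_derivative f (at x) v)" "Ck n W (\<lambda>x. frechet_derivative g (at x) v)" for v
    using Suc.prems by auto
  show ?case
    by (rule Ck_SucI[OF assms(1) bounded_bilinear.FDERIV[OF assms(2) Ck_has_derivative[OF Suc.prems(1)]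
            Ck_has_derivative[OF Suc.prems(2)]]], assumption, assumption)
      (intro Ck_add[OF assms(1)] Suc.IH * D)
qed

lemma Ck_sum:
  assumes "open W" "finite I" "\<And>i. i \<in> I \<Longrightarrow> Ck n W (f i)"
  shows "Ck n W (\<lambda>x. \<Sum>i\<in>I. f i x)"
  using assms(2,3) by (induction I rule: finite_induct) (auto intro: Ck_const Ck_add[OF assms(1)])

text \<open>The chain rule, expanded over an orthonormal basis: the derivative of a composition is a
  sum of products of a component of the inner derivative with a composition of a partial
  derivative of the outer function.\<close>

lemma Ck_compose:
  fixes f :: "'b::euclidean_space \<Rightarrow> 'c::real_normed_vector"
  assumes "open W" "open V"
  shows "Ck n V f \<Longrightarrow> Ck n W g \<Longrightarrow> (\<And>x. x \<in> W \<Longrightarrow> g x \<in> V) \<Longrightarrow> Ck n W (\<lambda>x. f (g x))"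
proof (induction n arbitrary: f g)
  case 0
  then show ?case using differentiable_chain_at[of g _ f] by (auto simp: o_def)
next
  case (Suc n)
  have g: "Ck n W g" using Suc.prems Ck_mono[of "Suc n" W _ n] by auto
  let ?D = "\<lambda>x. frechet_derivative g (at x)"
  have der: "((\<lambda>x. f (g x)) has_derivative
      (\<lambda>v. \<Sum>b\<in>Basis. (?D x v \<bullet> b) *\<^sub>R frechet_derivative f (at (g x)) b)) (at x)" if "x \<in> W" for x
  proof -
    have d: "(f has_derivative frechet_derivative f (at (g x))) (at (g x))"
      using Ck_has_derivative[OF Suc.prems(1)] Suc.prems(3) that by auto
    have rep: "frechet_derivative f (at (g x)) w
        = (\<Sum>b\<in>Basis. (w \<bullet> b) *\<^sub>R frechet_derivative f (at (g x)) b)" for w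
    proof -
      have "linear (frechet_derivative f (at (g x)))"
        using has_derivative_linear[OF d] .
      then show ?thesis
        by (subst euclidean_representation[of w, symmetric])
          (simp add: linear_sum linear_cmul del: euclidean_representation)
    qed
    show ?thesis
      using has_derivative_compose[OF Ck_has_derivative[OF Suc.prems(2) that] d]
      by (simp only: rep[of "frechet_derivative g (at x) v" for v])
  qed
  have part: "Ck n W (\<lambda>x. frechet_derivative f (at (g x)) b)" for b
    using Suc.IH[of "\<lambda>y. frechet_derivative f (at y) b" g] Suc.prems g by auto
  have comp: "Ck n W (\<lambda>x. (?D x v \<bullet> b))" for v b
    by (rule Ck_bilinear[OF assms(1) bounded_bilinear_inner]) (use Suc.prems Ck_const in auto)
  show ?case
    by (rule Ck_SucI[OF assms(1) der])
      (auto intro!: Ck_sum[OF assms(1)] Ck_bilinear[OF assms(1) bounded_bilinear_scaleR] comp part)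
qed

lemma Ck_linear_compose:
  assumes "bounded_linear F" "open W"
  shows "Ck n W f \<Longrightarrow> Ck n W (\<lambda>x. F (f x))"
proof (induction n arbitrary: f)
  case 0
  then show ?case
    using bounded_linear.has_derivative[OF assms(1) Ck_has_derivative[OF 0]]
    by (auto simp: differentiable_def)
next
  case (Suc n)
  show ?case
    by (rule Ck_SucI[OF assms(2) bounded_linear.has_derivative[OF assms(1) Ck_has_derivative[OF Suc.prems]]])
      (use Suc in auto)
qed

lemma Ck_Pair:
  assumes "open W"
  shows "Ck n W f \<Longrightarrow> Ck n W g \<Longrightarrow> Ck n W (\<lambda>x. (f x, g x))"
proof (induction n arbitrary: f g)
  case 0
  then show ?case
    using has_derivative_Pair[OF Ck_has_derivative[OF 0(1)] Ck_has_derivative[OF 0(2)]]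
    by (auto simp: differentiable_def)
next
  case (Suc n)
  show ?case
    by (rule Ck_SucI[OF assms has_derivative_Pair[OF Ck_has_derivative[OF Suc.prems(1)]
            Ck_has_derivative[OF Suc.prems(2)]]]) (use Suc in auto)
qed

lemma Ck_inverse: "Ck n (- {0}) (inverse :: real \<Rightarrow> real)"
proof (induction n)
  case 0
  show ?case unfolding Ck.simps differentiable_def using has_derivative_inverse' by blast
next
  case (Suc n)
  have o: "open (- {0::real})" by (simp add: open_Compl)
  show ?case
    by (rule Ck_SucI[OF o has_derivative_inverse'], simp)
      (rule Ck_linear_compose[OF bounded_linear_minus[OF bounded_linear_ident] o],
        intro Ck_bilinear[OF o bounded_bilinear_mult] Suc Ck_const)
qed

lemma Ck_sqrt: "Ck n {0<..} sqrt"
proof (induction n)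
  case 0
  show ?case using DERIV_real_sqrt unfolding Ck.simps differentiable_def has_field_derivative_def by blast
next
  case (Suc n)
  have o: "open {0::real<..}" by auto
  have "Ck n {0<..} (\<lambda>x. inverse (sqrt x))"
    by (rule Ck_compose[OF o _ Ck_inverse Suc]) auto
  then have "Ck n {0<..} (\<lambda>x. v * inverse (sqrt x) * (1/2))" for v
    by (intro Ck_bilinear[OF o bounded_bilinear_mult] Ck_const)
  moreover have "(sqrt has_derivative (\<lambda>v. v * inverse (sqrt x) * (1/2))) (at x)" if "x \<in> {0<..}" for x
  proof -
    have "(\<lambda>v. v * inverse (sqrt x) * (1/2)) = (*) (inverse (sqrt x) / 2)"
      by auto
    then show ?thesis using DERIV_real_sqrt[of x] that
      unfolding has_field_derivative_def by simp
  qed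
  ultimately show ?case by (rule Ck_SucI[OF o, rotated])
qed

lemma smooth_on_open: "smooth_on W f \<Longrightarrow> open W"
  by (simp add: smooth_on_def)

lemma smooth_on_cong:
  "smooth_on W f \<Longrightarrow> (\<And>x. x \<in> W \<Longrightarrow> f x = g x) \<Longrightarrow> smooth_on W g"
  by (simp add: smooth_on_iff_Ck Ck_cong[of W f g])

lemma smooth_on_differentiable: "smooth_on W f \<Longrightarrow> x \<in> W \<Longrightarrow> f differentiable (at x)"
  unfolding smooth_on_iff_Ck using Ck_differentiable by blast

lemma smooth_on_has_derivative:
  "smooth_on W f \<Longrightarrow> x \<in> W \<Longrightarrow> (f has_derivative frechet_derivative f (at x)) (at x)"
  using smooth_on_differentiable frechet_derivative_works by blast

lemma smooth_on_continuous_on: "smooth_on W f \<Longrightarrow> continuous_on W f"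
  using smooth_on_differentiable differentiable_imp_continuous_within
  by (metis continuous_at_imp_continuous_on)

lemma smooth_on_deriv: "smooth_on W f \<Longrightarrow> smooth_on W (\<lambda>x. frechet_derivative f (at x) v)"
  by (metis Ck.simps(2) smooth_on_iff_Ck)

lemma smooth_on_iter_deriv: "smooth_on W f \<Longrightarrow> smooth_on W (iter_deriv vs f)"
  by (induction vs) (auto intro: smooth_on_deriv)

lemma smooth_on_const: "open W \<Longrightarrow> smooth_on W (\<lambda>_. c)"
  by (simp add: smooth_on_iff_Ck Ck_const)

lemma smooth_on_linear: "bounded_linear F \<Longrightarrow> open W \<Longrightarrow> smooth_on W F"
  by (simp add: smooth_on_iff_Ck Ck_subset[OF Ck_linear])

lemma smooth_on_linear_compose: "smooth_on W f \<Longrightarrow> bounded_linear F \<Longrightarrow> smooth_on W (\<lambda>x. F (f x))"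
  using Ck_linear_compose[of F W _ f] by (simp add: smooth_on_iff_Ck)

lemma smooth_on_bilinear:
  "bounded_bilinear B \<Longrightarrow> smooth_on W f \<Longrightarrow> smooth_on W g \<Longrightarrow> smooth_on W (\<lambda>x. B (f x) (g x))"
  using Ck_bilinear[of W B _ f g] by (simp add: smooth_on_iff_Ck)

lemma smooth_on_Pair: "smooth_on W f \<Longrightarrow> smooth_on W g \<Longrightarrow> smooth_on W (\<lambda>x. (f x, g x))"
  using Ck_Pair[of W _ f g] by (simp add: smooth_on_iff_Ck)

lemma smooth_on_compose:
  fixes f :: "'b::euclidean_space \<Rightarrow> 'c::real_normed_vector"
  shows "smooth_on V f \<Longrightarrow> smooth_on W g \<Longrightarrow> (\<And>x. x \<in> W \<Longrightarrow> g x \<in> V) \<Longrightarrow> smooth_on W (\<lambda>x. f (g x))"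
  using Ck_compose[of W V _ f g] by (simp add: smooth_on_iff_Ck)

lemma smooth_on_add: "smooth_on W f \<Longrightarrow> smooth_on W g \<Longrightarrow> smooth_on W (\<lambda>x. f x + g x)"
  using Ck_add[of W _ f g] by (simp add: smooth_on_iff_Ck)

lemma smooth_on_minus: "smooth_on W f \<Longrightarrow> smooth_on W (\<lambda>x. - f x)"
  by (rule smooth_on_linear_compose[OF _ bounded_linear_minus[OF bounded_linear_ident]])

lemma smooth_on_diff: "smooth_on W f \<Longrightarrow> smooth_on W g \<Longrightarrow> smooth_on W (\<lambda>x. f x - g x)"
  using smooth_on_add[OF _ smooth_on_minus, of W f g] by simp

lemmas smooth_on_mult = smooth_on_bilinear[OF bounded_bilinear_mult]
lemmas smooth_on_inner = smooth_on_bilinear[OF bounded_bilinear_inner]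
lemmas smooth_on_scaleR = smooth_on_bilinear[OF bounded_bilinear_scaleR]
lemmas smooth_on_fst = smooth_on_linear_compose[OF _ bounded_linear_fst]
lemmas smooth_on_snd = smooth_on_linear_compose[OF _ bounded_linear_snd]
lemmas smooth_on_of_real = smooth_on_linear_compose[OF _ bounded_linear_of_real]

lemma smooth_on_ident: "open W \<Longrightarrow> smooth_on W (\<lambda>x. x)"
  by (rule smooth_on_linear[OF bounded_linear_ident])

lemma smooth_on_inverse:
  fixes f :: "'a::real_normed_vector \<Rightarrow> real"
  assumes "smooth_on W f" "\<And>x. x \<in> W \<Longrightarrow> f x \<noteq> 0"
  shows "smooth_on W (\<lambda>x. inverse (f x))"
  using assms Ck_compose[of W "- {0}" _ inverse f] Ck_inverse unfolding smooth_on_iff_Ck by auto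

lemma smooth_on_sqrt:
  fixes f :: "'a::real_normed_vector \<Rightarrow> real"
  assumes "smooth_on W f" "\<And>x. x \<in> W \<Longrightarrow> f x > 0"
  shows "smooth_on W (\<lambda>x. sqrt (f x))"
  using assms Ck_compose[of W "{0<..}" _ sqrt f] Ck_sqrt unfolding smooth_on_iff_Ck by auto

lemma smooth_on_norm:
  fixes f :: "'a::real_normed_vector \<Rightarrow> 'b::real_inner"
  assumes "smooth_on W f" "\<And>x. x \<in> W \<Longrightarrow> f x \<noteq> 0"
  shows "smooth_on W (\<lambda>x. norm (f x))"
  unfolding norm_eq_sqrt_inner by (intro smooth_on_sqrt smooth_on_inner) (use assms in auto)

lemma smooth_on_abs:
  fixes f :: "'a::real_normed_vector \<Rightarrow> real"
  assumes "smooth_on W f" "\<And>x. x \<in> W \<Longrightarrow> f x \<noteq> 0"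
  shows "smooth_on W (\<lambda>x. \<bar>f x\<bar>)"
  using smooth_on_norm[of W f] assms by simp

section \<open>A cutoff function\<close>

text \<open>The span of the functions \<open>x\<^sup>-\<^sup>n exp (-1/x)\<close>, extended by zero, is closed under differentiation, which
  gives smoothness of all of them across the origin.\<close>

definition flat :: "nat \<Rightarrow> real \<Rightarrow> real" where
  "flat n x = (if x > 0 then inverse x ^ n * exp (- inverse x) else 0)"

lemma flat_tendsto_0: "(flat n \<longlongrightarrow> 0) (at 0)"
proof -
  have "((\<lambda>x::real. x ^ n / exp x) \<longlongrightarrow> 0) at_top"
    by (rule tendsto_power_div_exp_0)
  then have "((\<lambda>x::real. inverse x ^ n / exp (inverse x)) \<longlongrightarrow> 0) (at_right 0)"
    by (rule filterlim_compose[OF _ filterlim_inverse_at_top_right])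
  then have r: "(flat n \<longlongrightarrow> 0) (at_right 0)"
    by (rule Lim_transform_eventually)
      (auto simp: flat_def exp_minus divide_inverse eventually_at_right_field intro!: exI[of _ 1])
  have l: "(flat n \<longlongrightarrow> 0) (at_left 0)"
    by (rule Lim_transform_eventually[OF tendsto_const])
      (auto simp: flat_def eventually_at_left_field intro!: exI[of _ "-1"])
  from l r show ?thesis by (simp add: filterlim_split_at)
qed

lemma flat_has_derivative:
  "(flat n has_derivative (\<lambda>v. v * (flat (n + 2) x - n * flat (n + 1) x))) (at x)"
proof -
  consider "x < 0" | "x = 0" | "x > 0" using linorder_less_linear[of x 0] by blast
  then have "(flat n has_field_derivative (flat (n + 2) x - n * flat (n + 1) x)) (at x)"
  proof cases
    case 1
    have "((\<lambda>_. 0) has_field_derivative 0) (at x)" by simp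
    then have "(flat n has_field_derivative 0) (at x)"
      by (rule has_field_derivative_transform_within_open[where S="{..<0}"]) (use 1 in \<open>auto simp: flat_def\<close>)
    then show ?thesis using 1 by (simp add: flat_def)
  next
    case 2
    have "((\<lambda>h. (flat n (0 + h) - flat n 0) / h) \<longlongrightarrow> 0) (at 0)"
    proof (rule Lim_transform_eventually[OF flat_tendsto_0[of "Suc n"]])
      show "\<forall>\<^sub>F h in at 0. flat (Suc n) h = (flat n (0 + h) - flat n 0) / h"
        by (auto simp: flat_def field_simps)
    qed
    then show ?thesis using 2 by (simp add: DERIV_def flat_def)
  next
    case 3
    have "((\<lambda>x. inverse x ^ n * exp (- inverse x)) has_field_derivative
        (of_nat n * (- (inverse x ^ 2) * inverse x ^ (n - 1)) * exp (- inverse x)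
          + inverse x ^ n * (exp (- inverse x) * inverse x ^ 2))) (at x)"
      using 3 by (auto intro!: derivative_eq_intros simp: power2_eq_square)
    also have "of_nat n * (- (inverse x ^ 2) * inverse x ^ (n - 1)) * exp (- inverse x)
          + inverse x ^ n * (exp (- inverse x) * inverse x ^ 2) = flat (n + 2) x - n * flat (n + 1) x"
      using 3 by (cases n) (simp_all add: flat_def power2_eq_square algebra_simps)
    finally have "((\<lambda>x. inverse x ^ n * exp (- inverse x)) has_field_derivative
        (flat (n + 2) x - n * flat (n + 1) x)) (at x)" .
    then show ?thesis
      by (rule has_field_derivative_transform_within_open[where S="{0<..}"]) (use 3 in \<open>auto simp: flat_def\<close>)
  qed
  moreover have "(\<lambda>v. v * d) = (*) d" for d :: real by (simp add: fun_eq_iff)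
  ultimately show ?thesis by (simp add: has_field_derivative_def)
qed

lemma smooth_on_flat: "smooth_on UNIV (flat n)"
proof -
  have "Ck m UNIV (flat n)" for m
  proof (induction m arbitrary: n)
    case 0
    show ?case using flat_has_derivative by (auto simp: differentiable_def)
  next
    case (Suc m)
    have "Ck m UNIV (\<lambda>x. v * (flat (n + 2) x + (- real n) * flat (n + 1) x))" for v
      by (intro Ck_bilinear[OF open_UNIV bounded_bilinear_mult] Ck_add[OF open_UNIV] Ck_const Suc)
    then show ?case by (intro Ck_SucI[OF open_UNIV flat_has_derivative]) simp
  qed
  then show ?thesis by (simp add: smooth_on_iff_Ck)
qed

text \<open>The quotient \<open>a / (a + b)\<close> works, where \<open>a\<close> is positive exactly for \<open>|x| < 2\<close> and \<open>b\<close> exactly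
  for \<open>|x| > 1\<close>.\<close>

lemma cutoff_exists:
  obtains \<kappa> :: "real \<Rightarrow> complex" where "\<kappa> \<in> test_functions UNIV" "\<forall>\<^sub>F \<theta> in nhds 0. \<kappa> \<theta> = 1"
proof -
  define a b where "a = (\<lambda>x::real. flat 0 (4 - x * x))" and "b = (\<lambda>x::real. flat 0 (x * x - 1))"
  have nn: "a x \<ge> 0" "b x \<ge> 0" for x by (auto simp: a_def b_def flat_def)
  have pos: "a x + b x > 0" for x
  proof (cases "x * x < 4")
    case True
    then have "a x > 0" by (auto simp: a_def flat_def)
    then show ?thesis using nn(2)[of x] by linarith
  next
    case False
    then have "b x > 0" by (auto simp: b_def flat_def)
    then show ?thesis using nn(1)[of x] by linarith
  qed
  have s: "smooth_on UNIV a" "smooth_on UNIV b"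
    unfolding a_def b_def
    by (rule smooth_on_compose[OF smooth_on_flat];
        (intro smooth_on_diff smooth_on_mult smooth_on_ident smooth_on_const)?; simp)+
  define \<kappa> where "\<kappa> = (\<lambda>x. complex_of_real (a x * inverse (a x + b x)))"
  have "smooth_on UNIV \<kappa>"
    unfolding \<kappa>_def
    by (intro smooth_on_of_real smooth_on_mult smooth_on_inverse smooth_on_add s)
      (metis less_irrefl pos)
  moreover have sub: "{x. \<kappa> x \<noteq> 0} \<subseteq> {-2..2}"
  proof
    fix x assume "x \<in> {x. \<kappa> x \<noteq> 0}"
    then have "x\<^sup>2 \<le> 2\<^sup>2" by (auto simp: \<kappa>_def a_def flat_def power2_eq_square split: if_splits)
    then show "x \<in> {-2..2}" using abs_le_square_iff[of x 2] by auto
  qed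
  have "compact (supp \<kappa>)" unfolding supp_def
    using bounded_closure[OF bounded_subset[OF bounded_closed_interval sub]]
    by (simp add: compact_eq_bounded_closed)
  moreover have "\<forall>\<^sub>F \<theta> in nhds 0. \<kappa> \<theta> = 1"
  proof -
    have "\<kappa> x = 1" if "x \<in> {-1<..<1}" for x
    proof -
      have "x\<^sup>2 < 1" using that abs_square_less_1[of x] by auto
      then have "b x = 0" by (auto simp: b_def flat_def power2_eq_square)
      then show ?thesis using pos[of x] by (simp add: \<kappa>_def)
    qed
    then show ?thesis
      by (auto simp: eventually_nhds intro!: exI[of _ "{-1<..<1}"])
  qed
  ultimately show thesis using that[of \<kappa>] by (auto simp: test_functions_def)
qed

text \<open>The defining condition quantifies over all cutoffs, so that the existence of one is what makes
  the oscillatory integral a definite number.\<close>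

lemma has_osc_integral_unique:
  fixes J :: "real \<Rightarrow> complex"
  assumes "has_osc_integral J l" "has_osc_integral J l'"
  shows "l = l'"
proof -
  obtain \<kappa> :: "real \<Rightarrow> complex" where "\<kappa> \<in> test_functions UNIV" "\<forall>\<^sub>F \<theta> in nhds 0. \<kappa> \<theta> = 1"
    by (rule cutoff_exists)
  then show ?thesis
    using assms tendsto_unique[OF trivial_limit_at_right_real] unfolding has_osc_integral_def by blast
qed

lemma osc_integral_eq:
  fixes J :: "real \<Rightarrow> complex"
  assumes "has_osc_integral J l"
  shows "osc_integral J = l"
  unfolding osc_integral_def using assms has_osc_integral_unique by blast

section \<open>Integrals of compactly supported functions\<close>

text \<open>The kernels below are only continuous off the singular set; multiplication by a test function
  whose support avoids that set gives a globally continuous integrand.\<close>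

lemma continuous_on_mult_vanishing:
  fixes G :: "'a::topological_space \<Rightarrow> complex"
  assumes "open A" "continuous_on A G" "continuous_on UNIV \<phi>" "closed C"
    and "\<And>p. p \<notin> C \<Longrightarrow> \<phi> p = 0" "S \<subseteq> A \<union> - C"
  shows "continuous_on S (\<lambda>p. G p * \<phi> p)"
proof -
  have "continuous_on A (\<lambda>p. G p * \<phi> p)"
    using assms continuous_on_subset by (intro continuous_on_mult) blast+
  moreover have "continuous_on (- C) (\<lambda>p. G p * \<phi> p)"
    using assms(5) by (subst continuous_on_cong[where g = "\<lambda>_. 0"]) auto
  ultimately have "continuous_on (A \<union> - C) (\<lambda>p. G p * \<phi> p)"
    using assms by (intro continuous_on_open_Un) auto
  then show ?thesis using assms(6) continuous_on_subset by blast
qed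

text \<open>The passage between the Lebesgue integral and the gauge integral over a box, for which a Leibniz
  rule is available.\<close>

lemma compactly_supported_integral:
  fixes f :: "'a::euclidean_space \<Rightarrow> complex"
  assumes "continuous_on UNIV f" "\<And>u. u \<notin> cbox a b \<Longrightarrow> f u = 0"
  shows "integrable lborel f" "integral (cbox a b) f = integral\<^sup>L lborel f"
proof -
  have "(\<lambda>x. indicator (cbox a b) x *\<^sub>R f x) = f"
    using assms(2) by (auto simp: indicator_def)
  then show i: "integrable lborel f"
    using borel_integrable_compact[OF compact_cbox continuous_on_subset[OF assms(1) subset_UNIV], of a b]
    by simp
  have "(\<lambda>x. if x \<in> cbox a b then f x else 0) = f" using assms(2) by auto
  then show "integral (cbox a b) f = integral\<^sup>L lborel f"
    using has_integral_integral_lborel[OF i] has_integral_restrict_UNIV[of "cbox a b" f "integral\<^sup>L lborel f"]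
    by (simp add: integral_unique)
qed

lemma compact_in_cbox:
  fixes K :: "'a::euclidean_space set"
  assumes "compact K"
  obtains a b where "K \<subseteq> cbox a b"
  using bounded_subset_cbox_symmetric[OF compact_imp_bounded[OF assms]] by metis

text \<open>By Fubini and the fundamental theorem of calculus in \<open>t\<close>: the boundary terms lie outside the
  support.\<close>

lemma integral_last_variable_derivative_zero:
  fixes F F' :: "'y::euclidean_space \<times> real \<Rightarrow> complex"
  assumes "compact K" "\<And>y t. ((\<lambda>t. F (y, t)) has_vector_derivative F' (y, t)) (at t)"
    and "continuous_on UNIV F'" "\<And>u. u \<notin> K \<Longrightarrow> F u = 0" "\<And>u. u \<notin> K \<Longrightarrow> F' u = 0"
  shows "integral\<^sup>L lborel F' = 0"
proof -
  obtain p q where K: "K \<subseteq> cbox p q" using compact_in_cbox assms(1) .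
  obtain a b where pq: "cbox p q = cbox (fst p) (fst q) \<times> {a..b}" "a = snd p" "b = snd q"
    by (cases p, cases q) (auto simp: cbox_Pair_eq)
  define a' b' where "a' = min a b - 1" and "b' = max a b + 1"
  have out: "F (y, t) = 0 \<and> F' (y, t) = 0" if "t \<notin> {a..b}" for y t
  proof -
    have "(y, t) \<notin> cbox p q" unfolding pq(1) using that by simp
    then have "(y, t) \<notin> K" using K by blast
    then show ?thesis using assms(4,5) by blast
  qed
  have "integrable lborel F'"
    by (rule compactly_supported_integral[OF assms(3)]) (use assms(5) K in blast)
  then have i: "integrable (lborel \<Otimes>\<^sub>M lborel) F'" by (simp add: lborel_prod)
  have sub: "{a..b} \<subseteq> cbox a' b'" by (auto simp: a'_def b'_def)
  have z: "(LINT t|lborel. F' (y, t)) = 0" for y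
  proof -
    have c: "continuous_on UNIV (\<lambda>t. F' (y, t))"
      by (rule continuous_on_compose2[OF assms(3)]) (auto intro!: continuous_intros)
    have "((\<lambda>t. F' (y, t)) has_integral F (y, b') - F (y, a')) {a'..b'}"
      by (rule fundamental_theorem_of_calculus)
        (use assms(2) in \<open>auto simp: a'_def b'_def intro: has_vector_derivative_at_within\<close>)
    moreover have "b' \<notin> {a..b}" "a' \<notin> {a..b}" by (auto simp: a'_def b'_def)
    then have "F (y, b') = 0" "F (y, a') = 0" using out by blast+
    moreover have "integral (cbox a' b') (\<lambda>t. F' (y, t)) = (LINT t|lborel. F' (y, t))"
      by (rule compactly_supported_integral(2)[OF c]) (use out sub in blast)
    ultimately show ?thesis by (auto simp: integral_unique)
  qed
  have "integral\<^sup>L lborel F' = integral\<^sup>L (lborel \<Otimes>\<^sub>M lborel) F'" by (simp add: lborel_prod)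
  also have "\<dots> = (LINT y|lborel. LINT t|lborel. F' (y, t))"
    using lborel_pair.integral_fst'[OF i] by simp
  finally show ?thesis using z by simp
qed

section \<open>The regularised kernel\<close>

text \<open>The growth \<open>|\<omega>|\<close> of the amplitude, damped by two applications of an integration by parts that each
  supply a factor \<open>(1 + \<omega>\<^sup>2)\<^sup>-\<^sup>1\<close>.  Even \<open>\<omega> weight \<omega>\<close> is integrable, so that the Fourier transform of the
  weight is of class \<open>C\<^sup>1\<close>.\<close>

definition weight :: "real \<Rightarrow> real" where
  "weight \<omega> = \<bar>\<omega>\<bar> / (1 + \<omega>\<^sup>2)\<^sup>2"

definition regular_kernel :: "real \<Rightarrow> complex" where
  "regular_kernel s = (LINT \<omega>|lborel. weight \<omega> * exp (\<i> * of_real (\<omega> * s)))"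

definition regular_kernel' :: "real \<Rightarrow> complex" where
  "regular_kernel' s = (LINT \<omega>|lborel. \<i> * of_real (\<omega> * weight \<omega>) * exp (\<i> * of_real (\<omega> * s)))"

lemma integrable_inverse_square: "integrable lborel (\<lambda>x::real. inverse (1 + x\<^sup>2))"
  using integrable_inverse_1_plus_square by (simp add: set_integrable_def)

lemma weight_le: "weight \<omega> \<le> inverse (1 + \<omega>\<^sup>2)" "\<bar>\<omega> * weight \<omega>\<bar> \<le> inverse (1 + \<omega>\<^sup>2)"
  "0 \<le> weight \<omega>"
proof -
  have p: "1 + \<omega>\<^sup>2 > 0" by (simp add: add_pos_nonneg)
  have "0 \<le> (\<bar>\<omega>\<bar> - 1)\<^sup>2" by simp
  then have "2 * \<bar>\<omega>\<bar> \<le> 1 + \<omega>\<^sup>2" by (simp add: power2_diff)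
  then have "\<bar>\<omega>\<bar> \<le> 1 + \<omega>\<^sup>2" by linarith
  then have "\<bar>\<omega>\<bar> / (1 + \<omega>\<^sup>2)\<^sup>2 \<le> (1 + \<omega>\<^sup>2) / (1 + \<omega>\<^sup>2)\<^sup>2" by (intro divide_right_mono) auto
  moreover have "\<bar>\<omega>\<bar> * \<bar>\<omega>\<bar> / (1 + \<omega>\<^sup>2)\<^sup>2 \<le> (1 + \<omega>\<^sup>2) / (1 + \<omega>\<^sup>2)\<^sup>2"
    by (intro divide_right_mono) (auto simp: power2_eq_square)
  moreover have "(1 + \<omega>\<^sup>2) / (1 + \<omega>\<^sup>2)\<^sup>2 = inverse (1 + \<omega>\<^sup>2)"
    using p by (simp add: power2_eq_square divide_inverse)
  ultimately show "weight \<omega> \<le> inverse (1 + \<omega>\<^sup>2)" "\<bar>\<omega> * weight \<omega>\<bar> \<le> inverse (1 + \<omega>\<^sup>2)"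
    by (simp_all add: weight_def abs_mult)
  show "0 \<le> weight \<omega>" by (simp add: weight_def)
qed

lemma borel_measurable_weight [measurable]: "weight \<in> borel_measurable borel"
  unfolding weight_def by measurable

lemma norm_exp_i_real: "norm (exp (\<i> * complex_of_real r)) = 1"
  by (simp add: norm_exp_eq_Re)

lemma norm_exp_i_diff_le: "norm (exp (\<i> * complex_of_real r) - 1) \<le> \<bar>r\<bar>"
  using iexp_approx1[of r 0] by simp

lemma regular_kernel_bounded: "norm (regular_kernel s) \<le> pi"
proof -
  have i: "integrable lborel (\<lambda>\<omega>. norm (weight \<omega> * exp (\<i> * complex_of_real (\<omega> * s))))"
    by (rule Bochner_Integration.integrable_bound[OF integrable_inverse_square])
      (auto simp: norm_mult norm_exp_i_real weight_le intro!: AE_I2 simp del: of_real_mult)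
  have "norm (regular_kernel s) \<le> (LINT \<omega>|lborel. norm (weight \<omega> * exp (\<i> * complex_of_real (\<omega> * s))))"
    unfolding regular_kernel_def by (rule integral_norm_bound)
  also have "\<dots> \<le> (LINT \<omega>|lborel. inverse (1 + \<omega>\<^sup>2))"
    by (rule integral_mono[OF i integrable_inverse_square])
      (simp add: norm_mult norm_exp_i_real weight_le del: of_real_mult)
  also have "\<dots> = pi"
    using LBINT_inverse_1_plus_square by (simp add: interval_lebesgue_integral_def set_lebesgue_integral_def)
  finally show ?thesis .
qed

lemma has_vector_derivative_iff_quotient:
  fixes f :: "real \<Rightarrow> 'b::real_normed_vector"
  shows "(f has_vector_derivative D) (at s) \<longleftrightarrow> ((\<lambda>h. (f (s + h) - f s) /\<^sub>R h) \<longlongrightarrow> D) (at 0)"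
proof -
  have eq: "norm ((f (s + h) - f s) /\<^sub>R h - D) = norm (f (s + h) - f s - h *\<^sub>R D) / norm h"
    if "h \<noteq> 0" for h
  proof -
    have "(f (s + h) - f s) /\<^sub>R h - D = (f (s + h) - f s - h *\<^sub>R D) /\<^sub>R h"
      using that by (simp add: scaleR_diff_right)
    then show ?thesis by (simp add: divide_inverse mult.commute)
  qed
  have "((\<lambda>h. (f (s + h) - f s) /\<^sub>R h) \<longlongrightarrow> D) (at 0) \<longleftrightarrow>
      ((\<lambda>h. norm ((f (s + h) - f s) /\<^sub>R h - D)) \<longlongrightarrow> 0) (at 0)"
    by (simp add: tendsto_norm_zero_iff LIM_zero_iff)
  also have "\<dots> \<longleftrightarrow> ((\<lambda>h. norm (f (s + h) - f s - h *\<^sub>R D) / norm h) \<longlongrightarrow> 0) (at 0)"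
    by (rule Lim_cong_within) (use eq in auto)
  also have "\<dots> \<longleftrightarrow> (f has_vector_derivative D) (at s)"
    by (simp add: has_vector_derivative_def has_derivative_at bounded_linear_scaleR_left)
  finally show ?thesis by simp
qed

text \<open>Dominated convergence of the difference quotients, using \<open>|exp (i r) - 1| \<le> |r|\<close>.\<close>

lemma regular_kernel_deriv: "(regular_kernel has_vector_derivative regular_kernel' s) (at s)"
proof -
  define f where "f = (\<lambda>s \<omega>. weight \<omega> * exp (\<i> * complex_of_real (\<omega> * s)))"
  have int: "integrable lborel (f s)" for s
    by (rule Bochner_Integration.integrable_bound[OF integrable_inverse_square])
      (auto simp: f_def norm_mult norm_exp_i_real weight_le intro!: AE_I2)
  have "((\<lambda>h. (regular_kernel (s + h) - regular_kernel s) /\<^sub>R h) \<longlongrightarrow> regular_kernel' s) (at 0)"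
    unfolding tendsto_at_iff_sequentially
  proof (intro allI impI)
    fix X :: "nat \<Rightarrow> real" assume X: "\<forall>i. X i \<in> UNIV - {0}" "X \<longlonglongrightarrow> 0"
    have "(\<lambda>i. LINT \<omega>|lborel. (f (s + X i) \<omega> - f s \<omega>) /\<^sub>R X i) \<longlonglongrightarrow>
        (LINT \<omega>|lborel. \<i> * of_real (\<omega> * weight \<omega>) * exp (\<i> * of_real (\<omega> * s)))"
    proof (rule integral_dominated_convergence[OF _ _ integrable_inverse_square])
      show "AE \<omega> in lborel. (\<lambda>i. (f (s + X i) \<omega> - f s \<omega>) /\<^sub>R X i) \<longlonglongrightarrow>
          \<i> * of_real (\<omega> * weight \<omega>) * exp (\<i> * of_real (\<omega> * s))"
      proof (rule AE_I2)
        fix \<omega>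
        have "((\<lambda>s. f s \<omega>) has_vector_derivative
            \<i> * of_real (\<omega> * weight \<omega>) * exp (\<i> * of_real (\<omega> * s))) (at s)"
          unfolding f_def
          by (rule has_vector_derivative_real_field | (auto intro!: derivative_eq_intros))+
        then have "((\<lambda>h. (f (s + h) \<omega> - f s \<omega>) /\<^sub>R h) \<longlongrightarrow> 
            \<i> * of_real (\<omega> * weight \<omega>) * exp (\<i> * of_real (\<omega> * s))) (at 0)"
          by (simp only: has_vector_derivative_iff_quotient)

        then show "(\<lambda>i. (f (s + X i) \<omega> - f s \<omega>) /\<^sub>R X i) \<longlonglongrightarrow>
            \<i> * of_real (\<omega> * weight \<omega>) * exp (\<i> * of_real (\<omega> * s))"
          using X unfolding tendsto_at_iff_sequentially comp_def by blast
      qed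
      show "AE \<omega> in lborel. norm ((f (s + X i) \<omega> - f s \<omega>) /\<^sub>R X i) \<le> inverse (1 + \<omega>\<^sup>2)" for i
      proof (rule AE_I2)
        fix \<omega>
        have "f (s + X i) \<omega> - f s \<omega> = 
            weight \<omega> * exp (\<i> * of_real (\<omega> * s)) * (exp (\<i> * complex_of_real (\<omega> * X i)) - 1)"
          by (simp add: f_def algebra_simps flip: exp_add)
        then have "norm (f (s + X i) \<omega> - f s \<omega>) \<le> weight \<omega> * \<bar>\<omega> * X i\<bar>"
          using norm_exp_i_diff_le[of "\<omega> * X i"] weight_le(3)[of \<omega>]
          by (simp add: norm_mult norm_exp_i_real mult_left_mono del: of_real_mult)
        then have "norm ((f (s + X i) \<omega> - f s \<omega>) /\<^sub>R X i) \<le> \<bar>\<omega> * weight \<omega>\<bar>"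
        proof -
          assume le: "norm (f (s + X i) \<omega> - f s \<omega>) \<le> weight \<omega> * \<bar>\<omega> * X i\<bar>"
          have "X i \<noteq> 0" using X(1) by auto
          have "norm ((f (s + X i) \<omega> - f s \<omega>) /\<^sub>R X i) = norm (f (s + X i) \<omega> - f s \<omega>) / \<bar>X i\<bar>"
            by (simp only: norm_scaleR abs_inverse divide_inverse mult.commute)
          also have "\<dots> \<le> weight \<omega> * \<bar>\<omega> * X i\<bar> / \<bar>X i\<bar>"
            using le by (rule divide_right_mono) simp
          also have "\<dots> = \<bar>\<omega> * weight \<omega>\<bar>"
            using \<open>X i \<noteq> 0\<close> weight_le(3)[of \<omega>] by (simp add: abs_mult)
          finally show ?thesis .
        qed
        then show "norm ((f (s + X i) \<omega> - f s \<omega>) /\<^sub>R X i) \<le> inverse (1 + \<omega>\<^sup>2)"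
          using weight_le(2)[of \<omega>] by linarith
      qed
    qed (auto simp: f_def)
    moreover have "(LINT \<omega>|lborel. (f (s + h) \<omega> - f s \<omega>) /\<^sub>R h) = 
        (regular_kernel (s + h) - regular_kernel s) /\<^sub>R h" for h
    proof -
      have "regular_kernel s = integral\<^sup>L lborel (f s)" for s
        by (simp add: regular_kernel_def f_def)
      then show ?thesis
        by (simp only: integral_scaleR_right Bochner_Integration.integral_diff[OF int int])
    qed
    then have "(\<lambda>i. LINT \<omega>|lborel. (f (s + X i) \<omega> - f s \<omega>) /\<^sub>R X i) =
        (\<lambda>h. (regular_kernel (s + h) - regular_kernel s) /\<^sub>R h) \<circ> X"
      by (simp only: comp_def)
    ultimately show "((\<lambda>h. (regular_kernel (s + h) - regular_kernel s) /\<^sub>R h) \<circ> X) \<longlonglongrightarrow> regular_kernel' s"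
      unfolding regular_kernel'_def by (simp only:)
  qed
  then show ?thesis by (simp only: has_vector_derivative_iff_quotient)
qed

lemma regular_kernel'_continuous: "continuous_on UNIV regular_kernel'"
  unfolding continuous_on_eq_continuous_at[OF open_UNIV] continuous_at_sequentially
proof (intro ballI allI impI)
  fix s :: real and X assume X: "X \<longlonglongrightarrow> s"
  have "(\<lambda>i. regular_kernel' (X i)) \<longlonglongrightarrow> regular_kernel' s"
    unfolding regular_kernel'_def
    by (rule integral_dominated_convergence[OF _ _ integrable_inverse_square])
      (use X weight_le(2) in \<open>auto simp: norm_mult norm_exp_i_real intro!: AE_I2 tendsto_intros simp flip: of_real_mult abs_mult\<close>)
  then show "(regular_kernel' \<circ> X) \<longlonglongrightarrow> regular_kernel' s" by (simp add: comp_def)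
qed

section \<open>Integral operators with a moving singularity\<close>

text \<open>The situation abstracted from the Radon transform: a phase \<open>t - Q (y, x)\<close> and amplitudes that
  are smooth on an open set of pairs \<open>(y, x)\<close>, tested with functions supported in a fixed compact
  set of \<open>(y, t)\<close>.  The set \<open>W\<close> collects the points \<open>x\<close> that meet no singularity for \<open>(y, t)\<close>
  in this compact set.\<close>

locale level_set_phase =
  fixes Q :: "'y::euclidean_space \<times> 'v::euclidean_space \<Rightarrow> real"
    and G :: "('y \<times> 'v) set" and K :: "('y \<times> real) set"
  assumes smooth_Q: "smooth_on G Q" and compact_K: "compact K"
begin

definition W :: "'v set" where
  "W = {x. \<forall>y \<in> fst ` K. (y, x) \<in> G}"

definition vanishing :: "('y \<times> real \<Rightarrow> complex) \<Rightarrow> bool" where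
  "vanishing \<phi> \<longleftrightarrow> smooth_on UNIV \<phi> \<and> (\<forall>u. u \<notin> K \<longrightarrow> \<phi> u = 0)"

abbreviation integrand :: "(real \<Rightarrow> complex) \<Rightarrow> ('y \<times> 'v \<Rightarrow> complex) \<Rightarrow> ('y \<times> real \<Rightarrow> complex) \<Rightarrow>
    'v \<Rightarrow> 'y \<times> real \<Rightarrow> complex" where
  "integrand e b \<phi> x u \<equiv> e (snd u - Q (fst u, x)) * b (fst u, x) * \<phi> u"

definition kernel_integral ::
  "(real \<Rightarrow> complex) \<Rightarrow> ('y \<times> 'v \<Rightarrow> complex) \<Rightarrow> ('y \<times> real \<Rightarrow> complex) \<Rightarrow> 'v \<Rightarrow> complex" where
  "kernel_integral e b \<phi> x = (LINT u|lborel. integrand e b \<phi> x u)"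

abbreviation time_deriv :: "nat \<Rightarrow> ('y \<times> real \<Rightarrow> complex) \<Rightarrow> 'y \<times> real \<Rightarrow> complex" where
  "time_deriv j \<equiv> iter_deriv (replicate j (0, 1))"

definition D :: "'v \<Rightarrow> ('y \<times> 'v \<Rightarrow> 'c::real_normed_vector) \<Rightarrow> 'y \<times> 'v \<Rightarrow> 'c" where
  "D v b p = frechet_derivative b (at p) (0, v)"

lemma open_G: "open G"
  using smooth_Q smooth_on_open by blast

lemma open_W: "open W"
proof (rule Topological_Spaces.openI)
  fix x assume "x \<in> W"
  then have "{x} \<times> fst ` K \<subseteq> (\<lambda>(x, y). (y, x)) -` G" by (auto simp: W_def)
  moreover have "open ((\<lambda>(x, y). (y, x)) -` G)"
    by (rule open_vimage[OF open_G]) (auto simp: case_prod_beta' intro!: continuous_intros)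
  moreover have "compact (fst ` K)"
    by (rule compact_continuous_image[OF continuous_on_fst[OF continuous_on_id] compact_K])
  ultimately have "\<exists>X. x \<in> X \<and> open X \<and> X \<times> fst ` K \<subseteq> (\<lambda>(x, y). (y, x)) -` G"
    by (intro Elementary_Topology.tube_lemma)
  then obtain X where X: "x \<in> X" "open X" "X \<times> fst ` K \<subseteq> (\<lambda>(x, y). (y, x)) -` G" by blast
  have "X \<subseteq> W"
  proof
    fix z assume "z \<in> X"
    have "(y, z) \<in> G" if "y \<in> fst ` K" for y
      using subsetD[OF X(3), of "(z, y)"] \<open>z \<in> X\<close> that by simp
    then show "z \<in> W" by (simp add: W_def)
  qed
  with X show "\<exists>T. open T \<and> x \<in> T \<and> T \<subseteq> W" by blast
qed

lemma smooth_D: "smooth_on G b \<Longrightarrow> smooth_on G (D v b)"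
  unfolding D_def by (rule smooth_on_deriv)

lemma vanishing_time_deriv: "vanishing \<phi> \<Longrightarrow> vanishing (time_deriv j \<phi>)"
proof -
  assume v: "vanishing \<phi>"
  have "time_deriv j \<phi> u = 0" if "u \<notin> K" for u
  proof -
    have "time_deriv j \<phi> u = time_deriv j (\<lambda>_. 0) u"
      using v compact_imp_closed[OF compact_K] that
      by (intro iter_deriv_cong_open[of "- K"]) (auto simp: vanishing_def)
    moreover have "iter_deriv vs (\<lambda>_. 0::complex) = (\<lambda>_. 0)" for vs :: "('y \<times> real) list"
      by (induction vs) auto
    ultimately show ?thesis by (simp only:)
  qed
  then show ?thesis using v smooth_on_iter_deriv by (auto simp: vanishing_def)
qed

lemma vanishing_outside: "vanishing \<phi> \<Longrightarrow> u \<notin> K \<Longrightarrow> \<phi> u = 0"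
  unfolding vanishing_def by blast

lemma continuous_on_vanishing: "vanishing \<phi> \<Longrightarrow> continuous_on UNIV \<phi>"
  unfolding vanishing_def using smooth_on_continuous_on by blast

lemma continuous_on_integrand:
  fixes e :: "real \<Rightarrow> complex"
  assumes "continuous_on UNIV e" "continuous_on G b" "continuous_on UNIV \<phi>" "\<And>u. u \<notin> K \<Longrightarrow> \<phi> u = 0"
  shows "continuous_on (W \<times> UNIV) (\<lambda>(x, u). integrand e b \<phi> x u)"
proof -
  define A where "A = {z :: 'v \<times> ('y \<times> real). (fst (snd z), fst z) \<in> G}"
  have cA: "continuous_on A (\<lambda>z. (fst (snd z), fst z))" by (intro continuous_intros)
  have "open A"
  proof -
    have "continuous_on UNIV (\<lambda>z :: 'v \<times> ('y \<times> real). (fst (snd z), fst z))" by (intro continuous_intros)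
    from open_vimage[OF open_G this] show ?thesis by (simp add: A_def vimage_def)
  qed
  moreover have "continuous_on A (\<lambda>z. Q (fst (snd z), fst z))"
    by (rule continuous_on_compose2[OF smooth_on_continuous_on[OF smooth_Q] cA]) (auto simp: A_def)
  then have "continuous_on A (\<lambda>z. snd (snd z) - Q (fst (snd z), fst z))"
    by (intro continuous_intros)
  then have "continuous_on A (\<lambda>z. e (snd (snd z) - Q (fst (snd z), fst z)))"
    by (rule continuous_on_compose2[OF assms(1)]) simp
  then have "continuous_on A (\<lambda>z. e (snd (snd z) - Q (fst (snd z), fst z)) * b (fst (snd z), fst z))"
    by (rule continuous_on_mult) (rule continuous_on_compose2[OF assms(2) cA], auto simp: A_def)
  ultimately have "continuous_on (W \<times> UNIV)
      (\<lambda>z. e (snd (snd z) - Q (fst (snd z), fst z)) * b (fst (snd z), fst z) * \<phi> (snd z))"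
  proof (rule continuous_on_mult_vanishing[where C = "UNIV \<times> K"])
    show "continuous_on UNIV (\<lambda>z. \<phi> (snd z))"
      by (rule continuous_on_compose2[OF assms(3)]) (auto intro!: continuous_intros)
    show "closed (UNIV \<times> K)" using compact_imp_closed[OF compact_K] by (intro closed_Times) auto
    show "W \<times> UNIV \<subseteq> A \<union> - (UNIV \<times> K)"
      by (force simp: W_def A_def)
    show "\<phi> (snd z) = 0" if "z \<notin> UNIV \<times> K" for z :: "'v \<times> 'y \<times> real"
      using assms(4)[of "snd z"] that by (simp add: mem_Times_iff)
  qed
  then show ?thesis by (simp add: case_prod_beta')
qed

lemma integrand_facts:
  assumes "continuous_on UNIV e" "smooth_on G b" "vanishing \<phi>" "x \<in> W"
  shows "continuous_on UNIV (integrand e b \<phi> x)"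
    and "integrable lborel (integrand e b \<phi> x)"
proof -
  show c: "continuous_on UNIV (integrand e b \<phi> x)"
  proof -
    have "continuous_on UNIV (Pair x :: _ \<Rightarrow> _ \<times> 'y \<times> real)" by (intro continuous_intros)
    with continuous_on_compose2[OF continuous_on_integrand[OF assms(1) smooth_on_continuous_on[OF assms(2)], of \<phi>],
        of UNIV "Pair x"] assms(3,4) smooth_on_continuous_on
    show ?thesis by (auto simp: vanishing_def)
  qed
  obtain p q where "K \<subseteq> cbox p q" using compact_in_cbox compact_K .
  then show "integrable lborel (integrand e b \<phi> x)"
    using assms(3) unfolding vanishing_def by (intro compactly_supported_integral(1)[OF c]) auto
qed

text \<open>Differentiating the kernel in \<open>x\<close> moves a derivative to \<open>t\<close>, which integration by parts
  then puts on the test function.\<close>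

lemma kernel_integral_by_parts:
  assumes e: "\<And>s. (e has_vector_derivative e' s) (at s)" "continuous_on UNIV e'"
    and "smooth_on G b" "vanishing \<phi>" "x \<in> W"
  shows "kernel_integral e' b \<phi> x = - kernel_integral e b (time_deriv 1 \<phi>) x"
proof -
  have ce: "continuous_on UNIV e"
    by (intro continuous_at_imp_continuous_on ballI has_vector_derivative_continuous[OF e(1)])
  note f1 = integrand_facts[OF e(2) assms(3-5)]
  note f2 = integrand_facts[OF ce assms(3) vanishing_time_deriv[OF assms(4), of 1] assms(5)]
  let ?F = "\<lambda>u. integrand e b \<phi> x u"
  let ?F' = "\<lambda>u. integrand e' b \<phi> x u
    + integrand e b (time_deriv 1 \<phi>) x u"
  have "integral\<^sup>L lborel ?F' = 0"
  proof (rule integral_last_variable_derivative_zero[OF compact_K, where F = ?F])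
    fix y t
    have 1: "((\<lambda>t. e (t - Q (y, x))) has_vector_derivative e' (t - Q (y, x))) (at t)"
    proof -
      have "((\<lambda>t. t - Q (y, x)) has_vector_derivative 1) (at t)"
        by (auto intro!: derivative_eq_intros)
      from vector_diff_chain_at[OF this e(1)] show ?thesis by (simp add: o_def)
    qed
    have 2: "((\<lambda>t. \<phi> (y, t)) has_vector_derivative time_deriv 1 \<phi> (y, t)) (at t)"
    proof -
      have p: "((\<lambda>t. (y, t)) has_derivative (\<lambda>h. (0, h))) (at t)" by (auto intro!: derivative_eq_intros)
      have d: "(\<phi> has_derivative frechet_derivative \<phi> (at (y, t))) (at (y, t))"
        using assms(4) smooth_on_has_derivative by (auto simp: vanishing_def)
      have "((\<lambda>t. \<phi> (y, t)) has_derivative (\<lambda>h. frechet_derivative \<phi> (at (y, t)) (0, h))) (at t)"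
        using has_derivative_compose[OF p d] .
      moreover have "(\<lambda>h. frechet_derivative \<phi> (at (y, t)) (0, h)) = (\<lambda>h. h *\<^sub>R time_deriv 1 \<phi> (y, t))"
      proof
        fix h :: real
        show "frechet_derivative \<phi> (at (y, t)) (0, h) = h *\<^sub>R time_deriv 1 \<phi> (y, t)"
          using linear_cmul[OF has_derivative_linear[OF d], of h "(0, 1)"] by simp
      qed
      ultimately show ?thesis by (simp only: has_vector_derivative_def)
    qed
    show "((\<lambda>t. ?F (y, t)) has_vector_derivative ?F' (y, t)) (at t)"
      using has_vector_derivative_mult[OF has_vector_derivative_mult_left[OF 1, of "b (y, x)"] 2]
      by (simp only: fst_conv snd_conv add.commute)
    show "continuous_on UNIV ?F'" by (rule continuous_on_add[OF f1(1) f2(1)])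
    show "?F u = 0" "?F' u = 0" if "u \<notin> K" for u
      using vanishing_outside[OF assms(4) that] vanishing_outside[OF vanishing_time_deriv[OF assms(4)] that, of 1]
      by simp_all
  qed
  then show ?thesis
    using f1(2) f2(2) by (simp add: kernel_integral_def eq_neg_iff_add_eq_0)
qed

lemma D_has_derivative:
  assumes "smooth_on G b" "(y, x) \<in> G"
  shows "((\<lambda>x. b (y, x)) has_derivative (\<lambda>v. D v b (y, x))) (at x)"
proof -
  have p: "((\<lambda>x. (y, x)) has_derivative (\<lambda>h. (0, h))) (at x)" by (auto intro!: derivative_eq_intros)
  show ?thesis
    using has_derivative_compose[OF p smooth_on_has_derivative[OF assms]] by (simp add: D_def)
qed

text \<open>The derivative is again a sum of kernel integrals with the same \<open>e\<close>: no regularity of \<open>e\<close> beyond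
  \<open>C\<^sup>1\<close> is consumed, and the step can be iterated indefinitely.\<close>

lemma kernel_integral_has_derivative:
  assumes e: "\<And>s. (e has_vector_derivative e' s) (at s)" "continuous_on UNIV e'"
    and b: "smooth_on G b" and \<phi>: "vanishing \<phi>" and x: "x \<in> W"
  shows "(kernel_integral e b \<phi> has_derivative
    (\<lambda>v. kernel_integral e (D v b) \<phi> x
       + kernel_integral e (\<lambda>p. b p * of_real (D v Q p)) (time_deriv 1 \<phi>) x)) (at x)"
proof -
  have ce: "continuous_on UNIV e"
    by (intro continuous_at_imp_continuous_on ballI has_vector_derivative_continuous[OF e(1)])
  have sbD: "smooth_on G (\<lambda>p. b p * of_real (D v Q p))" for v
    by (intro smooth_on_mult b smooth_on_of_real smooth_D smooth_Q)
  obtain p q where K: "K \<subseteq> cbox p q" using compact_in_cbox compact_K .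
  have out: "\<phi> u = 0" if "u \<notin> cbox p q" for u using vanishing_outside[OF \<phi>] K that by blast
  obtain r where r: "r > 0" "ball x r \<subseteq> W" using open_W x open_contains_ball by blast
  let ?f = "\<lambda>x u. integrand e b \<phi> x u"
  define f' where "f' = (\<lambda>x u v. integrand e (D v b) \<phi> x u
      - e' (snd u - Q (fst u, x)) * (b (fst u, x) * of_real (D v Q (fst u, x))) * \<phi> u)"
  have der: "((\<lambda>x. ?f x u) has_derivative f' x u) (at x)" if "x \<in> W" for x u
  proof (cases "u \<in> K")
    case True
    then have yG: "(fst u, x) \<in> G" using that by (force simp: W_def)
    have "((\<lambda>x. snd u - Q (fst u, x)) has_derivative (\<lambda>v. - D v Q (fst u, x))) (at x)"
      by (auto intro!: derivative_eq_intros D_has_derivative[OF smooth_Q yG])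
    from has_derivative_compose[OF this e(1)[unfolded has_vector_derivative_def]]
    have 1: "((\<lambda>x. e (snd u - Q (fst u, x))) has_derivative
        (\<lambda>v. (- D v Q (fst u, x)) *\<^sub>R e' (snd u - Q (fst u, x)))) (at x)" by simp
    show ?thesis
      unfolding f'_def
      by (rule has_derivative_eq_rhs[OF has_derivative_mult_left[OF has_derivative_mult[OF 1 D_has_derivative[OF b yG]]]])
        (simp add: algebra_simps scaleR_conv_of_real)
  next
    case False
    then have "\<phi> u = 0" using vanishing_outside[OF \<phi>] by blast
    then show ?thesis by (simp add: f'_def)
  qed
  have cont: "continuous_on (W \<times> UNIV) (\<lambda>(x, u). f' x u v)" for v
    using continuous_on_diff[OF
        continuous_on_integrand[OF ce smooth_on_continuous_on[OF smooth_D[OF b]], of \<phi> v]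
        continuous_on_integrand[OF e(2) smooth_on_continuous_on[OF sbD], of \<phi> v]]
      \<phi> smooth_on_continuous_on
    by (auto simp: vanishing_def f'_def case_prod_beta')
  define fx where "fx = (\<lambda>x u. Blinfun (f' x u))"
  have fx: "blinfun_apply (fx x u) = f' x u" if "x \<in> W" for x u
    unfolding fx_def using bounded_linear_Blinfun_apply[OF has_derivative_bounded_linear[OF der[OF that]]] .
  have cu: "continuous_on UNIV (?f x)" if "x \<in> W" for x
    using integrand_facts(1)[OF ce b \<phi> that] .
  have cfx: "continuous_on (ball x r \<times> cbox p q) (\<lambda>(x, u). fx x u)"
  proof (rule continuous_on_blinfun_componentwise)
    fix i :: 'v
    have "continuous_on (ball x r \<times> cbox p q) (\<lambda>(x, u). f' x u i)"
      by (rule continuous_on_subset[OF cont]) (use r in auto)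
    then show "continuous_on (ball x r \<times> cbox p q) (\<lambda>z. blinfun_apply (case z of (x, u) \<Rightarrow> fx x u) i)"
      by (rule continuous_on_cong[THEN iffD1, rotated 2]) (use fx r in auto)
  qed
  have "((\<lambda>x. integral (cbox p q) (?f x)) has_derivative integral (cbox p q) (fx x)) (at x within ball x r)"
  proof (rule leibniz_rule[OF _ _ cfx])
    show "((\<lambda>x. ?f x u) has_derivative blinfun_apply (fx z u)) (at z within ball x r)"
      if "z \<in> ball x r" for z u
      using der[of z u] fx[of z u] that r has_derivative_at_withinI by force
    show "?f z integrable_on cbox p q" if "z \<in> ball x r" for z
    proof -
      have "z \<in> W" using that r by blast
      from integrable_continuous[OF continuous_on_subset[OF cu[OF this] subset_UNIV]] show ?thesis .
    qed
  qed (use r in auto)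
  then have d: "((\<lambda>x. integral (cbox p q) (?f x)) has_derivative integral (cbox p q) (fx x)) (at x)"
    using r by (simp add: at_within_open[of x "ball x r"])
  have k: "integral (cbox p q) (?f z) = kernel_integral e b \<phi> z" if "z \<in> W" for z
    unfolding kernel_integral_def
    by (rule compactly_supported_integral(2)[OF cu[OF that]]) (use out in auto)
  have d': "(kernel_integral e b \<phi> has_derivative integral (cbox p q) (fx x)) (at x)"
    by (rule has_derivative_transform_within_open[OF d open_W x k])
  have "integral (cbox p q) (fx x) v = kernel_integral e (D v b) \<phi> x
       + kernel_integral e (\<lambda>p. b p * of_real (D v Q p)) (time_deriv 1 \<phi>) x" for v
  proof -
    have "continuous_on (cbox p q) (fx x)"
    proof -
      have "continuous_on (cbox p q) (Pair x)" by (intro continuous_intros)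
      then show ?thesis using continuous_on_compose2[OF cfx, of "cbox p q" "Pair x"] r(1)
        by (auto simp: image_subset_iff)
    qed
    then have "integral (cbox p q) (fx x) v = integral (cbox p q) (\<lambda>u. f' x u v)"
      using blinfun_apply_integral[OF integrable_continuous, of p q "fx x" v] by (simp only: fx[OF x])
    also have "\<dots> = (LINT u|lborel. f' x u v)"
    proof (rule compactly_supported_integral(2))
      show "continuous_on UNIV (\<lambda>u. f' x u v)"
      proof -
        have "continuous_on UNIV (Pair x :: _ \<Rightarrow> _ \<times> 'y \<times> real)" by (intro continuous_intros)
        then show ?thesis using continuous_on_compose2[OF cont, of UNIV "Pair x" v] x
          by (auto simp: image_subset_iff)
      qed
    qed (use out in \<open>auto simp: f'_def\<close>)
    also have "\<dots> = kernel_integral e (D v b) \<phi> x - kernel_integral e' (\<lambda>p. b p * of_real (D v Q p)) \<phi> x"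
      unfolding f'_def kernel_integral_def
      by (intro Bochner_Integration.integral_diff integrand_facts(2) ce e(2) \<phi> x sbD smooth_D b)
    finally show ?thesis
      using kernel_integral_by_parts[OF e sbD \<phi> x] by simp
  qed
  then show ?thesis by (intro has_derivative_eq_rhs[OF d'] ext)
qed

end

context level_set_phase
begin

text \<open>Since the derivative of a kernel integral is a sum of two such integrals, with amplitudes that do
  not depend on the test function, the same form persists for all iterated derivatives.\<close>

definition kernel_sum ::
  "(real \<Rightarrow> complex) \<Rightarrow> (('y \<times> 'v \<Rightarrow> complex) \<times> nat) list \<Rightarrow> ('y \<times> real \<Rightarrow> complex) \<Rightarrow> 'v \<Rightarrow> complex" where
  "kernel_sum e bs \<phi> x = (\<Sum>(b, j)\<leftarrow>bs. kernel_integral e b (time_deriv j \<phi>) x)"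

lemma kernel_sum_has_derivative:
  assumes e: "\<And>s. (e has_vector_derivative e' s) (at s)" "continuous_on UNIV e'"
    and bs: "\<forall>(b, j) \<in> set bs. smooth_on G b"
  obtains cs where "\<forall>v. \<forall>(b, j) \<in> set (cs v). smooth_on G b"
    "\<forall>\<phi> x. vanishing \<phi> \<longrightarrow> x \<in> W \<longrightarrow>
      (kernel_sum e bs \<phi> has_derivative (\<lambda>v. kernel_sum e (cs v) \<phi> x)) (at x)"
proof -
  define cs :: "(('y \<times> 'v \<Rightarrow> complex) \<times> nat) list \<Rightarrow> 'v \<Rightarrow> (('y \<times> 'v \<Rightarrow> complex) \<times> nat) list"
    where "cs = (\<lambda>bs v. concat (map (\<lambda>(b, j). [(D v b, j), (\<lambda>p. b p * of_real (D v Q p), Suc j)]) bs))"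
  have "\<forall>v. \<forall>(b, j) \<in> set (cs bs v). smooth_on G b"
    using bs by (auto simp: cs_def intro!: smooth_D smooth_on_mult smooth_on_of_real smooth_Q)
  moreover have "(kernel_sum e bs \<phi> has_derivative (\<lambda>v. kernel_sum e (cs bs v) \<phi> x)) (at x)"
    if v: "vanishing \<phi>" and x: "x \<in> W" for \<phi> x
    using bs
  proof (induction bs)
    case Nil
    have "kernel_sum e [] \<phi> = (\<lambda>x. 0)" by (simp add: kernel_sum_def fun_eq_iff)
    moreover have "(\<lambda>v. kernel_sum e (cs [] v) \<phi> x) = (\<lambda>v. 0)" by (simp add: kernel_sum_def cs_def fun_eq_iff)
    ultimately show ?case by simp
  next
    case (Cons z bs)
    obtain b j where z: "z = (b, j)" by (cases z)
    have b: "smooth_on G b" using Cons.prems z by auto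
    have IH: "(kernel_sum e bs \<phi> has_derivative (\<lambda>v. kernel_sum e (cs bs v) \<phi> x)) (at x)"
      using Cons by auto
    have t: "time_deriv 1 (time_deriv j \<phi>) = time_deriv (Suc j) \<phi>" by simp
    have l: "kernel_sum e (z # bs) \<phi> = (\<lambda>x. kernel_integral e b (time_deriv j \<phi>) x + kernel_sum e bs \<phi> x)"
      by (simp add: kernel_sum_def z fun_eq_iff)
    have r: "(\<lambda>v. kernel_sum e (cs (z # bs) v) \<phi> x) = (\<lambda>v. kernel_integral e (D v b) (time_deriv j \<phi>) x
       + kernel_integral e (\<lambda>p. b p * of_real (D v Q p)) (time_deriv (Suc j) \<phi>) x + kernel_sum e (cs bs v) \<phi> x)"
      by (simp add: kernel_sum_def z fun_eq_iff cs_def)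
    show ?case
      unfolding l r
      using has_derivative_add[OF kernel_integral_has_derivative[OF e b vanishing_time_deriv[OF v, of j] x] IH]
      by (simp only: t)
  qed
  ultimately show thesis using that[of "cs bs"] by blast
qed

lemma iter_deriv_kernel_integral:
  assumes e: "\<And>s. (e has_vector_derivative e' s) (at s)" "continuous_on UNIV e'"
    and b: "smooth_on G b"
  obtains bs where "\<forall>(b, j) \<in> set bs. smooth_on G b"
    "\<forall>\<phi> x. vanishing \<phi> \<longrightarrow> x \<in> W \<longrightarrow> iter_deriv vs (kernel_integral e b \<phi>) x = kernel_sum e bs \<phi> x"
proof -
  have "\<exists>bs. (\<forall>(b, j) \<in> set bs. smooth_on G b) \<and>
    (\<forall>\<phi> x. vanishing \<phi> \<longrightarrow> x \<in> W \<longrightarrow> iter_deriv vs (kernel_integral e b \<phi>) x = kernel_sum e bs \<phi> x)"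
  proof (induction vs)
    case Nil
    show ?case by (rule exI[of _ "[(b, 0)]"]) (use b in \<open>simp add: kernel_sum_def\<close>)
  next
    case (Cons v vs)
    then obtain bs where bs: "\<forall>(b, j) \<in> set bs. smooth_on G b"
      and eq: "\<And>\<phi> x. vanishing \<phi> \<Longrightarrow> x \<in> W \<Longrightarrow> iter_deriv vs (kernel_integral e b \<phi>) x = kernel_sum e bs \<phi> x"
      by blast
    obtain cs where cs: "\<forall>v. \<forall>(b, j) \<in> set (cs v). smooth_on G b"
      and der: "\<forall>\<phi> x. vanishing \<phi> \<longrightarrow> x \<in> W \<longrightarrow>
        (kernel_sum e bs \<phi> has_derivative (\<lambda>v. kernel_sum e (cs v) \<phi> x)) (at x)"
      using kernel_sum_has_derivative[OF e bs] .
    have "iter_deriv (v # vs) (kernel_integral e b \<phi>) x = kernel_sum e (cs v) \<phi> x"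
      if "vanishing \<phi>" "x \<in> W" for \<phi> x
    proof -
      have "frechet_derivative (iter_deriv vs (kernel_integral e b \<phi>)) (at x)
          = frechet_derivative (kernel_sum e bs \<phi>) (at x)"
        by (rule frechet_derivative_cong_open[OF open_W that(2)]) (use eq that in blast)
      also have "\<dots> = (\<lambda>v. kernel_sum e (cs v) \<phi> x)"
        using frechet_derivative_at der that by metis
      finally show ?thesis by simp
    qed
    then show ?case using cs by blast
  qed
  then show thesis using that by blast
qed

lemma smooth_on_kernel_integral:
  assumes e: "\<And>s. (e has_vector_derivative e' s) (at s)" "continuous_on UNIV e'"
    and b: "smooth_on G b" and v: "vanishing \<phi>"
  shows "smooth_on W (kernel_integral e b \<phi>)"
  unfolding smooth_on_def
proof (intro conjI allI ballI)
  fix vs x assume x: "x \<in> W"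
  obtain bs where bs: "\<forall>(b, j) \<in> set bs. smooth_on G b"
    and eq: "\<forall>\<phi> x. vanishing \<phi> \<longrightarrow> x \<in> W \<longrightarrow> iter_deriv vs (kernel_integral e b \<phi>) x = kernel_sum e bs \<phi> x"
    using iter_deriv_kernel_integral[OF e b] .
  obtain cs where "\<forall>v. \<forall>(b, j) \<in> set (cs v). smooth_on G b"
    and der: "\<forall>\<phi> x. vanishing \<phi> \<longrightarrow> x \<in> W \<longrightarrow>
      (kernel_sum e bs \<phi> has_derivative (\<lambda>v. kernel_sum e (cs v) \<phi> x)) (at x)"
    using kernel_sum_has_derivative[OF e bs] .
  have d: "kernel_sum e bs \<phi> differentiable (at x)"
    using der v x unfolding differentiable_def by blast
  have q: "kernel_sum e bs \<phi> y = iter_deriv vs (kernel_integral e b \<phi>) y" if "y \<in> W" for y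
    using eq v that by simp
  show "iter_deriv vs (kernel_integral e b \<phi>) differentiable (at x)"
    by (rule differentiable_cong_open[OF open_W x q d])
qed (rule open_W)

text \<open>The constant involves \<open>e\<close>, the amplitude on a compact set and the volume of a box around \<open>K\<close>, but not the
  test function.\<close>

lemma kernel_integral_bound:
  assumes e: "\<And>s. norm (e s) \<le> B" "continuous_on UNIV e" and b: "smooth_on G b"
    and L: "compact L" "L \<subseteq> W"
  obtains C where "C \<ge> 0" "\<And>\<phi> x M. vanishing \<phi> \<Longrightarrow> x \<in> L \<Longrightarrow> M \<ge> 0 \<Longrightarrow> (\<And>u. u \<in> K \<Longrightarrow> norm (\<phi> u) \<le> M) \<Longrightarrow>
    norm (kernel_integral e b \<phi> x) \<le> C * M"
proof -
  have "compact (fst ` K \<times> L)"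
    by (intro compact_Times L compact_continuous_image[OF continuous_on_fst[OF continuous_on_id] compact_K])
  moreover have "fst ` K \<times> L \<subseteq> G" using L by (auto simp: W_def)
  ultimately have "bounded (b ` (fst ` K \<times> L))"
    using smooth_on_continuous_on[OF b] continuous_on_subset compact_continuous_image compact_imp_bounded by metis
  then obtain Bb where Bb: "\<And>p. p \<in> fst ` K \<times> L \<Longrightarrow> norm (b p) \<le> Bb"
    unfolding bounded_iff by (metis imageI)
  obtain p q where K: "K \<subseteq> cbox p q" using compact_in_cbox compact_K .
  define C where "C = \<bar>B\<bar> * \<bar>Bb\<bar> * measure lborel (cbox p q)"
  have "norm (kernel_integral e b \<phi> x) \<le> C * M"
    if v: "vanishing \<phi>" and x: "x \<in> L" and M0: "M \<ge> 0" and M: "\<And>u. u \<in> K \<Longrightarrow> norm (\<phi> u) \<le> M" for \<phi> x M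
  proof -
    have xW: "x \<in> W" using x L by blast
    note f = integrand_facts[OF e(2) b v xW]
    have le: "norm (integrand e b \<phi> x u) \<le> (\<bar>B\<bar> * \<bar>Bb\<bar> * M) * indicator (cbox p q) u" for u
    proof (cases "u \<in> K")
      case True
      have "norm (e (snd u - Q (fst u, x))) \<le> \<bar>B\<bar>" using e(1)[of "snd u - Q (fst u, x)"] by linarith
      moreover have "norm (b (fst u, x)) \<le> \<bar>Bb\<bar>" using Bb[of "(fst u, x)"] True x by force
      ultimately have "norm (e (snd u - Q (fst u, x)) * b (fst u, x)) * norm (\<phi> u) \<le> \<bar>B\<bar> * \<bar>Bb\<bar> * M"
        using M[OF True] by (intro mult_mono) (auto simp: norm_mult intro!: mult_mono)
      then show ?thesis using True K by (auto simp: norm_mult)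
    next
      case False
      then have "\<phi> u = 0" using vanishing_outside[OF v] by blast
      then show ?thesis using M0 by simp
    qed
    have "norm (kernel_integral e b \<phi> x) \<le> (LINT u|lborel. norm (integrand e b \<phi> x u))"
      unfolding kernel_integral_def by (rule integral_norm_bound)
    also have "\<dots> \<le> (LINT u|lborel. (\<bar>B\<bar> * \<bar>Bb\<bar> * M) * indicator (cbox p q) u)"
      by (rule integral_mono[OF integrable_norm[OF f(2)] _ le])
        (auto intro!: integrable_mult_right integrable_real_indicator intro: emeasure_bounded_finite)
    also have "\<dots> = C * M" by (simp add: C_def)
    finally show ?thesis .
  qed
  moreover have "C \<ge> 0" by (simp add: C_def)
  ultimately show thesis using that by blast
qed


text \<open>Two derivatives in \<open>t\<close> and the identity give the factor \<open>1 + \<omega>\<^sup>2\<close> under the Fourier transform.\<close>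

definition regularize :: "('y \<times> real \<Rightarrow> complex) \<Rightarrow> 'y \<times> real \<Rightarrow> complex" where
  "regularize \<phi> u = \<phi> u - time_deriv 2 \<phi> u"

lemma vanishing_regularize: "vanishing \<phi> \<Longrightarrow> vanishing (regularize \<phi>)"
  using vanishing_time_deriv[of \<phi> 2] unfolding vanishing_def regularize_def
  by (auto intro: smooth_on_diff)

lemma kernel_integral_lincomb:
  assumes "continuous_on UNIV e" "smooth_on G b" "vanishing \<phi>" "vanishing \<eta>" "x \<in> W"
  shows "kernel_integral e b (\<lambda>u. c * \<phi> u + d * \<eta> u) x = c * kernel_integral e b \<phi> x + d * kernel_integral e b \<eta> x"
proof -
  have "kernel_integral e b (\<lambda>u. c * \<phi> u + d * \<eta> u) x = (LINT u|lborel. c * integrand e b \<phi> x u + d * integrand e b \<eta> x u)"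
    unfolding kernel_integral_def by (intro Bochner_Integration.integral_cong) (auto simp: algebra_simps)
  also have "\<dots> = c * kernel_integral e b \<phi> x + d * kernel_integral e b \<eta> x"
    using integrand_facts(2)[OF assms(1,2,3,5)] integrand_facts(2)[OF assms(1,2,4,5)]
    by (subst Bochner_Integration.integral_add) (auto simp: kernel_integral_def)
  finally show ?thesis .
qed

abbreviation wave :: "real \<Rightarrow> real \<Rightarrow> complex" where
  "wave \<omega> s \<equiv> exp (\<i> * of_real (\<omega> * s))"

lemma wave_facts:
  "((wave \<omega>) has_vector_derivative \<i> * \<omega> * wave \<omega> s) (at s)" "continuous_on UNIV (wave \<omega>)"
  "norm (wave \<omega> s) \<le> 1"
proof -
  have "((\<lambda>z. exp (\<i> * of_real \<omega> * z)) has_field_derivative \<i> * \<omega> * exp (\<i> * of_real \<omega> * of_real s)) (at (of_real s))"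
    by (auto intro!: derivative_eq_intros)
  from has_vector_derivative_real_field[OF this]
  show "((wave \<omega>) has_vector_derivative \<i> * \<omega> * wave \<omega> s) (at s)" by (simp add: mult.assoc)
  show "continuous_on UNIV (wave \<omega>)" by (intro continuous_intros)
  show "norm (wave \<omega> s) \<le> 1" by (simp add: norm_exp_i_real del: of_real_mult)
qed

lemma kernel_integral_scale: "kernel_integral (\<lambda>s. c * e s) b \<phi> x = c * kernel_integral e b \<phi> x"
  unfolding kernel_integral_def by (simp add: mult.assoc)

lemma kernel_integral_wave_deriv:
  assumes "smooth_on G b" "vanishing \<phi>" "x \<in> W"
  shows "kernel_integral (wave \<omega>) b (time_deriv 1 \<phi>) x = - (\<i> * \<omega>) * kernel_integral (wave \<omega>) b \<phi> x"
proof -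
  have "continuous_on UNIV (\<lambda>s. \<i> * complex_of_real \<omega> * wave \<omega> s)"
    by (intro continuous_intros)
  from kernel_integral_by_parts[OF wave_facts(1) this assms] show ?thesis
    unfolding kernel_integral_scale by simp
qed

lemma kernel_integral_wave_regularize:
  assumes "smooth_on G b" "vanishing \<phi>" "x \<in> W"
  shows "kernel_integral (wave \<omega>) b (regularize \<phi>) x = of_real (1 + \<omega>\<^sup>2) * kernel_integral (wave \<omega>) b \<phi> x"
proof -
  have t: "time_deriv 2 \<phi> = time_deriv 1 (time_deriv 1 \<phi>)" by (simp add: numeral_2_eq_2)
  have "kernel_integral (wave \<omega>) b (time_deriv 2 \<phi>) x
      = - (\<i> * \<omega>) * (- (\<i> * \<omega>) * kernel_integral (wave \<omega>) b \<phi> x)"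
    unfolding t
    by (simp only: kernel_integral_wave_deriv[OF assms(1) vanishing_time_deriv[OF assms(2)] assms(3)]
        kernel_integral_wave_deriv[OF assms])
  also have "\<dots> = - of_real (\<omega>\<^sup>2) * kernel_integral (wave \<omega>) b \<phi> x"
    unfolding of_real_power using power2_i by algebra
  finally show ?thesis
    using kernel_integral_lincomb[OF wave_facts(2) assms(1,2) vanishing_time_deriv[OF assms(2)] assms(3), of \<omega> 1 "- 1" 2]
    by (simp add: regularize_def[abs_def] algebra_simps del: iter_deriv.simps replicate.simps)
qed

text \<open>The integration by parts that makes the integral over \<open>\<omega>\<close> absolutely convergent.\<close>

lemma abs_kernel_integral_wave:
  assumes "smooth_on G b" "vanishing \<phi>" "x \<in> W"
  shows "complex_of_real \<bar>\<omega>\<bar> * kernel_integral (wave \<omega>) b \<phi> x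
    = weight \<omega> * kernel_integral (wave \<omega>) b (regularize (regularize \<phi>)) x"
proof -
  have "1 + \<omega>\<^sup>2 > 0" by (simp add: add_pos_nonneg)
  then have nz: "1 + complex_of_real \<omega> ^ 2 \<noteq> 0"
    by (metis less_irrefl of_real_1 of_real_add of_real_eq_0_iff of_real_power)
  have "kernel_integral (wave \<omega>) b (regularize (regularize \<phi>)) x
      = of_real (1 + \<omega>\<^sup>2) * (of_real (1 + \<omega>\<^sup>2) * kernel_integral (wave \<omega>) b \<phi> x)"
    by (simp only: kernel_integral_wave_regularize[OF assms(1) vanishing_regularize[OF assms(2)] assms(3)]
        kernel_integral_wave_regularize[OF assms])
  then show ?thesis using nz by (simp add: weight_def power2_eq_square)
qed

text \<open>Interchanging the integrals over \<open>\<omega>\<close> and \<open>(y, t)\<close>, which is legitimate once the weight makes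
  the integrand absolutely integrable.\<close>

lemma weighted_wave_integral:
  assumes b: "smooth_on G b" and v: "vanishing \<phi>" and x: "x \<in> W"
  shows "integrable lborel (\<lambda>\<omega>. weight \<omega> * kernel_integral (wave \<omega>) b \<phi> x)"
    and "(LINT \<omega>|lborel. weight \<omega> * kernel_integral (wave \<omega>) b \<phi> x) = kernel_integral regular_kernel b \<phi> x"
proof -
  define h where "h = (\<lambda>\<omega> u. weight \<omega> * (integrand (wave \<omega>) b \<phi> x u))"
  define A where "A = {z :: real \<times> ('y \<times> real). (fst (snd z), x) \<in> G}"
  have cA: "continuous_on A (\<lambda>z. (fst (snd z), x))" by (intro continuous_intros)
  have "continuous_on UNIV (\<lambda>z :: real \<times> ('y \<times> real). (fst (snd z), x))" by (intro continuous_intros)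
  from open_vimage[OF open_G this] have "open A" by (simp add: A_def vimage_def)
  have "continuous_on A (\<lambda>z. Q (fst (snd z), x))"
    by (rule continuous_on_compose2[OF smooth_on_continuous_on[OF smooth_Q] cA]) (auto simp: A_def)
  moreover have "continuous_on A (\<lambda>z. b (fst (snd z), x))"
    by (rule continuous_on_compose2[OF smooth_on_continuous_on[OF b] cA]) (auto simp: A_def)
  ultimately have "continuous_on A (\<lambda>z. wave (fst z) (snd (snd z) - Q (fst (snd z), x)) * b (fst (snd z), x))"
    by (intro continuous_intros)
  with \<open>open A\<close> have "continuous_on UNIV (\<lambda>z. wave (fst z) (snd (snd z) - Q (fst (snd z), x)) * b (fst (snd z), x) * \<phi> (snd z))"
  proof (rule continuous_on_mult_vanishing[where C = "UNIV \<times> K"])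
    show "continuous_on UNIV (\<lambda>z. \<phi> (snd z))"
      by (rule continuous_on_compose2[OF continuous_on_vanishing[OF v]]) (auto intro!: continuous_intros)
    show "closed (UNIV \<times> K)" using compact_imp_closed[OF compact_K] by (intro closed_Times) auto
    show "UNIV \<subseteq> A \<union> - (UNIV \<times> K)" using x by (force simp: W_def A_def)
    show "\<phi> (snd z) = 0" if "z \<notin> UNIV \<times> K" for z :: "real \<times> 'y \<times> real"
      using vanishing_outside[OF v, of "snd z"] that by (simp add: mem_Times_iff)
  qed
  from borel_measurable_continuous_onI[OF this]
  have "(\<lambda>z. wave (fst z) (snd (snd z) - Q (fst (snd z), x)) * b (fst (snd z), x) * \<phi> (snd z))
      \<in> borel_measurable (lborel \<Otimes>\<^sub>M lborel)"
    by (simp add: lborel_prod)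
  moreover have "(\<lambda>z :: real \<times> ('y \<times> real). complex_of_real (weight (fst z))) \<in> borel_measurable (lborel \<Otimes>\<^sub>M lborel)"
    by measurable
  ultimately have meas: "case_prod h \<in> borel_measurable (lborel \<Otimes>\<^sub>M lborel)"
    unfolding h_def case_prod_beta' by (rule borel_measurable_times[rotated])
  define c where "c = (LINT u|lborel. norm (integrand (wave 0) b \<phi> x u))"
  have nh: "norm (h \<omega> u) = weight \<omega> * norm (integrand (wave 0) b \<phi> x u)" for \<omega> u
    by (simp add: h_def norm_mult norm_exp_i_real weight_le del: of_real_mult)
  have iw: "integrable lborel weight"
    by (rule Bochner_Integration.integrable_bound[OF integrable_inverse_square]) (auto simp: weight_le intro!: AE_I2)
  have ih: "integrable (lborel \<Otimes>\<^sub>M lborel) (case_prod h)"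
  proof (rule lborel_pair.Fubini_integrable[OF meas])
    show "integrable lborel (\<lambda>\<omega>. LINT u|lborel. norm (case (\<omega>, u) of (\<omega>, u) \<Rightarrow> h \<omega> u))"
      using iw by (simp add: nh)
    show "AE \<omega> in lborel. integrable lborel (\<lambda>u. case (\<omega>, u) of (\<omega>, u) \<Rightarrow> h \<omega> u)"
      using integrand_facts(2)[OF wave_facts(2) b v x] by (auto simp: h_def)
  qed
  have 1: "(LINT u|lborel. h \<omega> u) = weight \<omega> * kernel_integral (wave \<omega>) b \<phi> x" for \<omega>
    by (simp add: h_def kernel_integral_def)
  show "integrable lborel (\<lambda>\<omega>. weight \<omega> * kernel_integral (wave \<omega>) b \<phi> x)"
    using lborel_pair.integrable_fst[OF ih] by (simp add: 1)
  have 2: "(LINT \<omega>|lborel. h \<omega> u) = integrand regular_kernel b \<phi> x u" for u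
    by (simp add: h_def regular_kernel_def flip: mult.assoc)
  show "(LINT \<omega>|lborel. weight \<omega> * kernel_integral (wave \<omega>) b \<phi> x) = kernel_integral regular_kernel b \<phi> x"
    using lborel_pair.Fubini_integral[OF ih] by (simp add: 1 2 kernel_integral_def)
qed

text \<open>After the regularization the integral over \<open>\<omega>\<close> converges absolutely; by dominated convergence every
  cutoff then gives the same limit.\<close>

lemma osc_integral_kernel:
  assumes b: "smooth_on G b" and v: "vanishing \<phi>" and x: "x \<in> W"
  shows "has_osc_integral (\<lambda>\<omega>. complex_of_real \<bar>\<omega>\<bar> * kernel_integral (wave \<omega>) b \<phi> x)
    (kernel_integral regular_kernel b (regularize (regularize \<phi>)) x)"
  unfolding has_osc_integral_def
proof (intro ballI impI)
  fix \<kappa> :: "real \<Rightarrow> complex" assume \<kappa>: "\<kappa> \<in> test_functions UNIV" "\<forall>\<^sub>F \<theta> in nhds 0. \<kappa> \<theta> = 1"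
  define J where "J = (\<lambda>\<omega>. weight \<omega> * kernel_integral (wave \<omega>) b (regularize (regularize \<phi>)) x)"
  note J = weighted_wave_integral[OF b vanishing_regularize[OF vanishing_regularize[OF v]] x, folded J_def]
  have c: "continuous_on UNIV \<kappa>" and cs: "compact (supp \<kappa>)"
    using \<kappa> smooth_on_continuous_on by (auto simp: test_functions_def)
  have "bounded (\<kappa> ` supp \<kappa>)"
    using compact_imp_bounded[OF compact_continuous_image[OF continuous_on_subset[OF c] cs]] by simp
  then obtain B where B: "\<And>\<theta>. \<theta> \<in> supp \<kappa> \<Longrightarrow> norm (\<kappa> \<theta>) \<le> B" by (auto simp: bounded_iff)
  have bd: "norm (\<kappa> \<theta>) \<le> \<bar>B\<bar>" for \<theta>
  proof (cases "\<kappa> \<theta> = 0")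
    case False
    then have "\<theta> \<in> supp \<kappa>" using closure_subset by (fastforce simp: supp_def)
    then show ?thesis using B[of \<theta>] by linarith
  qed simp
  have "((\<lambda>\<epsilon>. LINT \<theta>|lborel. \<kappa> (\<epsilon> *\<^sub>R \<theta>) * J \<theta>) \<longlongrightarrow> integral\<^sup>L lborel J) (at_right 0)"
    unfolding tendsto_at_iff_sequentially comp_def
  proof (intro allI impI)
    fix X :: "nat \<Rightarrow> real" assume X: "\<forall>i. X i \<in> {0<..} - {0}" "X \<longlonglongrightarrow> 0"
    show "(\<lambda>i. LINT \<theta>|lborel. \<kappa> (X i *\<^sub>R \<theta>) * J \<theta>) \<longlonglongrightarrow> integral\<^sup>L lborel J"
    proof (rule integral_dominated_convergence[where w = "\<lambda>\<theta>. \<bar>B\<bar> * norm (J \<theta>)"])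
      show "J \<in> borel_measurable lborel" using J(1) by auto
      have "\<kappa> \<in> borel_measurable borel" by (rule borel_measurable_continuous_onI[OF c])
      with J(1) show "(\<lambda>\<theta>. \<kappa> (X i *\<^sub>R \<theta>) * J \<theta>) \<in> borel_measurable lborel" for i by measurable
      show "integrable lborel (\<lambda>\<theta>. \<bar>B\<bar> * norm (J \<theta>))" using J(1) by auto
      show "AE \<theta> in lborel. norm (\<kappa> (X i *\<^sub>R \<theta>) * J \<theta>) \<le> \<bar>B\<bar> * norm (J \<theta>)" for i
        by (auto simp: norm_mult intro!: AE_I2 mult_right_mono bd)
      show "AE \<theta> in lborel. (\<lambda>i. \<kappa> (X i *\<^sub>R \<theta>) * J \<theta>) \<longlonglongrightarrow> J \<theta>"
      proof (rule AE_I2)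
        fix \<theta> :: real
        have "(\<lambda>i. X i *\<^sub>R \<theta>) \<longlonglongrightarrow> 0 *\<^sub>R \<theta>" by (intro tendsto_scaleR X(2) tendsto_const)
        then have "(\<lambda>i. X i *\<^sub>R \<theta>) \<longlonglongrightarrow> 0" by simp
        then have "\<forall>\<^sub>F i in sequentially. \<kappa> (X i *\<^sub>R \<theta>) = 1"
          by (rule eventually_compose_filterlim[OF \<kappa>(2)])
        then have "\<forall>\<^sub>F i in sequentially. J \<theta> = \<kappa> (X i *\<^sub>R \<theta>) * J \<theta>"
          by eventually_elim simp
        then show "(\<lambda>i. \<kappa> (X i *\<^sub>R \<theta>) * J \<theta>) \<longlonglongrightarrow> J \<theta>"
          by (rule Lim_transform_eventually[OF tendsto_const])
      qed
    qed
  qed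
  then show "((\<lambda>\<epsilon>. LINT \<theta>|lborel. \<kappa> (\<epsilon> *\<^sub>R \<theta>) * (complex_of_real \<bar>\<theta>\<bar> * kernel_integral (wave \<theta>) b \<phi> x)) \<longlongrightarrow>
      kernel_integral regular_kernel b (regularize (regularize \<phi>)) x) (at_right 0)"
    unfolding abs_kernel_integral_wave[OF assms] J(2)[symmetric] unfolding J_def .
qed

end

lemma iter_deriv_lincomb:
  fixes f g :: "'a::real_normed_vector \<Rightarrow> complex"
  assumes "smooth_on U f" "smooth_on U g" "x \<in> U"
  shows "iter_deriv vs (\<lambda>x. c * f x + d * g x) x = c * iter_deriv vs f x + d * iter_deriv vs g x"
proof -
  have "\<forall>x\<in>U. iter_deriv vs (\<lambda>x. c * f x + d * g x) x = c * iter_deriv vs f x + d * iter_deriv vs g x"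
  proof (induction vs)
    case (Cons v vs)
    show ?case
    proof
      fix x assume x: "x \<in> U"
      have "frechet_derivative (iter_deriv vs (\<lambda>x. c * f x + d * g x)) (at x)
          = frechet_derivative (\<lambda>x. c * iter_deriv vs f x + d * iter_deriv vs g x) (at x)"
        using Cons by (intro frechet_derivative_cong_open[OF smooth_on_open[OF assms(1)] x]) auto
      also have "\<dots> = (\<lambda>w. c * frechet_derivative (iter_deriv vs f) (at x) w
          + d * frechet_derivative (iter_deriv vs g) (at x) w)"
        by (rule frechet_derivative_at[symmetric])
          (intro has_derivative_add has_derivative_mult_right smooth_on_has_derivative[OF smooth_on_iter_deriv x] assms)
      finally show "iter_deriv (v # vs) (\<lambda>x. c * f x + d * g x) x
          = c * iter_deriv (v # vs) f x + d * iter_deriv (v # vs) g x"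
        by simp
    qed
  qed simp
  then show ?thesis using assms(3) by blast
qed

context level_set_phase
begin

lemma kernel_sum_bound:
  assumes e: "\<And>s. norm (e s) \<le> B" "continuous_on UNIV e" and bs: "\<forall>(b, j) \<in> set bs. smooth_on G b"
    and L: "compact L" "L \<subseteq> W"
  shows "\<exists>C J. C \<ge> 0 \<and> (\<forall>\<phi> x M. vanishing \<phi> \<and> x \<in> L \<and> M \<ge> 0 \<and>
    (\<forall>j\<le>J. \<forall>u\<in>K. norm (time_deriv j \<phi> u) \<le> M) \<longrightarrow> norm (kernel_sum e bs \<phi> x) \<le> C * M)"
  using bs
proof (induction bs)
  case Nil
  show ?case by (rule exI[of _ 0]) (simp add: kernel_sum_def)
next
  case (Cons z bs)
  obtain b j where z: "z = (b, j)" by (cases z)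
  have "\<forall>(b, j) \<in> set bs. smooth_on G b" using Cons.prems by auto
  from Cons.IH[OF this] obtain C1 J1 where 1: "C1 \<ge> 0" "\<forall>\<phi> x M. vanishing \<phi> \<and> x \<in> L \<and> M \<ge> 0 \<and>
      (\<forall>j\<le>J1. \<forall>u\<in>K. norm (time_deriv j \<phi> u) \<le> M) \<longrightarrow> norm (kernel_sum e bs \<phi> x) \<le> C1 * M"
    by blast
  have b: "smooth_on G b" using Cons.prems z by auto
  obtain C2 where 2: "C2 \<ge> 0" "\<And>\<phi> x M. vanishing \<phi> \<Longrightarrow> x \<in> L \<Longrightarrow> M \<ge> 0 \<Longrightarrow>
      (\<And>u. u \<in> K \<Longrightarrow> norm (\<phi> u) \<le> M) \<Longrightarrow> norm (kernel_integral e b \<phi> x) \<le> C2 * M"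
    using kernel_integral_bound[OF e b L] by metis
  have "norm (kernel_sum e (z # bs) \<phi> x) \<le> (C2 + C1) * M"
    if "vanishing \<phi>" "x \<in> L" "M \<ge> 0" "\<forall>i\<le>max j J1. \<forall>u\<in>K. norm (time_deriv i \<phi> u) \<le> M" for \<phi> x M
  proof -
    have "norm (kernel_integral e b (time_deriv j \<phi>) x) \<le> C2 * M"
      using that by (intro 2(2) vanishing_time_deriv) auto
    moreover have "norm (kernel_sum e bs \<phi> x) \<le> C1 * M"
      using that by (intro 1(2)[rule_format]) auto
    ultimately show ?thesis
      using norm_triangle_ineq[of "kernel_integral e b (time_deriv j \<phi>) x" "kernel_sum e bs \<phi> x"]
      by (simp add: kernel_sum_def z distrib_right)
  qed
  then show ?case using 1(1) 2(1) by (intro exI[of _ "C2 + C1"] exI[of _ "max j J1"]) auto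
qed

lemma time_deriv_regularize:
  assumes "vanishing \<phi>"
  shows "time_deriv j (regularize \<phi>) u = time_deriv j \<phi> u - time_deriv (j + 2) \<phi> u"
proof -
  have "time_deriv j (\<lambda>u. \<phi> u - time_deriv 2 \<phi> u) u = time_deriv j \<phi> u - time_deriv j (time_deriv 2 \<phi>) u"
    using iter_deriv_lincomb[of UNIV \<phi> "time_deriv 2 \<phi>" u "replicate j (0, 1)" 1 "- 1"]
      assms smooth_on_iter_deriv[of UNIV \<phi> "replicate 2 (0, 1)"]
    by (simp add: vanishing_def del: iter_deriv.simps replicate.simps)
  then show ?thesis
    unfolding regularize_def[abs_def] by (simp only: replicate_add iter_deriv_append)
qed

lemma regularize_bound:
  assumes v: "vanishing \<phi>" and M: "\<forall>j\<le>J + 2. \<forall>u\<in>K. norm (time_deriv j \<phi> u) \<le> M"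
  shows "\<forall>j\<le>J. \<forall>u\<in>K. norm (time_deriv j (regularize \<phi>) u) \<le> 2 * M"
proof (intro allI impI ballI)
  fix j u assume "j \<le> J" "u \<in> K"
  have "norm (time_deriv j \<phi> u) \<le> M" "norm (time_deriv (j + 2) \<phi> u) \<le> M"
    by (rule M[rule_format]; use \<open>j \<le> J\<close> \<open>u \<in> K\<close> in linarith)+
  then show "norm (time_deriv j (regularize \<phi>) u) \<le> 2 * M"
    using norm_triangle_ineq4[of "time_deriv j \<phi> u" "time_deriv (j + 2) \<phi> u"]
    unfolding time_deriv_regularize[OF v] by linarith
qed

lemma regular_kernel_continuous: "continuous_on UNIV regular_kernel"
  by (intro continuous_at_imp_continuous_on ballI has_vector_derivative_continuous[OF regular_kernel_deriv])

text \<open>The continuity estimate: derivatives of the oscillatory integral on a compact set are controlled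
  by finitely many derivatives of the test function.\<close>

lemma osc_integral_derivatives_bound:
  assumes b: "smooth_on G b" and L: "compact L" "L \<subseteq> W"
  shows "\<exists>C J. C \<ge> 0 \<and> (\<forall>\<phi> M vs x. vanishing \<phi> \<and> M \<ge> 0 \<and>
    (\<forall>j\<le>J. \<forall>u\<in>K. norm (time_deriv j \<phi> u) \<le> M) \<and> set vs \<subseteq> Basis \<and> length vs \<le> N \<and> x \<in> L \<longrightarrow>
    norm (iter_deriv vs (kernel_integral regular_kernel b (regularize (regularize \<phi>))) x) \<le> C * M)"
proof -
  let ?V = "{vs. set vs \<subseteq> (Basis :: 'v set) \<and> length vs \<le> N}"
  let ?P = "\<lambda>vs C J. C \<ge> 0 \<and> (\<forall>\<phi> x M. vanishing \<phi> \<and> x \<in> L \<and> M \<ge> 0 \<and>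
    (\<forall>j\<le>J. \<forall>u\<in>K. norm (time_deriv j \<phi> u) \<le> M) \<longrightarrow>
    norm (iter_deriv vs (kernel_integral regular_kernel b \<phi>) x) \<le> C * M)"
  have "\<exists>C J. ?P vs C J" for vs
  proof -
    obtain bs where bs: "\<forall>(b, j) \<in> set bs. smooth_on G b"
      and eq: "\<forall>\<phi> x. vanishing \<phi> \<longrightarrow> x \<in> W \<longrightarrow>
        iter_deriv vs (kernel_integral regular_kernel b \<phi>) x = kernel_sum regular_kernel bs \<phi> x"
      using iter_deriv_kernel_integral[OF regular_kernel_deriv regular_kernel'_continuous b] .
    obtain C J where CJ: "C \<ge> 0" "\<forall>\<phi> x M. vanishing \<phi> \<and> x \<in> L \<and> M \<ge> 0 \<and>
        (\<forall>j\<le>J. \<forall>u\<in>K. norm (time_deriv j \<phi> u) \<le> M) \<longrightarrow> norm (kernel_sum regular_kernel bs \<phi> x) \<le> C * M"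
      using kernel_sum_bound[OF regular_kernel_bounded regular_kernel_continuous bs L] by blast
    have "?P vs C J"
    proof (intro conjI allI impI CJ(1))
      fix \<phi> x M
      assume a: "vanishing \<phi> \<and> x \<in> L \<and> M \<ge> 0 \<and> (\<forall>j\<le>J. \<forall>u\<in>K. norm (time_deriv j \<phi> u) \<le> M)"
      have "norm (kernel_sum regular_kernel bs \<phi> x) \<le> C * M" using CJ(2)[rule_format, OF a] .
      moreover have "x \<in> W" using a L(2) by blast
      ultimately show "norm (iter_deriv vs (kernel_integral regular_kernel b \<phi>) x) \<le> C * M"
        using eq a by simp
    qed
    then show ?thesis by blast
  qed
  then have "\<exists>C. \<forall>vs. \<exists>J. ?P vs (C vs) J" by (intro choice allI)
  then obtain C where "\<forall>vs. \<exists>J. ?P vs (C vs) J" ..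
  then have "\<exists>J. \<forall>vs. ?P vs (C vs) (J vs)" by (intro choice)
  then obtain J where P: "\<And>vs. ?P vs (C vs) (J vs)" by blast
  have fin: "finite ?V" by (rule finite_lists_length_le) simp
  define C' where "C' = sum C ?V"
  define J' where "J' = Max (J ` ?V)"
  have C: "C vs \<le> C'" if "vs \<in> ?V" for vs
    unfolding C'_def using member_le_sum[OF that _ fin, of C] P by blast
  have J: "J vs \<le> J'" if "vs \<in> ?V" for vs
    unfolding J'_def using fin that by (intro Max_ge) auto
  have "norm (iter_deriv vs (kernel_integral regular_kernel b (regularize (regularize \<phi>))) x) \<le> (4 * C') * M"
    if v: "vanishing \<phi>" and M: "M \<ge> 0" and bd: "\<forall>j\<le>J' + 4. \<forall>u\<in>K. norm (time_deriv j \<phi> u) \<le> M"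
      and vs: "set vs \<subseteq> Basis" "length vs \<le> N" and x: "x \<in> L" for \<phi> M vs x
  proof -
    have "\<forall>j\<le>(J' + 2) + 2. \<forall>u\<in>K. norm (time_deriv j \<phi> u) \<le> M" using bd by simp
    note r = regularize_bound[OF vanishing_regularize[OF v] regularize_bound[OF v this], rule_format]
    have "J vs \<le> J'" using J[of vs] vs by simp
    then have "\<forall>j\<le>J vs. \<forall>u\<in>K. norm (time_deriv j (regularize (regularize \<phi>)) u) \<le> 2 * (2 * M)"
      by (intro allI impI ballI r) linarith+
    then have "norm (iter_deriv vs (kernel_integral regular_kernel b (regularize (regularize \<phi>))) x) \<le> C vs * (2 * (2 * M))"
      using vanishing_regularize[OF vanishing_regularize[OF v]] x M
      by (intro P[of vs, THEN conjunct2, rule_format] conjI) auto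
    also have "\<dots> \<le> C' * (2 * (2 * M))"
      using C[of vs] vs M by (intro mult_right_mono) auto
    finally show ?thesis by simp
  qed
  moreover have "4 * C' \<ge> 0" unfolding C'_def using P by (simp add: sum_nonneg)
  ultimately show ?thesis by (intro exI[of _ "4 * C'"] exI[of _ "J' + 4"]) simp
qed

lemma vanishing_lincomb:
  "vanishing \<phi> \<Longrightarrow> vanishing \<eta> \<Longrightarrow> vanishing (\<lambda>u. c * \<phi> u + d * \<eta> u)"
  unfolding vanishing_def by (auto intro!: smooth_on_add smooth_on_mult smooth_on_const)

lemma regularize_lincomb:
  assumes "vanishing \<phi>" "vanishing \<eta>"
  shows "regularize (\<lambda>u. c * \<phi> u + d * \<eta> u) = (\<lambda>u. c * regularize \<phi> u + d * regularize \<eta> u)"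
proof
  fix u
  have "time_deriv 2 (\<lambda>u. c * \<phi> u + d * \<eta> u) u = c * time_deriv 2 \<phi> u + d * time_deriv 2 \<eta> u"
    using assms by (intro iter_deriv_lincomb[of UNIV]) (auto simp: vanishing_def)
  then show "regularize (\<lambda>u. c * \<phi> u + d * \<eta> u) u = c * regularize \<phi> u + d * regularize \<eta> u"
    unfolding regularize_def by (simp only: right_diff_distrib) simp
qed

end

section \<open>Geometry of the half cylinder\<close>

text \<open>The tail of \<open>y\<close> consists of the coordinates from the second on, those that enter the equation of
  the cylinder; the signature acts on the first \<open>n - 1\<close> coordinates as \<open>A\<close> does.  They are commuting
  symmetric linear maps, one idempotent, the other an involution, and most computations below use
  nothing else.\<close>

definition tail :: "(real, 'm::{finite,linorder}) vec \<Rightarrow> (real, 'm) vec" where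
  "tail y = (\<chi> i. if coord_index i \<ge> 2 then y $ i else 0)"

definition signature :: "nat \<Rightarrow> (real, 'm::{finite,linorder}) vec \<Rightarrow> (real, 'm) vec" where
  "signature k y = (\<chi> i. diag_entry k (coord_index i) * y $ i)"

lemma linear_tail: "linear tail" and linear_signature: "linear (signature k)"
  by (auto intro!: linearI simp: tail_def signature_def vec_eq_iff algebra_simps)

lemma bounded_linear_tail: "bounded_linear tail"
  using linear_tail linear_conv_bounded_linear by blast

lemma bounded_linear_signature: "bounded_linear (signature k)"
  using linear_signature linear_conv_bounded_linear by blast

lemma tail_tail [simp]: "tail (tail y) = tail y"
  by (simp add: tail_def vec_eq_iff)

lemma tail_inner: "tail x \<bullet> y = x \<bullet> tail y"
  unfolding tail_def inner_vec_def by (intro sum.cong) auto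

lemma signature_signature [simp]: "signature k (signature k y) = y"
  by (simp add: signature_def vec_eq_iff diag_entry_def)

lemma signature_inner: "signature k x \<bullet> y = x \<bullet> signature k y"
  unfolding signature_def inner_vec_def by (intro sum.cong) auto

lemma tail_signature: "tail (signature k y) = signature k (tail y)"
  by (simp add: signature_def tail_def vec_eq_iff)

lemma tail_inner_tail: "tail x \<bullet> tail y = tail x \<bullet> y"
  by (metis tail_inner tail_tail)

lemma sum_tail: "(\<Sum>i | coord_index i \<ge> 2. (y $ i)\<^sup>2) = tail y \<bullet> tail y"
proof -
  have "tail y \<bullet> tail y = (\<Sum>i\<in>UNIV. if coord_index i \<ge> 2 then (y $ i)\<^sup>2 else 0)"
    unfolding inner_vec_def tail_def by (intro sum.cong) (auto simp: power2_eq_square)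
  also have "\<dots> = (\<Sum>i | coord_index i \<ge> 2. (y $ i)\<^sup>2)"
    by (simp add: sum.If_cases)
  finally show ?thesis by simp
qed

lemma Omega_eq: "Omega = {y. tail y \<bullet> tail y < 1}"
  by (simp add: Omega_def sum_tail)

lemma cyl_height_eq: "cyl_height y = sqrt (1 - tail y \<bullet> tail y)"
  by (simp add: cyl_height_def sum_tail)

lemma cyl_height_pos: "y \<in> Omega \<Longrightarrow> cyl_height y > 0"
  by (simp add: Omega_eq cyl_height_eq)

lemma cyl_height_square: "y \<in> Omega \<Longrightarrow> cyl_height y * cyl_height y = 1 - tail y \<bullet> tail y"
  by (simp add: Omega_eq cyl_height_eq)

lemma open_Omega: "open Omega"
proof -
  have "continuous_on UNIV (\<lambda>y. tail y \<bullet> tail y)"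
    by (intro continuous_intros linear_continuous_on bounded_linear_tail)
  then show ?thesis unfolding Omega_eq by (rule open_Collect_less[OF _ continuous_on_const])
qed

lemma smooth_on_cyl_height: "smooth_on Omega cyl_height"
proof -
  have "smooth_on Omega (\<lambda>y. sqrt (1 - tail y \<bullet> tail y))"
    by (intro smooth_on_sqrt smooth_on_diff smooth_on_const smooth_on_inner smooth_on_linear
        bounded_linear_tail open_Omega) (simp add: Omega_eq)
  then show ?thesis by (rule smooth_on_cong) (simp add: cyl_height_eq)
qed

lemma grad_eqI:
  assumes "(f has_derivative (\<lambda>h. g \<bullet> h)) (at x)"
  shows "grad f x = g"
proof -
  have "frechet_derivative f (at x) = (\<lambda>h. g \<bullet> h)"
    using frechet_derivative_at[OF assms] by simp
  then show ?thesis by (simp add: grad_def euclidean_representation)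
qed

lemma cyl_height_has_derivative:
  assumes "y \<in> Omega"
  shows "(cyl_height has_derivative (\<lambda>h. (- (1 / cyl_height y) *\<^sub>R tail y) \<bullet> h)) (at y)"
proof -
  have pos: "1 - tail y \<bullet> tail y > 0" using assms by (simp add: Omega_eq)
  have d: "((\<lambda>y. 1 - tail y \<bullet> tail y) has_derivative (\<lambda>h. - (tail y \<bullet> tail h + tail h \<bullet> tail y))) (at y)"
    by (auto intro!: derivative_eq_intros bounded_linear_imp_has_derivative bounded_linear_tail)
  have "(sqrt has_derivative (\<lambda>h. h * (inverse (sqrt (1 - tail y \<bullet> tail y)) / 2))) (at (1 - tail y \<bullet> tail y))"
    using DERIV_real_sqrt[OF pos] unfolding has_field_derivative_def
    by (rule has_derivative_eq_rhs) (simp add: fun_eq_iff)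
  from has_derivative_compose[OF d this]
  have "((\<lambda>y. sqrt (1 - tail y \<bullet> tail y)) has_derivative
      (\<lambda>h. - (tail y \<bullet> tail h + tail h \<bullet> tail y) * (inverse (sqrt (1 - tail y \<bullet> tail y)) / 2))) (at y)" .
  moreover have "- (tail y \<bullet> tail h + tail h \<bullet> tail y) * (inverse (sqrt (1 - tail y \<bullet> tail y)) / 2)
      = (- (1 / cyl_height y) *\<^sub>R tail y) \<bullet> h" for h
  proof -
    have e: "tail y \<bullet> tail h + tail h \<bullet> tail y = 2 * (tail y \<bullet> h)"
      using tail_inner_tail[of y h] inner_commute[of "tail h" "tail y"] by linarith
    show ?thesis unfolding e cyl_height_eq inner_scaleR_left by (simp only: inverse_eq_divide) simp
  qed
  ultimately show ?thesis by (simp add: cyl_height_eq[abs_def])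
qed

lemma grad_cyl_height: "y \<in> Omega \<Longrightarrow> grad cyl_height y = - (1 / cyl_height y) *\<^sub>R tail y"
  by (rule grad_eqI[OF cyl_height_has_derivative])

lemma linear_diag_A: "linear (diag_A k)"
  by (auto intro!: linearI simp: diag_A_def vec_eq_iff algebra_simps)

lemma bounded_linear_diag_A: "bounded_linear (diag_A k)"
  using linear_diag_A linear_conv_bounded_linear by blast

lemma diag_A_eq:
  fixes x :: "'m::{finite,linorder} space"
  assumes "k \<le> CARD('m)"
  shows "diag_A k x = (signature k (fst x), - snd x)"
  using assms by (simp add: diag_A_def signature_def diag_entry_def)

lemma diag_A_diag_A [simp]: "diag_A k (diag_A k x) = x"
  by (simp add: diag_A_def vec_eq_iff prod_eq_iff diag_entry_def)

lemma diag_A_inner: "diag_A k x \<bullet> y = x \<bullet> diag_A k y"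
  using signature_inner[of k "fst x" "fst y"]
  by (simp add: diag_A_def inner_prod_def signature_def mult.left_commute)

lemma norm_diag_A [simp]: "norm (diag_A k x) = norm x"
  by (simp add: norm_eq_sqrt_inner diag_A_inner)

lemma diag_A_eq_0_iff [simp]: "diag_A k x = 0 \<longleftrightarrow> x = 0"
  by (metis norm_diag_A norm_eq_zero)

section \<open>The phase function\<close>

definition quad :: "nat \<Rightarrow> (real, 'm::{finite,linorder}) vec \<times> 'm space \<Rightarrow> real" where
  "quad k p = xT (fst p) (snd p) \<bullet> diag_A k (xT (fst p) (snd p))"

lemma psi_eq: "psi k ((y, t), x, \<omega>) = \<omega> * (t - quad k (y, x))"
  by (simp add: psi_def quad_def)

text \<open>The derivative of \<open>(y, q y)\<close> along \<open>h\<close>.\<close>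

definition lift :: "(real, 'm::{finite,linorder}) vec \<Rightarrow> (real, 'm) vec \<Rightarrow> 'm space" where
  "lift y h = (h, grad cyl_height y \<bullet> h)"

lemma lift_inner: "v \<bullet> lift y h = matrix_B y v \<bullet> h"
  by (simp add: lift_def matrix_B_def inner_prod_def inner_add_left)

lemma xT_has_derivative:
  assumes "y \<in> Omega"
  shows "((\<lambda>p. xT (fst p) (snd p)) has_derivative (\<lambda>h. snd h - lift y (fst h))) (at (y, x))"
proof -
  have "(cyl_height has_derivative (\<lambda>h. grad cyl_height y \<bullet> h)) (at (fst (y, x)))"
    using cyl_height_has_derivative[OF assms] grad_cyl_height[OF assms] by simp
  from has_derivative_compose[OF has_derivative_fst[OF has_derivative_ident] this]
  show ?thesis unfolding xT_def lift_def
    by (auto intro!: derivative_eq_intros)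
qed

lemma quad_derivative_aux:
  assumes "(f has_derivative f') (at p)"
  shows "((\<lambda>p. f p \<bullet> diag_A k (f p)) has_derivative (\<lambda>h. 2 * (diag_A k (f p) \<bullet> f' h))) (at p)"
proof -
  have "((\<lambda>p. diag_A k (f p)) has_derivative (\<lambda>h. diag_A k (f' h))) (at p)"
    using bounded_linear.has_derivative[OF bounded_linear_diag_A assms] .
  from has_derivative_inner[OF assms this] show ?thesis
  proof (rule has_derivative_eq_rhs, intro ext)
    fix h
    show "f p \<bullet> diag_A k (f' h) + f' h \<bullet> diag_A k (f p) = 2 * (diag_A k (f p) \<bullet> f' h)"
      using diag_A_inner[of k "f p" "f' h"] inner_commute[of "f' h" "diag_A k (f p)"] by simp
  qed
qed

lemma quad_has_derivative:
  assumes "y \<in> Omega"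
  shows "(quad k has_derivative (\<lambda>h. 2 * (diag_A k (xT y x) \<bullet> (snd h - lift y (fst h))))) (at (y, x))"
  using quad_derivative_aux[OF xT_has_derivative[OF assms], of k x] unfolding quad_def by simp

lemma quad_has_derivative_x:
  "((\<lambda>x. quad k (y, x)) has_derivative (\<lambda>h. 2 * (diag_A k (xT y x) \<bullet> h))) (at x)"
proof -
  have "(xT y has_derivative (\<lambda>h. h)) (at x)"
    unfolding xT_def by (auto intro!: derivative_eq_intros)
  from quad_derivative_aux[OF this] show ?thesis by (simp add: quad_def)
qed

lemma quad_has_derivative_y:
  assumes "y \<in> Omega"
  shows "((\<lambda>y. quad k (y, x)) has_derivative (\<lambda>h. - 2 * (diag_A k (xT y x) \<bullet> lift y h))) (at y)"
proof -
  have "((\<lambda>y. (y, x)) has_derivative (\<lambda>h. (h, 0))) (at y)" by (auto intro!: derivative_eq_intros)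
  from has_derivative_compose[OF this quad_has_derivative[OF assms]] show ?thesis
    by (simp add: inner_diff_right)
qed

lemma grad_psi_x:
  "grad (\<lambda>x. psi k (u, x, \<omega>)) x = - (2 * \<omega>) *\<^sub>R diag_A k (xT (fst u) x)"
proof -
  obtain y t where u: "u = (y, t)" by (cases u)
  show ?thesis unfolding u psi_eq
    by (rule grad_eqI) (auto intro!: derivative_eq_intros quad_has_derivative_x)
qed

lemma grad_psi_omega: "grad (\<lambda>\<omega>. psi k (u, x, \<omega>)) \<omega> = snd u - quad k (fst u, x)"
proof -
  obtain y t where u: "u = (y, t)" by (cases u)
  show ?thesis unfolding u psi_eq
    by (rule grad_eqI) (auto intro!: derivative_eq_intros)
qed

lemma grad_psi_u:
  assumes "fst u \<in> Omega"
  shows "grad (\<lambda>u. psi k (u, x, \<omega>)) u = ((2 * \<omega>) *\<^sub>R matrix_B (fst u) (diag_A k (xT (fst u) x)), \<omega>)"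
proof -
  have e: "psi k (u, x, \<omega>) = \<omega> * (snd u - quad k (fst u, x))" for u
    by (cases u) (simp add: psi_eq)
  have "((\<lambda>u. quad k (fst u, x)) has_derivative
      (\<lambda>h. - 2 * (diag_A k (xT (fst u) x) \<bullet> lift (fst u) (fst h)))) (at u)"
    using has_derivative_compose[OF has_derivative_fst[OF has_derivative_ident] quad_has_derivative_y[OF assms]]
    by simp
  then have "((\<lambda>u. \<omega> * (snd u - quad k (fst u, x))) has_derivative
      (\<lambda>h. \<omega> * (snd h + 2 * (diag_A k (xT (fst u) x) \<bullet> lift (fst u) (fst h))))) (at u)"
    by (auto intro!: derivative_eq_intros)
  then show ?thesis unfolding e
    by (intro grad_eqI) (rule has_derivative_eq_rhs, assumption, simp add: fun_eq_iff lift_inner algebra_simps)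
qed

lemma amplitude_eq:
  "amplitude k (u, x, \<omega>) = of_real (\<bar>\<omega>\<bar> * (2 * norm (xT (fst u) x)))"
  by (simp add: amplitude_def grad_psi_x abs_mult)

lemma xT_eq_0_iff:
  assumes "y \<in> Omega" "x \<notin> half_cylinder"
  shows "xT y x \<noteq> 0"
  using assms unfolding xT_def half_cylinder_def by auto

lemma smooth_on_compose_cyl_height:
  "smooth_on S f \<Longrightarrow> (\<And>p. p \<in> S \<Longrightarrow> f p \<in> Omega) \<Longrightarrow> smooth_on S (\<lambda>p. cyl_height (f p))"
  by (rule smooth_on_compose[OF smooth_on_cyl_height])

lemma smooth_on_xT:
  assumes "smooth_on S f" "smooth_on S g" "\<And>p. p \<in> S \<Longrightarrow> f p \<in> Omega"
  shows "smooth_on S (\<lambda>p. xT (f p) (g p))"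
  unfolding xT_def by (intro smooth_on_diff smooth_on_Pair smooth_on_compose_cyl_height assms)

lemma smooth_on_quad:
  assumes "smooth_on S f" "smooth_on S g" "\<And>p. p \<in> S \<Longrightarrow> f p \<in> Omega"
  shows "smooth_on S (\<lambda>p. quad k (f p, g p))"
  unfolding quad_def fst_conv snd_conv
  by (intro smooth_on_inner smooth_on_linear_compose[OF _ bounded_linear_diag_A] smooth_on_xT assms)

section \<open>The amplitude as a symbol\<close>

lemma iter_deriv_const: "iter_deriv (v # vs) (\<lambda>_. c) = (\<lambda>_. 0)"
  by (induction vs arbitrary: v) auto

lemma iter_deriv_bounded_linear:
  assumes "bounded_linear F"
  shows "length vs \<ge> 2 \<Longrightarrow> iter_deriv vs F = (\<lambda>_. 0)" "iter_deriv [e] F = (\<lambda>_. F e)"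
proof -
  have d: "frechet_derivative F (at x) = F" for x
    using frechet_derivative_at[OF bounded_linear_imp_has_derivative[OF assms]] by simp
  then have s: "iter_deriv [e] F = (\<lambda>_. F e)" for e by simp
  show "iter_deriv [e] F = (\<lambda>_. F e)" by (rule s)
  assume "length vs \<ge> 2"
  then obtain v ws e where vs: "vs = v # ws @ [e]"
    by (cases vs; cases "tl vs" rule: rev_cases) auto
  have "iter_deriv vs F = iter_deriv (v # ws) (iter_deriv [e] F)"
    unfolding vs append_Cons[symmetric] by (rule iter_deriv_append)
  then show "iter_deriv vs F = (\<lambda>_. 0)" by (simp only: s iter_deriv_const)
qed

text \<open>On each half line the absolute value is linear, so that all derivatives of order two and more vanish.\<close>

lemma iter_deriv_abs_bound:
  shows "\<exists>C. \<forall>\<theta>. norm \<theta> \<ge> 1 \<longrightarrow> \<bar>iter_deriv es abs \<theta>\<bar> \<le> C * (1 + norm \<theta>) powr (1 - real (length es))"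
proof -
  have p: "iter_deriv es abs \<theta> = iter_deriv es (\<lambda>x. x) \<theta>" if "\<theta> > 0" for \<theta> :: real
    using that by (intro iter_deriv_cong_open[of "{0<..}"]) auto
  have n: "iter_deriv es abs \<theta> = iter_deriv es (\<lambda>x. - x) \<theta>" if "\<theta> < 0" for \<theta> :: real
    using that by (intro iter_deriv_cong_open[of "{..<0}"]) auto
  note id = iter_deriv_bounded_linear[OF bounded_linear_ident]
  note um = iter_deriv_bounded_linear[OF bounded_linear_minus[OF bounded_linear_ident]]
  consider "es = []" | e where "es = [e]" | "length es \<ge> 2"
    by (cases es; cases "tl es") auto
  then show ?thesis
  proof cases
    case 1
    then show ?thesis by (intro exI[of _ 1]) auto
  next
    case 2
    have "\<bar>iter_deriv es abs \<theta>\<bar> \<le> \<bar>e\<bar>" if "norm \<theta> \<ge> 1" for \<theta>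
      using p[of \<theta>] n[of \<theta>] fun_cong[OF id(2)[of e], of \<theta>] fun_cong[OF um(2)[of e], of \<theta>] that 2 by (cases "\<theta> > 0") auto
    then show ?thesis using 2 by (intro exI[of _ "\<bar>e\<bar>"]) auto
  next
    case 3
    have "iter_deriv es abs \<theta> = 0" if "norm \<theta> \<ge> 1" for \<theta>
      using p[of \<theta>] n[of \<theta>] id(1)[OF 3] um(1)[OF 3] that by (cases "\<theta> > 0") auto
    then show ?thesis by (intro exI[of _ 0]) auto
  qed
qed

lemma open_cone_over:
  fixes W :: "('u::euclidean_space \<times> 'v::euclidean_space) set"
  assumes "open W"
  shows "open (cone_over W :: ('u \<times> 'v \<times> 'w::euclidean_space) set)"
proof -
  have "cone_over W = ((\<lambda>p. (fst p, fst (snd p))) -` W) \<inter> ((\<lambda>p. snd (snd p)) -` (- {0 :: 'w}))"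
    by (auto simp: cone_over_def)
  then show ?thesis
    using assms by (auto intro!: open_Int open_vimage continuous_intros)
qed

text \<open>The amplitude separates the variables: derivatives in \<open>\<theta>\<close> act on one factor, derivatives in \<open>(u, v)\<close> on
  the other.\<close>

definition tensor ::
  "(real \<Rightarrow> real) \<Rightarrow> ('u::euclidean_space \<times> 'v::euclidean_space \<Rightarrow> complex) \<Rightarrow> 'u \<times> 'v \<times> real \<Rightarrow> complex" where
  "tensor r b p = of_real (r (snd (snd p))) * b (fst p, fst (snd p))"

lemma tensor_derivative:
  assumes "open W" "smooth_on W b" "smooth_on (- {0}) r" "p \<in> cone_over W"
  shows "frechet_derivative (tensor r b) (at p) (d1, d2, 0)
      = tensor r (\<lambda>q. frechet_derivative b (at q) (d1, d2)) p"
    and "frechet_derivative (tensor r b) (at p) (0, 0, d3)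
      = tensor (\<lambda>\<theta>. frechet_derivative r (at \<theta>) d3) b p"
proof -
  obtain u v \<theta> where p: "p = (u, v, \<theta>)" by (cases p)
  have W: "(u, v) \<in> W" and \<theta>: "\<theta> \<in> - {0}" using assms(4) by (auto simp: p cone_over_def)
  have db: "(b has_derivative frechet_derivative b (at (u, v))) (at (u, v))"
    by (rule smooth_on_has_derivative[OF assms(2) W])
  have dr: "(r has_derivative frechet_derivative r (at \<theta>)) (at \<theta>)"
    by (rule smooth_on_has_derivative[OF assms(3) \<theta>])
  have 1: "((\<lambda>p :: _ \<times> _ \<times> real. (fst p, fst (snd p))) has_derivative (\<lambda>h. (fst h, fst (snd h)))) (at p)"
    by (auto intro!: derivative_eq_intros)
  have 2: "((\<lambda>p :: _ \<times> _ \<times> real. snd (snd p)) has_derivative (\<lambda>h. snd (snd h))) (at p)"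
    by (auto intro!: derivative_eq_intros)
  have b': "((\<lambda>p :: _ \<times> _ \<times> real. b (fst p, fst (snd p))) has_derivative
      (\<lambda>h. frechet_derivative b (at (u, v)) (fst h, fst (snd h)))) (at p)"
    using has_derivative_compose[OF 1] db by (simp add: p)
  have r': "((\<lambda>p :: _ \<times> _ \<times> real. complex_of_real (r (snd (snd p)))) has_derivative
      (\<lambda>h. complex_of_real (frechet_derivative r (at \<theta>) (snd (snd h))))) (at p)"
    using has_derivative_of_real[OF has_derivative_compose[OF 2]] dr by (simp add: p)
  have "(tensor r b has_derivative (\<lambda>h. of_real (r \<theta>) * frechet_derivative b (at (u, v)) (fst h, fst (snd h))
      + of_real (frechet_derivative r (at \<theta>) (snd (snd h))) * b (u, v))) (at p)"
    unfolding tensor_def[abs_def] using has_derivative_mult[OF r' b'] by (simp add: p)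
  from frechet_derivative_at[OF this, symmetric]
  have D: "frechet_derivative (tensor r b) (at p) = (\<lambda>h. of_real (r \<theta>) * frechet_derivative b (at (u, v)) (fst h, fst (snd h))
      + of_real (frechet_derivative r (at \<theta>) (snd (snd h))) * b (u, v))" .
  have "frechet_derivative r (at \<theta>) 0 = 0" "frechet_derivative b (at (u, v)) (0, 0) = 0"
    using linear_0[OF has_derivative_linear[OF dr]] linear_0[OF has_derivative_linear[OF db]]
    by (auto simp: zero_prod_def)
  then show "frechet_derivative (tensor r b) (at p) (d1, d2, 0)
      = tensor r (\<lambda>q. frechet_derivative b (at q) (d1, d2)) p"
    "frechet_derivative (tensor r b) (at p) (0, 0, d3)
      = tensor (\<lambda>\<theta>. frechet_derivative r (at \<theta>) d3) b p"
    unfolding D by (auto simp: tensor_def p)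
qed

lemma iter_deriv_tensor:
  assumes "open W" "smooth_on W b" "smooth_on (- {0}) r"
    and "set ds \<subseteq> UNIV \<times> UNIV \<times> {0}" "set es \<subseteq> {0} \<times> {0} \<times> UNIV" "p \<in> cone_over W"
  shows "iter_deriv (ds @ es) (tensor r b) p
    = tensor (iter_deriv (map (\<lambda>e. snd (snd e)) es) r) (iter_deriv (map (\<lambda>d. (fst d, fst (snd d))) ds) b) p"
proof -
  have o: "open (cone_over W :: (_ \<times> _ \<times> real) set)" by (rule open_cone_over[OF assms(1)])
  let ?r = "iter_deriv (map (\<lambda>e. snd (snd e)) es) r"
  have e: "\<forall>p\<in>cone_over W. iter_deriv es (tensor r b) p = tensor ?r b p"
    using assms(5)
  proof (induction es)
    case (Cons e es)
    show ?case
    proof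
      fix p :: "_ \<times> _ \<times> real" assume p: "p \<in> cone_over W"
      obtain d3 where d3: "e = (0, 0, d3)" using Cons.prems by auto
      have "frechet_derivative (iter_deriv es (tensor r b)) (at p)
          = frechet_derivative (tensor (iter_deriv (map (\<lambda>e. snd (snd e)) es) r) b) (at p)"
        by (rule frechet_derivative_cong_open[OF o p]) (use Cons in auto)
      then show "iter_deriv (e # es) (tensor r b) p
          = tensor (iter_deriv (map (\<lambda>e. snd (snd e)) (e # es)) r) b p"
        using tensor_derivative(2)[OF assms(1,2) smooth_on_iter_deriv[OF assms(3)] p] by (simp add: d3)
    qed
  qed simp
  have "\<forall>p\<in>cone_over W. iter_deriv ds (tensor ?r b) p = tensor ?r (iter_deriv (map (\<lambda>d. (fst d, fst (snd d))) ds) b) p"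
    using assms(4)
  proof (induction ds)
    case (Cons d ds)
    show ?case
    proof
      fix p :: "_ \<times> _ \<times> real" assume p: "p \<in> cone_over W"
      obtain d1 d2 where d: "d = (d1, d2, 0)" using Cons.prems by auto
      have "frechet_derivative (iter_deriv ds (tensor ?r b)) (at p)
          = frechet_derivative (tensor ?r (iter_deriv (map (\<lambda>d. (fst d, fst (snd d))) ds) b)) (at p)"
        by (rule frechet_derivative_cong_open[OF o p]) (use Cons in auto)
      then show "iter_deriv (d # ds) (tensor ?r b) p
          = tensor ?r (iter_deriv (map (\<lambda>d. (fst d, fst (snd d))) (d # ds)) b) p"
        using tensor_derivative(1)[OF assms(1) smooth_on_iter_deriv[OF assms(2)] smooth_on_iter_deriv[OF assms(3)] p]
        by (simp add: d)
    qed
  qed simp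
  then show ?thesis
    using iter_deriv_cong_open[OF o assms(6), of "iter_deriv es (tensor r b)" "tensor ?r b" ds] e assms(6)
    by (simp add: iter_deriv_append)
qed

lemma smooth_on_tensor:
  assumes "smooth_on W b" "smooth_on (- {0}) r"
  shows "smooth_on (cone_over W) (tensor r b)"
  unfolding tensor_def[abs_def]
proof (intro smooth_on_mult smooth_on_of_real)
  have o: "open (cone_over W :: (_ \<times> _ \<times> real) set)"
    using open_cone_over smooth_on_open assms(1) by blast
  show "smooth_on (cone_over W) (\<lambda>p :: _ \<times> _ \<times> real. r (snd (snd p)))"
    by (rule smooth_on_compose[OF assms(2)], intro smooth_on_snd smooth_on_ident[OF o])
      (auto simp: cone_over_def)
  show "smooth_on (cone_over W) (\<lambda>p :: _ \<times> _ \<times> real. b (fst p, fst (snd p)))"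
    by (rule smooth_on_compose[OF assms(1)], intro smooth_on_Pair smooth_on_fst smooth_on_snd smooth_on_ident[OF o])
      (auto simp: cone_over_def)
qed

lemma smooth_on_real_abs: "smooth_on (- {0}) (abs :: real \<Rightarrow> real)"
  by (intro smooth_on_abs smooth_on_ident) auto

lemma symbol_abs_tensor:
  fixes b :: "'u::euclidean_space \<times> 'v::euclidean_space \<Rightarrow> complex"
  assumes "smooth_on W b"
  shows "symbol 1 W (tensor abs b)"
  unfolding symbol_def
proof (intro conjI allI impI)
  have oW: "open W" using assms smooth_on_open by blast
  show "smooth_on (cone_over W) (tensor abs b)" by (rule smooth_on_tensor[OF assms smooth_on_real_abs])
  have bound: "\<exists>B\<ge>0. \<forall>q\<in>K. norm (iter_deriv ds b q) \<le> B" if "compact K" "K \<subseteq> W" for K ds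
  proof -
    have "bounded (iter_deriv ds b ` K)"
      using compact_imp_bounded[OF compact_continuous_image[OF continuous_on_subset[OF
            smooth_on_continuous_on[OF smooth_on_iter_deriv[OF assms]] that(2)] that(1)]] .
    then obtain B where "\<forall>q\<in>K. norm (iter_deriv ds b q) \<le> B" by (auto simp: bounded_iff)
    then show ?thesis by (intro exI[of _ "\<bar>B\<bar>"]) force
  qed
  fix K and ds es :: "('u \<times> 'v \<times> real) list"
  let ?ds = "map (\<lambda>d. (fst d, fst (snd d))) ds" and ?es = "map (\<lambda>e. snd (snd e)) es"
  {
    assume a: "compact K \<and> K \<subseteq> W \<and> set ds \<subseteq> UNIV \<times> UNIV \<times> {0} \<and> set es \<subseteq> {0} \<times> {0} \<times> UNIV"
    obtain C where C: "\<forall>\<theta>. norm \<theta> \<ge> 1 \<longrightarrow> \<bar>iter_deriv ?es abs \<theta>\<bar> \<le> C * (1 + norm \<theta>) powr (1 - real (length ?es))"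
      using iter_deriv_abs_bound by blast
    obtain B where B: "B \<ge> 0" "\<forall>q\<in>K. norm (iter_deriv ?ds b q) \<le> B"
      using bound[of K ?ds] a by blast
    have "norm (iter_deriv (ds @ es) (tensor abs b) (u, v, \<theta>)) \<le> C * B * (1 + norm \<theta>) powr (1 - real (length es))"
      if "(u, v) \<in> K" "norm \<theta> \<ge> 1" for u v \<theta>
    proof -
      have p: "(u, v, \<theta>) \<in> cone_over W" using that a by (auto simp: cone_over_def)
      have "norm (iter_deriv (ds @ es) (tensor abs b) (u, v, \<theta>))
          = \<bar>iter_deriv ?es abs \<theta>\<bar> * norm (iter_deriv ?ds b (u, v))"
        using iter_deriv_tensor[OF oW assms smooth_on_real_abs _ _ p, of ds es] a
        by (simp add: tensor_def norm_mult)
      also have "\<dots> \<le> (C * (1 + norm \<theta>) powr (1 - real (length ?es))) * B"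
        using C[rule_format, OF that(2)] B that(1) by (intro mult_mono') auto
      finally show ?thesis by (simp add: mult_ac)
    qed
    then show "\<exists>C. \<forall>(u, v)\<in>K. \<forall>\<theta>. 1 \<le> norm \<theta> \<longrightarrow>
        norm (iter_deriv (ds @ es) (tensor abs b) (u, v, \<theta>)) \<le> C * (1 + norm \<theta>) powr (1 - real (length es))"
      by blast
  }
  {
    assume a: "compact K \<and> K \<subseteq> W \<and> set ds \<subseteq> UNIV \<times> UNIV \<times> {0}"
    obtain B where B: "B \<ge> 0" "\<forall>q\<in>K. norm (iter_deriv ?ds b q) \<le> B"
      using bound[of K ?ds] a by blast
    have "norm (iter_deriv ds (tensor abs b) (u, v, \<theta>)) \<le> B"
      if "(u, v) \<in> K" "0 < norm \<theta>" "norm \<theta> \<le> 1" for u v \<theta>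
    proof -
      have p: "(u, v, \<theta>) \<in> cone_over W" using that a by (auto simp: cone_over_def)
      have "norm (iter_deriv ds (tensor abs b) (u, v, \<theta>)) = \<bar>\<theta>\<bar> * norm (iter_deriv ?ds b (u, v))"
        using iter_deriv_tensor[OF oW assms smooth_on_real_abs _ _ p, of ds "[]"] a
        by (simp add: tensor_def norm_mult)
      also have "\<dots> \<le> 1 * B" using B that by (intro mult_mono') auto
      finally show ?thesis by simp
    qed
    then show "\<exists>C. \<forall>(u, v)\<in>K. \<forall>\<theta>. 0 < norm \<theta> \<and> norm \<theta> \<le> 1 \<longrightarrow>
        norm (iter_deriv ds (tensor abs b) (u, v, \<theta>)) \<le> C"
      by blast
  }
qed

section \<open>The Radon transform as a Fourier integral operator\<close>

text \<open>The half cylinder is not closed, as its edge is missing, so that its complement is not open.  The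
  phase and the amplitude are therefore considered wherever \<open>x\<close> differs from the centre
  \<open>(y, q y)\<close>.\<close>

definition regular_base :: "((real, 'm::{finite,linorder}) vec \<times> 'm space) set" where
  "regular_base = {p. fst p \<in> Omega \<and> xT (fst p) (snd p) \<noteq> 0}"

definition regular_pairs :: "('m::{finite,linorder} space \<times> 'm space) set" where
  "regular_pairs = {p. (fst (fst p), snd p) \<in> regular_base \<and> snd (fst p) > 0}"

definition conormal_length :: "(real, 'm::{finite,linorder}) vec \<times> 'm space \<Rightarrow> complex" where
  "conormal_length p = of_real (2 * norm (xT (fst p) (snd p)))"

lemma open_Omega_times: "open (Omega \<times> UNIV)"
  by (intro open_Times open_Omega open_UNIV)

lemma open_regular_base: "open (regular_base :: ((real, 'm::{finite,linorder}) vec \<times> 'm space) set)"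
proof -
  have "continuous_on (Omega \<times> UNIV) (\<lambda>p :: (real, 'm) vec \<times> 'm space. xT (fst p) (snd p))"
    by (intro smooth_on_continuous_on smooth_on_xT smooth_on_fst smooth_on_snd smooth_on_ident
        open_Omega_times) auto
  from continuous_open_preimage[OF this open_Omega_times, of "- {0}"]
  have "open ((Omega \<times> UNIV) \<inter> (\<lambda>p :: (real, 'm) vec \<times> 'm space. xT (fst p) (snd p)) -` (- {0}))" by (simp add: open_Compl)
  moreover have "(Omega \<times> UNIV) \<inter> (\<lambda>p :: (real, 'm) vec \<times> 'm space. xT (fst p) (snd p)) -` (- {0}) = regular_base"
    by (auto simp: regular_base_def)
  ultimately show ?thesis by simp
qed

lemma open_regular_pairs: "open (regular_pairs :: ('m::{finite,linorder} space \<times> 'm space) set)"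
proof -
  have eq: "(regular_pairs :: ('m space \<times> 'm space) set) = ((\<lambda>p. (fst (fst p), snd p)) -` regular_base) \<inter> ((\<lambda>p. snd (fst p)) -` {0<..})"
    by (auto simp: regular_pairs_def)
  show ?thesis
    unfolding eq by (intro open_Int open_vimage open_regular_base open_greaterThan continuous_intros)
qed

lemma smooth_on_quad_base: "smooth_on regular_base (quad k)"
proof -
  have "smooth_on regular_base (\<lambda>p. quad k (fst p, snd p))"
    by (intro smooth_on_quad smooth_on_fst smooth_on_snd smooth_on_ident open_regular_base)
      (simp add: regular_base_def)
  then show ?thesis by simp
qed

lemma smooth_on_conormal_length: "smooth_on regular_base conormal_length"
  unfolding conormal_length_def
  by (intro smooth_on_of_real smooth_on_mult smooth_on_const smooth_on_norm smooth_on_xT smooth_on_fst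
      smooth_on_snd smooth_on_ident open_regular_base) (auto simp: regular_base_def)

lemma half_cylinder_complement_regular:
  "y \<in> Omega \<Longrightarrow> x \<in> - half_cylinder \<Longrightarrow> (y, x) \<in> regular_base"
  using xT_eq_0_iff by (simp add: regular_base_def)

lemma phase_function_psi: "phase_function (regular_pairs :: ('m::{finite,linorder} space \<times> 'm space) set) (psi k)"
  unfolding phase_function_def
proof (intro conjI ballI, goal_cases)
  case 1
  let ?C = "cone_over regular_pairs :: ('m space \<times> 'm space \<times> real) set"
  have o: "open ?C" by (rule open_cone_over[OF open_regular_pairs])
  have "smooth_on ?C (\<lambda>p. snd (snd p) * (snd (fst p) - quad k (fst (fst p), fst (snd p))))"
  proof (intro smooth_on_mult smooth_on_diff smooth_on_quad smooth_on_fst smooth_on_snd smooth_on_ident o)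
    show "fst (fst p) \<in> Omega" if "p \<in> ?C" for p
      using that by (auto simp: cone_over_def regular_pairs_def regular_base_def)
  qed
  then show ?case by (rule smooth_on_cong) (metis prod.collapse psi_eq)
next
  case (2 p)
  obtain u v \<theta> where p: "p = (u, v, \<theta>)" by (cases p)
  have r: "fst u \<in> Omega" "xT (fst u) v \<noteq> 0" "\<theta> \<noteq> 0"
    using 2 by (auto simp: p cone_over_def regular_pairs_def regular_base_def)
  have "psi k (u, v, s *\<^sub>R \<theta>) = s * psi k (u, v, \<theta>)" for s
    by (cases u) (simp add: psi_eq)
  moreover have "grad (\<lambda>u. psi k (u, v, \<theta>)) u \<noteq> 0"
    unfolding grad_psi_u[OF r(1)] using r(3) by (simp add: zero_prod_def)
  moreover have "grad (\<lambda>v. psi k (u, v, \<theta>)) v \<noteq> 0"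
    unfolding grad_psi_x using r by simp
  ultimately show ?case by (simp add: p zero_prod_def)
qed

lemma nondegenerate_phase_psi: "nondegenerate_phase (regular_pairs :: ('m::{finite,linorder} space \<times> 'm space) set) (psi k)"
  unfolding nondegenerate_phase_def
proof (intro conjI ballI phase_function_psi)
  fix p :: "'m space \<times> 'm space \<times> real" assume "p \<in> cone_over regular_pairs"
  then obtain u v \<theta> where p: "p = (u, v, \<theta>)" and u: "fst u \<in> Omega"
    by (cases p) (auto simp: cone_over_def regular_pairs_def regular_base_def)
  have "c = 0" if 0: "frechet_derivative (\<lambda>(u, v, \<theta>). c \<bullet> grad (\<lambda>\<theta>. psi k (u, v, \<theta>)) \<theta>) (at (u, v, \<theta>)) = (\<lambda>_. 0)"
    for c :: real
  proof -
    have "((\<lambda>p :: 'm space \<times> 'm space \<times> real. (fst (fst p), fst (snd p))) has_derivative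
        (\<lambda>h. (fst (fst h), fst (snd h)))) (at (u, v, \<theta>))"
      by (auto intro!: derivative_eq_intros)
    from has_derivative_compose[OF this] quad_has_derivative[OF u, of k v]
    have q: "((\<lambda>p :: 'm space \<times> 'm space \<times> real. quad k (fst (fst p), fst (snd p))) has_derivative
        (\<lambda>h. 2 * (diag_A k (xT (fst u) v) \<bullet> (fst (snd h) - lift (fst u) (fst (fst h)))))) (at (u, v, \<theta>))"
      by fastforce
    have d: "((\<lambda>p :: 'm space \<times> 'm space \<times> real. c * (snd (fst p) - quad k (fst (fst p), fst (snd p)))) has_derivative
        (\<lambda>h. c * (snd (fst h) - 2 * (diag_A k (xT (fst u) v) \<bullet> (fst (snd h) - lift (fst u) (fst (fst h))))))) (at (u, v, \<theta>))"
      by (intro has_derivative_mult_right has_derivative_diff q) (auto intro!: derivative_eq_intros)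
    have e: "(\<lambda>(u, v, \<theta>). c \<bullet> grad (\<lambda>\<theta>. psi k (u, v, \<theta>)) \<theta>)
        = (\<lambda>p :: 'm space \<times> 'm space \<times> real. c * (snd (fst p) - quad k (fst (fst p), fst (snd p))))"
      by (auto simp: fun_eq_iff grad_psi_omega)
    note z = fun_cong[OF trans[OF frechet_derivative_at[OF d] 0[unfolded e]]]
    from z[of "((0, 1), 0, 0)"] show "c = 0"
      by (simp add: lift_def flip: zero_prod_def)
  qed
  then show "case p of (u, v, \<theta>) \<Rightarrow> grad (\<lambda>\<theta>. psi k (u, v, \<theta>)) \<theta> = 0 \<longrightarrow>
      (\<forall>c. frechet_derivative (\<lambda>(u, v, \<theta>). c \<bullet> grad (\<lambda>\<theta>. psi k (u, v, \<theta>)) \<theta>) (at (u, v, \<theta>)) = (\<lambda>_. 0) \<longrightarrow> c = 0)"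
    by (simp only: p case_prod_conv) blast
qed

lemma symbol_amplitude: "symbol 1 (regular_pairs :: ('m::{finite,linorder} space \<times> 'm space) set) (amplitude k)"
proof -
  let ?b = "\<lambda>p :: 'm space \<times> 'm space. conormal_length (fst (fst p), snd p)"
  have s: "smooth_on regular_pairs ?b"
    by (rule smooth_on_compose[OF smooth_on_conormal_length],
        intro smooth_on_Pair smooth_on_fst smooth_on_snd smooth_on_ident[OF open_regular_pairs])
      (simp add: regular_pairs_def)
  have e: "tensor abs ?b = amplitude k"
  proof
    fix p :: "'m space \<times> 'm space \<times> real"
    show "tensor abs ?b p = amplitude k p"
      by (cases p) (simp add: tensor_def conormal_length_def amplitude_eq)
  qed
  show ?thesis using symbol_abs_tensor[OF s] unfolding e .
qed

abbreviation source :: "('m::{finite,linorder}) space set" where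
  "source \<equiv> Omega \<times> {0<..}"

definition transform :: "nat \<Rightarrow> ('m::{finite,linorder} space \<Rightarrow> complex) \<Rightarrow> 'm space \<Rightarrow> complex" where
  "transform k g x = osc_integral (fibre_integral (psi k) (amplitude k) g x)"

lemma Radon_eq: "Radon k f g = f (transform k g)"
  by (simp add: Radon_def transform_def[abs_def])

text \<open>For sources in a compact set \<open>K\<close> the centres \<open>(y, q y)\<close> form a compact part of the half cylinder.  Its
  complement, on which the transform of a test function supported in \<open>K\<close> is smooth, is an open
  neighbourhood of the complement of the half cylinder.\<close>

locale radon_sources =
  fixes K :: "('m::{finite,linorder}) space set" and k :: nat
  assumes K: "compact K" "K \<subseteq> source"

sublocale radon_sources \<subseteq> level_set_phase "quad k" regular_base K
  by unfold_locales (rule smooth_on_quad_base, rule K)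

context radon_sources
begin

lemma half_cylinder_complement_subset: "- half_cylinder \<subseteq> W"
  using K(2) half_cylinder_complement_regular by (fastforce simp: W_def)

lemma vanishing_if_supported:
  assumes "g \<in> test_functions source" "supp g \<subseteq> K"
  shows "vanishing g"
proof -
  have "g u = 0" if "u \<notin> K" for u
  proof (rule ccontr)
    assume "g u \<noteq> 0"
    then have "u \<in> supp g" using closure_subset[THEN subsetD, of u "{x. g x \<noteq> 0}"] by (simp add: supp_def)
    then show False using assms(2) that by blast
  qed
  then show ?thesis using assms(1) unfolding vanishing_def test_functions_def by blast
qed

lemma fibre_integral_eq:
  assumes "vanishing g"
  shows "fibre_integral (psi k) (amplitude k) g x = (\<lambda>\<omega>. complex_of_real \<bar>\<omega>\<bar> * kernel_integral (wave \<omega>) conormal_length g x)"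
proof
  fix \<omega>
  have "fibre_integral (psi k) (amplitude k) g x \<omega>
      = (LINT u|lborel. complex_of_real \<bar>\<omega>\<bar> * (wave \<omega> (snd u - quad k (fst u, x)) * conormal_length (fst u, x) * g u))"
    unfolding fibre_integral_def
  proof (intro Bochner_Integration.integral_cong refl)
    fix u :: "'m space"
    have "psi k (u, x, \<omega>) = \<omega> * (snd u - quad k (fst u, x))" by (cases u) (simp add: psi_eq)
    then show "exp (\<i> * complex_of_real (psi k (u, x, \<omega>))) * amplitude k (u, x, \<omega>) * g u
        = complex_of_real \<bar>\<omega>\<bar> * (wave \<omega> (snd u - quad k (fst u, x)) * conormal_length (fst u, x) * g u)"
      by (simp only: amplitude_eq conormal_length_def fst_conv snd_conv of_real_mult) (simp only: mult_ac)
  qed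
  then show "fibre_integral (psi k) (amplitude k) g x \<omega>
      = complex_of_real \<bar>\<omega>\<bar> * kernel_integral (wave \<omega>) conormal_length g x"
    by (simp add: kernel_integral_def)
qed

lemma has_osc_integral_transform:
  assumes "vanishing g" "x \<in> W"
  shows "has_osc_integral (fibre_integral (psi k) (amplitude k) g x) (transform k g x)"
    and "transform k g x = kernel_integral regular_kernel conormal_length (regularize (regularize g)) x"
proof -
  note h = osc_integral_kernel[OF smooth_on_conormal_length assms, folded fibre_integral_eq[OF assms(1)]]
  show t: "transform k g x = kernel_integral regular_kernel conormal_length (regularize (regularize g)) x"
    unfolding transform_def by (rule osc_integral_eq[OF h])
  show "has_osc_integral (fibre_integral (psi k) (amplitude k) g x) (transform k g x)"
    using h unfolding t .
qed

lemma smooth_on_transform: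
  assumes "vanishing g"
  shows "smooth_on W (transform k g)"
  by (rule smooth_on_cong[OF smooth_on_kernel_integral[OF regular_kernel_deriv regular_kernel'_continuous
          smooth_on_conormal_length vanishing_regularize[OF vanishing_regularize[OF assms]]]])
    (use has_osc_integral_transform(2)[OF assms] in simp)

lemma transform_lincomb:
  assumes "vanishing g" "vanishing h" "x \<in> W"
  shows "transform k (\<lambda>u. c * g u + d * h u) x = c * transform k g x + d * transform k h x"
  unfolding has_osc_integral_transform(2)[OF assms(1,3)] has_osc_integral_transform(2)[OF assms(2,3)]
    has_osc_integral_transform(2)[OF vanishing_lincomb[OF assms(1,2)] assms(3)]
    regularize_lincomb[OF assms(1,2)] regularize_lincomb[OF vanishing_regularize[OF assms(1)] vanishing_regularize[OF assms(2)]]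
  by (intro kernel_integral_lincomb regular_kernel_continuous smooth_on_conormal_length vanishing_regularize assms)

end

lemma compact_distribution_bound:
  assumes "f \<in> compact_distributions V" "open N" "V \<subseteq> N"
  shows "\<exists>L C m. compact L \<and> L \<subseteq> N \<and>
    (\<forall>h M. smooth_on N h \<and> deriv_bound m L h M \<longrightarrow> norm (f h) \<le> C * M)"
  using assms by (simp add: compact_distributions_def)

text \<open>The transform of a test function is only controlled near the complement of the half cylinder.  This
  suffices because two functions that agree near \<open>V\<close> have a difference with vanishing seminorms.\<close>

lemma compact_distribution_lincomb:
  fixes f :: "'a::euclidean_space functional"
  assumes f: "f \<in> compact_distributions V" and "V \<subseteq> N" and s: "smooth_on N g" "smooth_on N h" "smooth_on N q"
    and eq: "\<And>x. x \<in> N \<Longrightarrow> q x = c * g x + d * h x"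
  shows "f q = c * f g + d * f h"
proof -
  have lin: "linear_functional_on (smooth_functions V) f" using f by (simp add: compact_distributions_def)
  have mem: "a \<in> smooth_functions V" if "smooth_on N a" for a
    using that assms(2) by (auto simp: smooth_functions_def)
  have add: "f (\<lambda>x. a x + b x) = f a + f b" if "smooth_on N a" "smooth_on N b" for a b
    using lin mem[OF that(1)] mem[OF that(2)] unfolding linear_functional_on_def by simp
  have scale: "f (\<lambda>x. e * a x) = e * f a" if "smooth_on N a" for a e
    using lin mem[OF that] unfolding linear_functional_on_def by simp
  have cs: "smooth_on N (\<lambda>x. e * a x)" if "smooth_on N a" for a :: "_ \<Rightarrow> complex" and e
    using that smooth_on_open[OF that] by (intro smooth_on_mult smooth_on_const)
  let ?r = "\<lambda>x. q x + (- 1) * (c * g x + d * h x)"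
  have r: "smooth_on N ?r" by (intro smooth_on_add s cs)
  have oN: "open N" using smooth_on_open s by blast
  obtain L C m where L: "compact L" "L \<subseteq> N"
    and bd: "\<forall>h M. smooth_on N h \<and> deriv_bound m L h M \<longrightarrow> norm (f h) \<le> C * M"
    using compact_distribution_bound[OF f oN assms(2)] by (elim exE conjE) (rule that)
  have "deriv_bound m L ?r 0"
    unfolding deriv_bound_def
  proof (intro conjI allI impI)
    fix vs :: "'a list" and x assume a: "set vs \<subseteq> Basis \<and> length vs \<le> m \<and> x \<in> L"
    have "iter_deriv vs ?r x = iter_deriv vs (\<lambda>_. 0) x"
      using a L(2) eq by (intro iter_deriv_cong_open[OF oN]) auto
    also have "\<dots> = 0"
      by (cases vs) (simp_all only: iter_deriv_const iter_deriv.simps(1))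
    finally show "norm (iter_deriv vs ?r x) \<le> 0" by simp
  qed simp
  from bd[rule_format, OF conjI[OF r this]] have "f ?r = 0" by simp
  moreover have "f ?r = f q + (- 1) * (c * f g + d * f h)"
    using add[OF s(3) cs[of "\<lambda>x. c * g x + d * h x" "- 1"]] scale[of "\<lambda>x. c * g x + d * h x" "- 1"]
      add[OF cs[OF s(1), of c] cs[OF s(2), of d]] scale[OF s(1), of c] scale[OF s(2), of d]
      smooth_on_add[OF cs[OF s(1), of c] cs[OF s(2), of d]] by simp
  ultimately have "f q = - ((- 1) * (c * f g + d * f h))" by (simp only: eq_neg_iff_add_eq_0)
  then show ?thesis by simp
qed

lemma Radon_lincomb:
  fixes f :: "'m::{finite,linorder} space functional"
  assumes f: "f \<in> compact_distributions (- half_cylinder)"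
    and g: "g \<in> test_functions source" and h: "h \<in> test_functions source"
  shows "Radon k f (\<lambda>u. c * g u + d * h u) = c * Radon k f g + d * Radon k f h"
proof -
  have "compact (supp g \<union> supp h)" "supp g \<union> supp h \<subseteq> source"
    using g h by (auto simp: test_functions_def)
  then interpret radon_sources "supp g \<union> supp h" k by unfold_locales
  have v: "vanishing g" "vanishing h" using g h by (auto intro: vanishing_if_supported)
  show ?thesis
    unfolding Radon_eq
    by (rule compact_distribution_lincomb[OF f half_cylinder_complement_subset smooth_on_transform[OF v(1)]
          smooth_on_transform[OF v(2)] smooth_on_transform[OF vanishing_lincomb[OF v]] transform_lincomb[OF v]])
qed

text \<open>The continuity estimate for \<open>f\<close> is composed with the one for the transform.\<close>

lemma Radon_distribution:
  fixes f :: "'m::{finite,linorder} space functional"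
  assumes f: "f \<in> compact_distributions (- half_cylinder)"
  shows "Radon k f \<in> distributions source"
  unfolding distributions_def mem_Collect_eq
proof (intro conjI allI impI)
  show "linear_functional_on (test_functions source) (Radon k f)"
    unfolding linear_functional_on_def
  proof (intro conjI ballI allI)
    fix g h :: "'m space \<Rightarrow> complex"
    assume gh: "g \<in> test_functions source" "h \<in> test_functions source"
    show "Radon k f (\<lambda>x. g x + h x) = Radon k f g + Radon k f h"
      using Radon_lincomb[OF f gh, of k 1 1] by simp
  next
    fix c and g :: "'m space \<Rightarrow> complex"
    assume g: "g \<in> test_functions source"
    show "Radon k f (\<lambda>x. c * g x) = c * Radon k f g"
      using Radon_lincomb[OF f g g, of k c 0] by simp
  qed
next
  fix K :: "'m space set" assume "compact K \<and> K \<subseteq> source"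
  then interpret radon_sources K k by unfold_locales auto
  obtain L C m where L: "compact L" "L \<subseteq> W"
    and fb: "\<forall>h M. smooth_on W h \<and> deriv_bound m L h M \<longrightarrow> norm (f h) \<le> C * M"
    using compact_distribution_bound[OF f open_W half_cylinder_complement_subset] by (elim exE conjE) (rule that)
  obtain C' J where C': "C' \<ge> 0" and b: "\<forall>\<phi> M vs x. vanishing \<phi> \<and> M \<ge> 0 \<and>
      (\<forall>j\<le>J. \<forall>u\<in>K. norm (time_deriv j \<phi> u) \<le> M) \<and> set vs \<subseteq> Basis \<and> length vs \<le> m \<and> x \<in> L \<longrightarrow>
      norm (iter_deriv vs (kernel_integral regular_kernel conormal_length (regularize (regularize \<phi>))) x) \<le> C' * M"
    using osc_integral_derivatives_bound[OF smooth_on_conormal_length L, of m] by (elim exE conjE) (rule that)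
  have "norm (Radon k f g) \<le> (C * C') * M"
    if g: "g \<in> test_functions source" "supp g \<subseteq> K" and M: "deriv_bound J K g M" for g M
  proof -
    have v: "vanishing g" by (rule vanishing_if_supported[OF g])
    have M0: "M \<ge> 0" using M by (simp add: deriv_bound_def)
    have tb: "\<forall>j\<le>J. \<forall>u\<in>K. norm (time_deriv j g u) \<le> M"
    proof (intro allI impI ballI)
      fix j u assume "j \<le> J" "u \<in> K"
      moreover have "set (replicate j (0 :: (real, 'm) vec, 1 :: real)) \<subseteq> Basis"
        by (auto simp: set_replicate_conv_if Basis_prod_def)
      ultimately show "norm (time_deriv j g u) \<le> M"
        using M unfolding deriv_bound_def by (metis length_replicate)
    qed
    have "deriv_bound m L (transform k g) (C' * M)"
      unfolding deriv_bound_def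
    proof (intro conjI allI impI)
      show "0 \<le> C' * M" using C' M0 by simp
      fix vs :: "'m space list" and x assume a: "set vs \<subseteq> Basis \<and> length vs \<le> m \<and> x \<in> L"
      have "iter_deriv vs (transform k g) x
          = iter_deriv vs (kernel_integral regular_kernel conormal_length (regularize (regularize g))) x"
        using a L(2) by (intro iter_deriv_cong_open[OF open_W] has_osc_integral_transform(2)[OF v]) auto
      then show "norm (iter_deriv vs (transform k g) x) \<le> C' * M"
        using b[rule_format, of g M vs x] v M0 tb a by simp
    qed
    from fb[rule_format, OF conjI[OF smooth_on_transform[OF v] this]] show ?thesis by (simp add: Radon_eq mult_ac)
  qed
  then show "\<exists>C N. \<forall>g\<in>test_functions source. supp g \<subseteq> K \<longrightarrow>
      (\<forall>M. deriv_bound N K g M \<longrightarrow> norm (Radon k f g) \<le> C * M)"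
    by (intro exI[of _ "C * C'"] exI[of _ J]) simp
qed

lemma transform_smooth_function:
  assumes "g \<in> test_functions source"
  shows "transform k g \<in> smooth_functions (- half_cylinder)"
proof -
  have K: "compact (supp g)" "supp g \<subseteq> source" using assms by (auto simp: test_functions_def)
  interpret radon_sources "supp g" k using K by unfold_locales
  show ?thesis
    using half_cylinder_complement_subset smooth_on_transform[OF vanishing_if_supported[OF assms]]
    unfolding smooth_functions_def by auto
qed

text \<open>Pairing \<open>Radon k f\<close> with \<open>g\<close> is evaluating \<open>f\<close> at the smooth function \<open>transform k g\<close>, so that weak-* continuity
  reduces to the continuity of the evaluations.\<close>

lemma continuous_linear_operator_Radon:
  "continuous_linear_operator (- half_cylinder) (source :: 'm::{finite,linorder} space set) (Radon k)"
  unfolding continuous_linear_operator_def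
proof (intro conjI ballI allI)
  let ?V = "- half_cylinder :: 'm space set"
  show "continuous_map (weak_star (compact_distributions ?V) (smooth_functions ?V))
      (weak_star (distributions source) (test_functions source)) (Radon k)" (is "continuous_map ?X _ _")
  proof -
    have X: "topspace ?X = compact_distributions ?V"
      by (auto simp: weak_star_def topspace_pullback_topology)
    have "continuous_map ?X (product_topology (\<lambda>_. euclidean) (test_functions source))
        ((\<lambda>u. restrict u (test_functions source)) \<circ> Radon k)"
      unfolding continuous_map_componentwise
    proof (intro conjI ballI)
      show "((\<lambda>u. restrict u (test_functions source)) \<circ> Radon k) ` topspace ?X \<subseteq> extensional (test_functions source)"
        by auto
      fix g :: "'m space \<Rightarrow> complex" assume g: "g \<in> test_functions source"
      have "continuous_map ?X euclidean ((\<lambda>F. F (transform k g)) \<circ> (\<lambda>u. restrict u (smooth_functions ?V)))"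
        unfolding weak_star_def
        by (intro continuous_map_pullback continuous_map_product_projection transform_smooth_function g)
      then show "continuous_map ?X euclidean (\<lambda>x. ((\<lambda>u. restrict u (test_functions source)) \<circ> Radon k) x g)"
        using transform_smooth_function[OF g] g by (simp add: comp_def Radon_eq)
    qed
    then show ?thesis
      unfolding weak_star_def[of "distributions source"]
      using Radon_distribution X by (intro continuous_map_pullback') auto
  qed
qed (simp_all add: Radon_eq)

theorem fourier_integral_operator_Radon:
  "fourier_integral_operator (source :: 'm::{finite,linorder} space set) (- half_cylinder) (psi k) (amplitude k) (Radon k)"
  unfolding fourier_integral_operator_def
proof (intro conjI exI[of _ regular_pairs] exI[of _ 1])
  show "open (source :: 'm space set)" by (intro open_Times open_Omega open_greaterThan)
  show "(source :: 'm space set) \<times> - half_cylinder \<subseteq> regular_pairs"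
    using half_cylinder_complement_regular by (auto simp: regular_pairs_def)
  show "has_osc_kernel (source :: 'm space set) (- half_cylinder) (psi k) (amplitude k) (Radon k)"
    unfolding has_osc_kernel_def
  proof
    fix g :: "'m space \<Rightarrow> complex" assume g: "g \<in> test_functions source"
    then have K: "compact (supp g)" "supp g \<subseteq> source" by (auto simp: test_functions_def)
    interpret radon_sources "supp g" k using K by unfold_locales
    have v: "vanishing g" by (rule vanishing_if_supported[OF g]) simp
    show "\<exists>W h. - half_cylinder \<subseteq> W \<and> smooth_on W h \<and>
        (\<forall>v\<in>W. has_osc_integral (fibre_integral (psi k) (amplitude k) g v) (h v)) \<and>
        (\<forall>f\<in>compact_distributions (- half_cylinder). Radon k f g = f h)"
      using half_cylinder_complement_subset smooth_on_transform[OF v] has_osc_integral_transform(1)[OF v]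
      by (intro exI[of _ W] exI[of _ "transform k g"]) (simp add: Radon_eq)
  qed
qed (rule open_regular_pairs nondegenerate_phase_psi symbol_amplitude continuous_linear_operator_Radon)+

section \<open>Jacobian determinants of factored differentials\<close>

definition endo_det :: "('a::euclidean_space \<Rightarrow> 'a) \<Rightarrow> real" where
  "endo_det T = det (\<chi> (i :: 'a basis_index) (j :: 'a basis_index). T (Rep_basis_index j) \<bullet> Rep_basis_index i)"

definition matched_det :: "('a::euclidean_space \<Rightarrow> 'b::euclidean_space) \<Rightarrow> real" where
  "matched_det T = det (\<chi> (i :: 'a basis_index) (j :: 'a basis_index).
     T (Rep_basis_index j) \<bullet> (basis_matching (Rep_basis_index i) :: 'b))"

lemma jacobian_det_eq: "jacobian_det f p = matched_det (frechet_derivative f (at p))"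
  by (simp add: jacobian_det_def matched_det_def)

lemma basis_index_props:
  "Rep_basis_index i \<in> Basis" "Rep_basis_index i = Rep_basis_index j \<longleftrightarrow> i = j"
  "bij_betw Rep_basis_index UNIV Basis"
proof -
  interpret type_definition Rep_basis_index Abs_basis_index Basis by (rule type_definition_basis_index)
  show "Rep_basis_index i \<in> Basis" by (rule Rep)
  show "Rep_basis_index i = Rep_basis_index j \<longleftrightarrow> i = j" by (rule Rep_inject)
  show "bij_betw Rep_basis_index UNIV Basis"
    by (simp add: bij_betw_def inj_on_def Rep_inject Rep_range)
qed

lemma basis_index_expansion: "(\<Sum>k\<in>UNIV. (v \<bullet> Rep_basis_index k) *\<^sub>R Rep_basis_index k) = v"
  using sum.reindex_bij_betw[OF basis_index_props(3), of "\<lambda>b. (v \<bullet> b) *\<^sub>R b"]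
  by (simp add: euclidean_representation)

text \<open>The family \<open>\<beta>\<close> stands for the standard basis of the target or for its matched enumeration.\<close>

lemma det_compose_aux:
  fixes S :: "'a::euclidean_space \<Rightarrow> 'a" and T :: "'a \<Rightarrow> 'b::euclidean_space" and \<beta> :: "'a basis_index \<Rightarrow> 'b"
  assumes "linear T"
  shows "det (\<chi> (i :: 'a basis_index) (j :: 'a basis_index). T (S (Rep_basis_index j)) \<bullet> \<beta> i)
    = det (\<chi> (i :: 'a basis_index) (j :: 'a basis_index). T (Rep_basis_index j) \<bullet> \<beta> i) * endo_det S"
proof -
  have "T (S (Rep_basis_index j)) \<bullet> \<beta> i
      = (\<Sum>k\<in>UNIV. (T (Rep_basis_index k) \<bullet> \<beta> i) * (S (Rep_basis_index j) \<bullet> Rep_basis_index k))" for i and j :: "'a basis_index"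
  proof -
    have "T (S (Rep_basis_index j)) = T (\<Sum>k\<in>UNIV. (S (Rep_basis_index j) \<bullet> Rep_basis_index k) *\<^sub>R Rep_basis_index k)"
      by (simp only: basis_index_expansion)
    also have "\<dots> = (\<Sum>k\<in>UNIV. (S (Rep_basis_index j) \<bullet> Rep_basis_index k) *\<^sub>R T (Rep_basis_index k))"
      using assms by (simp add: linear_sum linear_cmul)
    finally show ?thesis by (simp add: inner_sum_left mult.commute)
  qed
  then have "(\<chi> (i :: 'a basis_index) (j :: 'a basis_index). T (S (Rep_basis_index j)) \<bullet> \<beta> i)
    = (\<chi> (i :: 'a basis_index) (j :: 'a basis_index). T (Rep_basis_index j) \<bullet> \<beta> i)
      ** (\<chi> i j. S (Rep_basis_index j) \<bullet> Rep_basis_index i)"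
    by (simp add: matrix_matrix_mult_def vec_eq_iff)
  then show ?thesis by (simp add: det_mul endo_det_def)
qed

lemma matched_det_compose: "linear T \<Longrightarrow> matched_det (\<lambda>v. T (S v)) = matched_det T * endo_det S"
  unfolding matched_det_def by (rule det_compose_aux)

lemma endo_det_compose: "linear T \<Longrightarrow> endo_det (\<lambda>v. T (S v)) = endo_det T * endo_det S"
  unfolding endo_det_def[of T] endo_det_def[of "\<lambda>v. T (S v)"] by (rule det_compose_aux)

lemma endo_det_ident: "endo_det (\<lambda>v. v) = 1"
proof -
  have "(\<chi> (i :: 'a basis_index) (j :: 'a basis_index). Rep_basis_index j \<bullet> Rep_basis_index i) = mat 1"
    by (simp add: mat_def vec_eq_iff inner_Basis basis_index_props)
  then show ?thesis by (simp add: endo_det_def)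
qed

lemma endo_det_nonzero:
  assumes "linear T" "inj T"
  shows "endo_det T \<noteq> 0"
proof -
  obtain S where S: "linear S" "S \<circ> T = id"
    using linear_injective_left_inverse[OF assms] by blast
  have "(\<lambda>v. S (T v)) = (\<lambda>v. v)" using S(2) by (simp add: fun_eq_iff)
  then have "endo_det S * endo_det T = 1"
    using endo_det_compose[OF S(1), of T] by (simp add: endo_det_ident)
  then show ?thesis by auto
qed

lemma basis_matching_bij:
  assumes "DIM('a::euclidean_space) = DIM('b::euclidean_space)"
  shows "bij_betw (basis_matching :: 'a \<Rightarrow> 'b) Basis Basis"
  unfolding basis_matching_def
  by (rule someI_ex[where P = "\<lambda>\<beta>. bij_betw \<beta> Basis Basis"])
    (rule finite_same_card_bij[OF finite_Basis finite_Basis assms])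

text \<open>Composing with the isomorphism \<open>J\<close> that undoes the matching of the bases reduces this to endomorphisms.\<close>

lemma matched_det_nonzero:
  fixes T :: "'a::euclidean_space \<Rightarrow> 'b::euclidean_space"
  assumes "DIM('a) = DIM('b)" "linear T" "inj T"
  shows "matched_det T \<noteq> 0"
proof -
  define J :: "'b \<Rightarrow> 'a" where "J = (\<lambda>w. \<Sum>k\<in>UNIV. (w \<bullet> basis_matching (Rep_basis_index k)) *\<^sub>R Rep_basis_index k)"
  have J: "J w \<bullet> Rep_basis_index i = w \<bullet> basis_matching (Rep_basis_index i)" for w and i :: "'a basis_index"
  proof -
    have "J w \<bullet> Rep_basis_index i = (\<Sum>k\<in>UNIV. if k = i then w \<bullet> basis_matching (Rep_basis_index k) else 0)"
      unfolding J_def inner_sum_left by (intro sum.cong) (auto simp: inner_Basis basis_index_props)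
    then show ?thesis by simp
  qed
  have lJ: "linear J"
    unfolding J_def by (intro linearI) (simp_all add: inner_add_left scaleR_add_left sum.distrib scaleR_sum_right)
  have "w = 0" if "J w = 0" for w
  proof -
    have "w \<bullet> b = 0" if b: "b \<in> Basis" for b
    proof -
      obtain a :: 'a where a: "a \<in> Basis" "b = basis_matching a"
        using basis_matching_bij[OF assms(1)] b by (auto simp: bij_betw_def)
      obtain i where "a = Rep_basis_index i"
        using basis_index_props(3) a(1) by (auto simp: bij_betw_def)
      then show ?thesis using J[of w i] \<open>J w = 0\<close> a(2) by simp
    qed
    then show ?thesis by (simp add: euclidean_eq_iff[of w 0])
  qed
  then have "inj J" using linear_injective_0[OF lJ] by blast
  then have "endo_det (\<lambda>v. J (T v)) \<noteq> 0"
    using linear_compose[OF assms(2) lJ] inj_compose[of J T] assms(3)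
    by (intro endo_det_nonzero) (auto simp: o_def)
  moreover have "endo_det (\<lambda>v. J (T v)) = matched_det T"
    by (simp add: endo_det_def matched_det_def J)
  ultimately show ?thesis by simp
qed

text \<open>Multiplication of one coordinate by \<open>c\<close>.\<close>

definition stretch :: "'a::euclidean_space \<Rightarrow> real \<Rightarrow> 'a \<Rightarrow> 'a" where
  "stretch e c v = v + ((c - 1) * (v \<bullet> e)) *\<^sub>R e"

lemma endo_det_stretch:
  fixes e :: "'a::euclidean_space"
  assumes "e \<in> Basis"
  shows "endo_det (stretch e c) = c"
proof -
  obtain m where m: "e = Rep_basis_index m"
    using basis_index_props(3) assms by (auto simp: bij_betw_def)
  let ?A = "(\<chi> (i :: 'a basis_index) (j :: 'a basis_index). stretch e c (Rep_basis_index j) \<bullet> Rep_basis_index i)"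
  have entry: "?A $ i $ j = (if i = j then (if i = m then c else 1) else 0)" for i j
    by (auto simp: stretch_def m inner_add_left inner_Basis basis_index_props)
  have "det ?A = prod (\<lambda>i. ?A $ i $ i) UNIV"
    by (rule det_diagonal) (simp only: entry, simp)
  also have "\<dots> = prod (\<lambda>i. if i = m then c else 1) UNIV" by (simp only: entry) simp
  also have "\<dots> = c" by simp
  finally show ?thesis by (simp add: endo_det_def)
qed

lemma differentiable_prod:
  fixes f :: "'i \<Rightarrow> 'a::real_normed_vector \<Rightarrow> real"
  assumes "finite I" "\<And>i. i \<in> I \<Longrightarrow> f i differentiable (at x)"
  shows "(\<lambda>x. \<Prod>i\<in>I. f i x) differentiable (at x)"
  using assms by (induction I rule: finite_induct) (auto intro: differentiable_mult)

lemma differentiable_det: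
  fixes A :: "'a::real_normed_vector \<Rightarrow> real ^ 'n ^ 'n"
  assumes "\<And>i j. (\<lambda>x. A x $ i $ j) differentiable (at x)"
  shows "(\<lambda>x. det (A x)) differentiable (at x)"
  unfolding det_def
  by (auto intro!: differentiable_sum differentiable_mult differentiable_prod assms simp: finite_permutations)

text \<open>If the differential factors through the stretching of one coordinate by \<open>\<mu>\<close>, with invertible
  outer factors, then the Jacobian determinant is a nonvanishing multiple of \<open>\<mu>\<close>.  This
  determines the singular set, and the differential of the determinant along it, without computing
  the determinant.\<close>

lemma jacobian_det_factored:
  fixes f :: "'a::euclidean_space \<Rightarrow> 'b::euclidean_space" and L :: "'a \<Rightarrow> 'a \<Rightarrow> 'b" and R :: "'a \<Rightarrow> 'a \<Rightarrow> 'a"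
  assumes dim: "DIM('a) = DIM('b)" and e: "e \<in> Basis" and N: "open N"
    and f: "\<And>p v. p \<in> N \<Longrightarrow> frechet_derivative f (at p) v = L p (stretch e (\<mu> p) (R p v))"
    and L: "\<And>p. p \<in> N \<Longrightarrow> linear (L p)" "\<And>p. p \<in> N \<Longrightarrow> inj (L p)"
      "\<And>p v. p \<in> N \<Longrightarrow> (\<lambda>p. L p v) differentiable (at p)"
    and R: "\<And>p. p \<in> N \<Longrightarrow> linear (R p)" "\<And>p. p \<in> N \<Longrightarrow> inj (R p)"
      "\<And>p v. p \<in> N \<Longrightarrow> (\<lambda>p. R p v) differentiable (at p)"
    and p: "p \<in> N"
  shows "jacobian_det f p = 0 \<longleftrightarrow> \<mu> p = 0"
    and "\<mu> p = 0 \<Longrightarrow> (\<mu> has_derivative \<mu>') (at p) \<Longrightarrow>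
      \<exists>c. c \<noteq> 0 \<and> frechet_derivative (jacobian_det f) (at p) = (\<lambda>w. c * \<mu>' w)"
proof -
  define c where "c = (\<lambda>p. matched_det (L p) * endo_det (R p))"
  have j: "jacobian_det f p = c p * \<mu> p" if "p \<in> N" for p
  proof -
    have lS: "linear (stretch e (\<mu> p))"
      unfolding stretch_def by (intro linearI) (simp_all add: inner_add_left algebra_simps)
    have "frechet_derivative f (at p) = (\<lambda>v. L p (stretch e (\<mu> p) (R p v)))"
      using f[OF that] by (simp add: fun_eq_iff)
    then have "jacobian_det f p = matched_det (\<lambda>v. L p (stretch e (\<mu> p) (R p v)))"
      by (simp add: jacobian_det_eq)
    also have "\<dots> = matched_det (L p) * endo_det (\<lambda>v. stretch e (\<mu> p) (R p v))"
      by (rule matched_det_compose[OF L(1)[OF that]])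
    also have "\<dots> = matched_det (L p) * (\<mu> p * endo_det (R p))"
      using endo_det_compose[OF lS, of "R p"] by (simp only: endo_det_stretch[OF e])
    finally show ?thesis by (simp add: c_def)
  qed
  have c0: "c p \<noteq> 0" if "p \<in> N" for p
    using matched_det_nonzero[OF dim L(1,2)[OF that]] endo_det_nonzero[OF R(1,2)[OF that]]
    by (simp add: c_def)
  show "jacobian_det f p = 0 \<longleftrightarrow> \<mu> p = 0" using j[OF p] c0[OF p] by simp
  assume \<mu>: "\<mu> p = 0" "(\<mu> has_derivative \<mu>') (at p)"
  have inner: "(\<lambda>p. h p \<bullet> w) differentiable (at p)" if "h differentiable (at p)"
    for h :: "'a \<Rightarrow> 'c::real_inner" and w
    using that by (intro differentiable_inner differentiable_const)
  have "c differentiable (at p)"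
    unfolding c_def matched_det_def endo_det_def
    by (intro differentiable_mult differentiable_det) (simp_all add: inner L(3)[OF p] R(3)[OF p])
  then have "((\<lambda>p. c p * \<mu> p) has_derivative (\<lambda>w. c p * \<mu>' w + frechet_derivative c (at p) w * \<mu> p)) (at p)"
    by (intro has_derivative_mult \<mu>(2)) (simp add: frechet_derivative_works)
  then have d: "((\<lambda>p. c p * \<mu> p) has_derivative (\<lambda>w. c p * \<mu>' w)) (at p)" by (simp add: \<mu>(1))
  have "frechet_derivative (jacobian_det f) (at p) = frechet_derivative (\<lambda>p. c p * \<mu> p) (at p)"
    by (rule frechet_derivative_cong_open[OF N p j])
  also have "\<dots> = (\<lambda>w. c p * \<mu>' w)" by (rule frechet_derivative_at[OF d, symmetric])
  finally show "\<exists>c. c \<noteq> 0 \<and> frechet_derivative (jacobian_det f) (at p) = (\<lambda>w. c * \<mu>' w)"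
    using c0[OF p] by blast
qed

text \<open>A kernel vector along which the determinant changes splits off from the tangent space.\<close>

lemma fold_pointI:
  assumes "p \<in> S1 f" "v \<in> ker_deriv f p" "f differentiable (at p)"
    and jac: "frechet_derivative (jacobian_det f) (at p) = (\<lambda>w. c * \<mu> w)" "linear \<mu>" "c \<noteq> 0" "\<mu> v \<noteq> 0"
  shows "fold_point f p"
  unfolding fold_point_def
proof (intro conjI assms(1) set_eqI iffI UNIV_I)
  fix x
  have lf: "linear (frechet_derivative f (at p))" using linear_frechet_derivative[OF assms(3)] .
  let ?s = "\<mu> x / \<mu> v"
  have "?s *\<^sub>R v \<in> ker_deriv f p"
    using assms(2) by (simp add: ker_deriv_def linear_cmul[OF lf])
  moreover have "x - ?s *\<^sub>R v \<in> tangent_S1 f p"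
    using jac by (simp add: tangent_S1_def linear_diff linear_cmul)
  ultimately show "x \<in> {v + w | v w. v \<in> ker_deriv f p \<and> w \<in> tangent_S1 f p}"
    by (intro CollectI exI[of _ "?s *\<^sub>R v"] exI[of _ "x - ?s *\<^sub>R v"]) simp
qed

section \<open>The two projections\<close>

type_synonym 'm param = "(real, 'm) vec \<times> 'm space \<times> real"

text \<open>The equation of the tangent plane of the cylinder at \<open>(y, q y)\<close>, whose unit normal is
  \<open>(tail y, q y)\<close>.  Both differentials degenerate exactly where \<open>x\<close> lies on this plane.\<close>

definition tangency :: "'m::{finite,linorder} param \<Rightarrow> real" where
  "tangency p = cyl_height (fst p) * snd (fst (snd p)) + tail (fst p) \<bullet> fst (fst (snd p)) - 1"

definition tangency' :: "'m::{finite,linorder} param \<Rightarrow> 'm param \<Rightarrow> real" where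
  "tangency' p h = (grad cyl_height (fst p) \<bullet> fst h) * snd (fst (snd p)) + cyl_height (fst p) * snd (fst (snd h))
     + tail (fst h) \<bullet> fst (fst (snd p)) + tail (fst p) \<bullet> fst (fst (snd h))"

definition chart :: "'m::{finite,linorder} param set" where
  "chart = Omega \<times> UNIV \<times> (- {0})"

lemma open_chart: "open chart"
  unfolding chart_def by (intro open_Times open_Omega open_UNIV) (simp add: open_Compl)

lemma chart_iff: "(y, x, \<omega>) \<in> chart \<longleftrightarrow> y \<in> Omega \<and> \<omega> \<noteq> 0"
  by (simp add: chart_def)

lemma param_domain_subset_chart: "param_domain k \<subseteq> chart"
  by (auto simp: param_domain_def chart_def)

lemma tangency_has_derivative:
  assumes "p \<in> chart"
  shows "(tangency has_derivative tangency' p) (at p)"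
proof -
  obtain y x \<omega> where p: "p = (y, x, \<omega>)" by (cases p)
  have y: "y \<in> Omega" using assms by (simp add: p chart_iff)
  have "(cyl_height has_derivative (\<lambda>h. grad cyl_height y \<bullet> h)) (at (fst p))"
    using cyl_height_has_derivative[OF y] grad_cyl_height[OF y] by (simp add: p)
  from has_derivative_compose[OF has_derivative_fst[OF has_derivative_ident] this]
  have q: "((\<lambda>p. cyl_height (fst p)) has_derivative (\<lambda>h. grad cyl_height (fst p) \<bullet> fst h)) (at p)"
    by (simp add: p)
  have t: "((\<lambda>p. tail (fst p)) has_derivative (\<lambda>h. tail (fst h))) (at p)"
    by (rule bounded_linear.has_derivative[OF bounded_linear_tail has_derivative_fst[OF has_derivative_ident]])
  show ?thesis
    unfolding tangency_def tangency'_def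
    by (auto intro!: derivative_eq_intros q t simp: algebra_simps)
qed

lemma linear_tangency': "p \<in> chart \<Longrightarrow> linear (tangency' p)"
  using has_derivative_linear[OF tangency_has_derivative] .

lemma frechet_derivative_tangency: "p \<in> chart \<Longrightarrow> frechet_derivative tangency (at p) = tangency' p"
  by (rule frechet_derivative_at[OF tangency_has_derivative, symmetric])

lemma xT_defect:
  assumes "y \<in> Omega"
  shows "snd (xT y x) - grad cyl_height y \<bullet> fst (xT y x) = (1 / cyl_height y) * tangency (y, x, \<omega>)"
proof -
  let ?q = "cyl_height y"
  have q: "?q > 0" "?q * ?q = 1 - tail y \<bullet> y"
    using cyl_height_pos[OF assms] cyl_height_square[OF assms] tail_inner_tail[of y y] by simp_all
  have "?q * (snd (xT y x) - grad cyl_height y \<bullet> fst (xT y x))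
      = ?q * snd x - ?q * ?q + (tail y \<bullet> fst x - tail y \<bullet> y)"
    using q(1) by (simp add: xT_def grad_cyl_height[OF assms] inner_diff_right algebra_simps)
  also have "\<dots> = tangency (y, x, \<omega>)" unfolding q(2) by (simp add: tangency_def)
  finally show ?thesis using q(1) by (simp add: field_simps)
qed

text \<open>The decomposition of \<open>xT y x\<close> into a tangent vector of the cylinder and a vertical vector.\<close>

lemma xT_eq_lift:
  assumes "y \<in> Omega"
  shows "xT y x = lift y (fst (xT y x)) + (0, (1 / cyl_height y) * tangency (y, x, \<omega>))"
  unfolding xT_defect[OF assms, symmetric] by (simp add: lift_def prod_eq_iff)

lemma linear_lift: "linear (lift y)"
  by (intro linearI) (simp_all add: lift_def inner_add_right)

lemma DIM_param: "DIM('m::{finite,linorder} param) = DIM('m::{finite,linorder} space \<times> 'm space)"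
  by simp

lemma smooth_on_grad_cyl_height: "smooth_on Omega (grad cyl_height)"
proof -
  have "smooth_on Omega (\<lambda>y. - inverse (cyl_height y) *\<^sub>R tail y)"
    by (intro smooth_on_scaleR smooth_on_minus smooth_on_inverse smooth_on_cyl_height
        smooth_on_linear bounded_linear_tail open_Omega) (metis cyl_height_pos less_irrefl)
  then show ?thesis by (rule smooth_on_cong) (simp add: grad_cyl_height inverse_eq_divide)
qed

lemma smooth_on_chart_coordinates:
  "smooth_on chart (\<lambda>p. fst p)" "smooth_on chart (\<lambda>p. fst (snd p))" "smooth_on chart (\<lambda>p. snd (snd p))"
  by (intro smooth_on_fst smooth_on_snd smooth_on_ident open_chart)+

lemma chart_fst: "p \<in> chart \<Longrightarrow> fst p \<in> Omega"
  by (auto simp: chart_def)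

lemma smooth_on_chart_xT: "smooth_on chart (\<lambda>p. xT (fst p) (fst (snd p)))"
  by (intro smooth_on_xT smooth_on_chart_coordinates chart_fst)

lemma smooth_on_chart_grad: "smooth_on chart (\<lambda>p. grad cyl_height (fst p))"
  by (rule smooth_on_compose[OF smooth_on_grad_cyl_height smooth_on_chart_coordinates(1) chart_fst])

lemma smooth_on_chart_cyl_height: "smooth_on chart (\<lambda>p. cyl_height (fst p))"
  by (rule smooth_on_compose[OF smooth_on_cyl_height smooth_on_chart_coordinates(1) chart_fst])

lemma smooth_on_chart_inverse_cyl_height: "smooth_on chart (\<lambda>p. inverse (cyl_height (fst p)))"
  by (intro smooth_on_inverse smooth_on_chart_cyl_height) (metis chart_fst cyl_height_pos less_irrefl)

lemma smooth_on_chart_diag_A: "smooth_on chart (\<lambda>p. diag_A k (xT (fst p) (fst (snd p))))"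
  by (rule smooth_on_linear_compose[OF smooth_on_chart_xT bounded_linear_diag_A])

lemma smooth_on_tangency: "smooth_on chart tangency"
  unfolding tangency_def
  by (intro smooth_on_diff smooth_on_add smooth_on_mult smooth_on_inner smooth_on_chart_cyl_height
      smooth_on_linear_compose[OF _ bounded_linear_tail] smooth_on_fst smooth_on_snd smooth_on_chart_coordinates
      smooth_on_const open_chart)

lemma smooth_on_pi_R: "smooth_on chart (pi_R k)"
proof -
  have "smooth_on chart (\<lambda>p. (fst (snd p), (2 * snd (snd p)) *\<^sub>R diag_A k (xT (fst p) (fst (snd p)))))"
    by (intro smooth_on_Pair smooth_on_chart_coordinates smooth_on_scaleR smooth_on_mult smooth_on_const
        smooth_on_chart_diag_A open_chart)
  then show ?thesis by (simp add: pi_R_def case_prod_beta')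
qed

lemma smooth_on_pi_L: "smooth_on chart (pi_L k)"
proof -
  have "smooth_on chart (\<lambda>p. ((fst p, quad k (fst p, fst (snd p))),
      ((2 * snd (snd p)) *\<^sub>R (fst (diag_A k (xT (fst p) (fst (snd p))))
        + snd (diag_A k (xT (fst p) (fst (snd p)))) *\<^sub>R grad cyl_height (fst p)), snd (snd p))))"
    by (intro smooth_on_Pair smooth_on_chart_coordinates smooth_on_scaleR smooth_on_mult smooth_on_const
        smooth_on_add smooth_on_fst[OF smooth_on_chart_diag_A] smooth_on_snd[OF smooth_on_chart_diag_A]
        smooth_on_chart_grad smooth_on_quad chart_fst open_chart)
  then show ?thesis by (simp add: pi_L_def matrix_B_def quad_def case_prod_beta')
qed

lemma xT_chart_has_derivative:
  assumes "p \<in> chart"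
  shows "((\<lambda>p. xT (fst p) (fst (snd p))) has_derivative (\<lambda>h. fst (snd h) - lift (fst p) (fst h))) (at p)"
proof -
  have y: "fst p \<in> Omega" using assms by (rule chart_fst)
  have "((\<lambda>p. (fst p, fst (snd p))) has_derivative (\<lambda>h. (fst h, fst (snd h)))) (at p)"
    by (auto intro!: derivative_eq_intros)
  from has_derivative_compose[OF this xT_has_derivative[OF y]] show ?thesis by simp
qed

lemma diag_A_chart_has_derivative:
  assumes "p \<in> chart"
  shows "((\<lambda>p. diag_A k (xT (fst p) (fst (snd p)))) has_derivative
    (\<lambda>h. diag_A k (fst (snd h) - lift (fst p) (fst h)))) (at p)"
  by (rule bounded_linear.has_derivative[OF bounded_linear_diag_A xT_chart_has_derivative[OF assms]])

subsection \<open>The right projection\<close>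

lemma pi_R_derivative:
  assumes "(y, x, \<omega>) \<in> chart"
  shows "frechet_derivative (pi_R k) (at (y, x, \<omega>)) = (\<lambda>h. (fst (snd h),
    (2 * \<omega>) *\<^sub>R diag_A k (fst (snd h) - lift y (fst h)) + (2 * snd (snd h)) *\<^sub>R diag_A k (xT y x)))"
proof -
  have e: "pi_R k = (\<lambda>p. (fst (snd p), (2 * snd (snd p)) *\<^sub>R diag_A k (xT (fst p) (fst (snd p)))))"
    by (simp add: pi_R_def case_prod_beta')
  have "(pi_R k has_derivative (\<lambda>h. (fst (snd h),
    (2 * \<omega>) *\<^sub>R diag_A k (fst (snd h) - lift y (fst h)) + (2 * snd (snd h)) *\<^sub>R diag_A k (xT y x)))) (at (y, x, \<omega>))"
    unfolding e
    by (rule has_derivative_eq_rhs)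
      (auto intro!: derivative_eq_intros diag_A_chart_has_derivative[OF assms] simp: fun_eq_iff)
  from frechet_derivative_at[OF this] show ?thesis by simp
qed

text \<open>The differential of \<open>pi_R\<close> maps \<open>\<delta>\<omega>\<close> to a multiple of \<open>A xT\<close> and \<open>\<delta>y\<close> to multiples of \<open>A lift\<close>.  Shearing
  \<open>\<delta>y\<close> by a multiple of \<open>\<delta>\<omega>\<close> removes the tangential part of \<open>xT\<close>; what remains of it is vertical
  and proportional to \<open>tangency\<close>.\<close>

definition outer_R :: "nat \<Rightarrow> 'm::{finite,linorder} param \<Rightarrow> 'm param \<Rightarrow> 'm space \<times> 'm space" where
  "outer_R k p h = (fst (snd h), (2 * snd (snd p)) *\<^sub>R diag_A k (fst (snd h) - lift (fst p) (fst h))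
     + (2 * inverse (cyl_height (fst p)) * snd (snd h)) *\<^sub>R diag_A k (0, 1))"

definition inner_R :: "'m::{finite,linorder} param \<Rightarrow> 'm param \<Rightarrow> 'm param" where
  "inner_R p h = (fst h - (inverse (snd (snd p)) * snd (snd h)) *\<^sub>R fst (xT (fst p) (fst (snd p))), snd h)"

lemma stretch_omega: "stretch (0, 0, 1) c (a, b, s) = (a, b, c * s)"
  by (simp add: stretch_def inner_prod_def algebra_simps)

lemma pi_R_factored:
  fixes p :: "'m::{finite,linorder} param"
  assumes "p \<in> chart"
  shows "frechet_derivative (pi_R k) (at p) h = outer_R k p (stretch (0, 0, 1) (tangency p) (inner_R p h))"
proof -
  obtain y x \<omega> where p: "p = (y, x, \<omega>)" by (cases p)
  obtain a b s where h: "h = (a, b, s)" by (cases h)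
  have y: "y \<in> Omega" and \<omega>: "\<omega> \<noteq> 0" using assms by (auto simp: p chart_iff)
  let ?z = "xT y x"
  let ?c = "(1 / cyl_height y) * tangency (y, x, \<omega>)"
  have A: "diag_A k (v + w) = diag_A k v + diag_A k w" "diag_A k (r *\<^sub>R v) = r *\<^sub>R diag_A k v"
    "diag_A k (v - w) = diag_A k v - diag_A k w" for v w :: "'m space" and r
    by (rule linear_add[OF linear_diag_A] linear_cmul[OF linear_diag_A] linear_diff[OF linear_diag_A])+
  have "(s :: real) *\<^sub>R ?z = s *\<^sub>R lift y (fst ?z) + (s * ?c) *\<^sub>R (0, 1)"
    by (subst xT_eq_lift[OF y, of x \<omega>]) (simp add: scaleR_add_right)
  then have z: "s *\<^sub>R diag_A k ?z = s *\<^sub>R diag_A k (lift y (fst ?z)) + (s * ?c) *\<^sub>R diag_A k (0, 1)"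
    by (metis A(1,2))
  have l: "lift y (a - (inverse \<omega> * s) *\<^sub>R fst ?z) = lift y a - (inverse \<omega> * s) *\<^sub>R lift y (fst ?z)"
    by (simp only: linear_diff[OF linear_lift] linear_cmul[OF linear_lift])
  have "(2 * \<omega>) *\<^sub>R diag_A k (b - lift y a) + (2 * s) *\<^sub>R diag_A k ?z
      = (2 * \<omega>) *\<^sub>R diag_A k (b - lift y (a - (inverse \<omega> * s) *\<^sub>R fst ?z))
        + (2 * inverse (cyl_height y) * (tangency p * s)) *\<^sub>R diag_A k (0, 1)"
    unfolding l A using \<omega> arg_cong[OF z, of "\<lambda>v. 2 *\<^sub>R v"]
    by (simp add: p scaleR_add_right scaleR_diff_right inverse_eq_divide mult.commute mult.left_commute)
  then show ?thesis
    unfolding p pi_R_derivative[OF assms[unfolded p]]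
    by (simp add: outer_R_def inner_R_def h p stretch_omega)
qed

lemma outer_R_facts:
  fixes p :: "'m::{finite,linorder} param"
  assumes "p \<in> chart"
  shows "linear (outer_R k p)" "inj (outer_R k p)" "(\<lambda>p. outer_R k p h) differentiable (at p)"
proof -
  obtain y x \<omega> where p: "p = (y, x, \<omega>)" by (cases p)
  have y: "y \<in> Omega" and \<omega>: "\<omega> \<noteq> 0" using assms by (auto simp: p chart_iff)
  have A: "diag_A k (v + w) = diag_A k v + diag_A k w" "diag_A k (r *\<^sub>R v) = r *\<^sub>R diag_A k v"
    "diag_A k (v - w) = diag_A k v - diag_A k w" for v w :: "'m space" and r
    by (rule linear_add[OF linear_diag_A] linear_cmul[OF linear_diag_A] linear_diff[OF linear_diag_A])+
  show l: "linear (outer_R k p)"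
    by (intro linearI) (simp_all add: outer_R_def A linear_add[OF linear_lift] linear_cmul[OF linear_lift] algebra_simps)
  have "h = 0" if "outer_R k p h = 0" for h
  proof -
    obtain a b s where h: "h = (a, b, s)" by (cases h)
    have b: "b = 0" using that by (simp add: outer_R_def h prod_eq_iff)
    let ?r = "2 * inverse (cyl_height y) * s"
    have "diag_A k (- (2 * \<omega>) *\<^sub>R lift y a + ?r *\<^sub>R (0, 1)) = 0"
      using that unfolding A by (simp add: outer_R_def h p b A prod_eq_iff linear_0[OF linear_diag_A] linear_neg[OF linear_diag_A])
    then have "- (2 * \<omega>) *\<^sub>R lift y a + ?r *\<^sub>R (0, 1) = 0" by simp
    then have "a = 0 \<and> s = 0"
      using \<omega> cyl_height_pos[OF y] by (auto simp: lift_def prod_eq_iff)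
    then show ?thesis using b h by (simp add: zero_prod_def)
  qed
  then show "inj (outer_R k p)" using linear_injective_0[OF l] by blast
  have "smooth_on chart (\<lambda>p. outer_R k p h)"
    unfolding outer_R_def lift_def
    by (intro smooth_on_Pair smooth_on_const open_chart smooth_on_add smooth_on_scaleR smooth_on_mult
        smooth_on_chart_coordinates smooth_on_linear_compose[OF _ bounded_linear_diag_A] smooth_on_diff
        smooth_on_inner smooth_on_chart_grad smooth_on_chart_inverse_cyl_height)
  then show "(\<lambda>p. outer_R k p h) differentiable (at p)" using smooth_on_differentiable assms by blast
qed

lemma inner_R_facts:
  fixes p :: "'m::{finite,linorder} param"
  assumes "p \<in> chart"
  shows "linear (inner_R p)" "inj (inner_R p)" "(\<lambda>p. inner_R p h) differentiable (at p)"
proof -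
  show l: "linear (inner_R p)"
    by (intro linearI) (simp_all add: inner_R_def algebra_simps)
  have "h = 0" if "inner_R p h = 0" for h
  proof -
    have s: "snd h = 0" using that by (simp add: inner_R_def zero_prod_def)
    then have "fst h = 0" using that by (simp add: inner_R_def zero_prod_def)
    with s show ?thesis by (simp add: prod_eq_iff)
  qed
  then show "inj (inner_R p)" using linear_injective_0[OF l] by blast
  have "smooth_on chart (\<lambda>p. inner_R p h)"
    unfolding inner_R_def
    by (intro smooth_on_Pair smooth_on_const open_chart smooth_on_diff smooth_on_scaleR smooth_on_mult
        smooth_on_inverse smooth_on_chart_coordinates smooth_on_fst[OF smooth_on_chart_xT])
      (auto simp: chart_def)
  then show "(\<lambda>p. inner_R p h) differentiable (at p)" using smooth_on_differentiable assms by blast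
qed

lemma basis_omega: "(0, 0, 1) \<in> (Basis :: 'm::{finite,linorder} param set)"
  by (auto simp: Basis_prod_def zero_prod_def)

lemma jacobian_pi_R:
  fixes p :: "'m::{finite,linorder} param"
  assumes "p \<in> chart"
  shows "jacobian_det (pi_R k) p = 0 \<longleftrightarrow> tangency p = 0"
    and "tangency p = 0 \<Longrightarrow> \<exists>c. c \<noteq> 0 \<and> frechet_derivative (jacobian_det (pi_R k)) (at p) = (\<lambda>w. c * tangency' p w)"
  using jacobian_det_factored[OF DIM_param basis_omega open_chart pi_R_factored outer_R_facts inner_R_facts assms]
    tangency_has_derivative[OF assms] by blast+

text \<open>The differential of \<open>tangency\<close> does not vanish: \<open>x\<close> can be moved off the tangent plane vertically.\<close>

lemma tangency'_last: "tangency' p (0, (0, 1), 0) = cyl_height (fst p)"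
  by (simp add: tangency'_def linear_0[OF linear_tail])

lemma not_zero_multiple_tangency':
  assumes "p \<in> chart" "c \<noteq> 0"
  shows "(\<lambda>w. c * tangency' p w) \<noteq> (\<lambda>_. 0)"
proof
  assume "(\<lambda>w. c * tangency' p w) = (\<lambda>_. 0)"
  from fun_cong[OF this, of "(0, (0, 1), 0)"] show False
    using assms cyl_height_pos[OF chart_fst[OF assms(1)]] by (simp add: tangency'_last)
qed

text \<open>The kernel is spanned by \<open>(z', 0, \<omega>)\<close> for \<open>z = xT y x\<close>, and the derivative of \<open>tangency\<close> along it is the sum
  of the squares of all coordinates of \<open>z\<close> but the first.  It can only vanish if \<open>z\<close> is parallel to the
  axis of the cylinder, which would put \<open>x\<close> on the half cylinder.\<close>

theorem fold_singularity_pi_R: "fold_singularity (param_domain k :: 'm::{finite,linorder} param set) (pi_R k)"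
  unfolding fold_singularity_def
proof (intro conjI exI[of _ chart] ballI impI param_domain_subset_chart smooth_on_pi_R)
  fix p :: "'m param"
  assume p: "p \<in> param_domain k" and 0: "jacobian_det (pi_R k) p = 0"
  obtain y x \<omega> where pe: "p = (y, x, \<omega>)" by (cases p)
  have chart: "p \<in> chart" using p param_domain_subset_chart by blast
  have y: "y \<in> Omega" and \<omega>: "\<omega> \<noteq> 0" and x: "x \<notin> half_cylinder"
    using p by (auto simp: pe param_domain_def)
  have t: "tangency p = 0" using 0 jacobian_pi_R(1)[OF chart] by blast
  obtain c where c: "c \<noteq> 0" and jac: "frechet_derivative (jacobian_det (pi_R k)) (at p) = (\<lambda>w. c * tangency' p w)"
    using jacobian_pi_R(2)[OF chart t] by blast
  let ?z = "xT y x" and ?q = "cyl_height y"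
  let ?v = "(fst ?z, 0, \<omega>) :: 'm param"
  have z: "?z = lift y (fst ?z)"
    using xT_eq_lift[OF y, of x \<omega>] t by (simp add: pe flip: zero_prod_def)
  have q: "?q > 0" by (rule cyl_height_pos[OF y])
  have zn: "snd ?z = - (1 / ?q) * (tail y \<bullet> fst ?z)"
    using arg_cong[OF z, of snd] by (simp add: lift_def grad_cyl_height[OF y])
  show "fold_point (pi_R k) p"
  proof (rule fold_pointI[OF _ _ _ jac linear_tangency'[OF chart] c])
    show "p \<in> S1 (pi_R k)"
      using 0 not_zero_multiple_tangency'[OF chart c] by (simp add: S1_def jac)
    have "(2 * \<omega>) *\<^sub>R diag_A k (0 - lift y (fst ?z)) + (2 * \<omega>) *\<^sub>R diag_A k ?z = 0"
      using z linear_neg[OF linear_diag_A, of k ?z] by simp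
    then show "?v \<in> ker_deriv (pi_R k) p"
      unfolding ker_deriv_def pe pi_R_derivative[OF chart[unfolded pe]] by (simp add: zero_prod_def)
    show "pi_R k differentiable (at p)"
      using smooth_on_differentiable[OF smooth_on_pi_R chart] .
    have "tangency' p ?v = (snd ?z)\<^sup>2 + tail (fst ?z) \<bullet> tail (fst ?z)"
    proof -
      have xn: "snd x = snd ?z + ?q" and xf: "fst x = fst ?z + y" by (simp_all add: xT_def)
      have "tangency' p ?v = snd ?z * snd x + tail (fst ?z) \<bullet> fst x"
        by (simp add: tangency'_def pe grad_cyl_height[OF y] zn)
      also have "\<dots> = (snd ?z)\<^sup>2 + snd ?z * ?q + (tail (fst ?z) \<bullet> tail (fst ?z) + tail y \<bullet> fst ?z)"
        unfolding xn xf using tail_inner_tail[of "fst ?z" "fst ?z"] tail_inner[of "fst ?z" y]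
        by (simp add: power2_eq_square algebra_simps inner_add_right inner_commute[of "fst ?z"])
      also have "snd ?z * ?q = - (tail y \<bullet> fst ?z)" using q by (subst zn) simp
      finally show ?thesis by simp
    qed
    moreover have "(snd ?z)\<^sup>2 + tail (fst ?z) \<bullet> tail (fst ?z) \<noteq> 0"
    proof
      assume "(snd ?z)\<^sup>2 + tail (fst ?z) \<bullet> tail (fst ?z) = 0"
      then have s: "snd ?z = 0" "tail (fst ?z) = 0"
        by (simp_all add: add_nonneg_eq_0_iff)
      have "tail (fst x) = tail y"
        using s(2) by (simp add: xT_def linear_diff[OF linear_tail])
      then have "fst x \<in> Omega" "cyl_height (fst x) = ?q"
        using y by (simp_all add: Omega_eq cyl_height_eq)
      moreover have "snd x = ?q" using s(1) by (simp add: xT_def)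
      ultimately have "x \<in> half_cylinder"
        unfolding half_cylinder_def by (intro image_eqI[of _ _ "fst x"]) (simp_all add: prod_eq_iff)
      then show False using x by blast
    qed
    ultimately show "tangency' p ?v \<noteq> 0" by simp
  qed
qed (rule DIM_param)

subsection \<open>The left projection\<close>

definition hessian :: "(real, 'm::{finite,linorder}) vec \<Rightarrow> (real, 'm) vec \<Rightarrow> (real, 'm) vec" where
  "hessian y = frechet_derivative (grad cyl_height) (at y)"

lemma hessian_has_derivative:
  "p \<in> chart \<Longrightarrow> ((\<lambda>p. grad cyl_height (fst p)) has_derivative (\<lambda>h. hessian (fst p) (fst h))) (at p)"
  unfolding hessian_def
  by (rule has_derivative_compose[OF has_derivative_fst[OF has_derivative_ident]
        smooth_on_has_derivative[OF smooth_on_grad_cyl_height chart_fst]])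

lemma linear_hessian: "y \<in> Omega \<Longrightarrow> linear (hessian y)"
  unfolding hessian_def
  by (rule has_derivative_linear[OF smooth_on_has_derivative[OF smooth_on_grad_cyl_height]])

lemma linear_matrix_B: "linear (matrix_B y)"
  by (intro linearI) (simp_all add: matrix_B_def algebra_simps)

definition left_variation :: "nat \<Rightarrow> (real, 'm::{finite,linorder}) vec \<Rightarrow> 'm param \<Rightarrow> 'm space" where
  "left_variation k y h = diag_A k (fst (snd h) - lift y (fst h))"

lemma linear_left_variation: "linear (left_variation k y)"
  unfolding left_variation_def
  by (intro linearI) (simp_all add: linear_add[OF linear_lift] linear_cmul[OF linear_lift]
      linear_add[OF linear_diag_A] linear_cmul[OF linear_diag_A] linear_diff[OF linear_diag_A] algebra_simps)

lemma pi_L_derivative: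
  assumes "(y, x, \<omega>) \<in> chart"
  shows "frechet_derivative (pi_L k) (at (y, x, \<omega>)) = (\<lambda>h.
    ((fst h, 2 * (xT y x \<bullet> left_variation k y h)),
     ((2 * snd (snd h)) *\<^sub>R matrix_B y (diag_A k (xT y x))
      + (2 * \<omega>) *\<^sub>R (matrix_B y (left_variation k y h) + snd (diag_A k (xT y x)) *\<^sub>R hessian y (fst h)), snd (snd h))))"
    (is "_ = ?D")
proof -
  let ?A = "\<lambda>p. diag_A k (xT (fst p) (fst (snd p)))"
  have e: "pi_L k = (\<lambda>p. ((fst p, xT (fst p) (fst (snd p)) \<bullet> ?A p),
      ((2 * snd (snd p)) *\<^sub>R (fst (?A p) + snd (?A p) *\<^sub>R grad cyl_height (fst p)), snd (snd p))))"
    by (simp add: pi_L_def matrix_B_def case_prod_beta')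
  note dA = diag_A_chart_has_derivative[OF assms, of k]
  have q: "((\<lambda>p. xT (fst p) (fst (snd p)) \<bullet> ?A p) has_derivative (\<lambda>h. 2 * (xT y x \<bullet> left_variation k y h))) (at (y, x, \<omega>))"
    using quad_derivative_aux[OF xT_chart_has_derivative[OF assms], of k]
    by (simp add: left_variation_def diag_A_inner)
  have b: "((\<lambda>p. (2 * snd (snd p)) *\<^sub>R (fst (?A p) + snd (?A p) *\<^sub>R grad cyl_height (fst p))) has_derivative
      (\<lambda>h. (2 * snd (snd h)) *\<^sub>R matrix_B y (diag_A k (xT y x))
      + (2 * \<omega>) *\<^sub>R (matrix_B y (left_variation k y h) + snd (diag_A k (xT y x)) *\<^sub>R hessian y (fst h)))) (at (y, x, \<omega>))"
  proof (rule has_derivative_eq_rhs)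
    show "((\<lambda>p. (2 * snd (snd p)) *\<^sub>R (fst (?A p) + snd (?A p) *\<^sub>R grad cyl_height (fst p))) has_derivative
      (\<lambda>h. (2 * snd (snd (y, x, \<omega>))) *\<^sub>R (fst (left_variation k y h)
          + (snd (?A (y, x, \<omega>)) *\<^sub>R hessian y (fst h) + snd (left_variation k y h) *\<^sub>R grad cyl_height (fst (y, x, \<omega>))))
        + (2 * snd (snd h)) *\<^sub>R (fst (?A (y, x, \<omega>)) + snd (?A (y, x, \<omega>)) *\<^sub>R grad cyl_height (fst (y, x, \<omega>))))) (at (y, x, \<omega>))"
    proof (intro has_derivative_scaleR has_derivative_add)
      show "((\<lambda>p. 2 * snd (snd p)) has_derivative (\<lambda>h. 2 * snd (snd h))) (at (y, x, \<omega>))"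
        by (auto intro!: derivative_eq_intros)
      show "((\<lambda>p. fst (?A p)) has_derivative (\<lambda>h. fst (left_variation k y h))) (at (y, x, \<omega>))"
        using has_derivative_fst[OF dA] by (simp add: left_variation_def)
      show "((\<lambda>p. snd (?A p)) has_derivative (\<lambda>h. snd (left_variation k y h))) (at (y, x, \<omega>))"
        using has_derivative_snd[OF dA] by (simp add: left_variation_def)
      show "((\<lambda>p. grad cyl_height (fst p)) has_derivative (\<lambda>h. hessian y (fst h))) (at (y, x, \<omega>))"
        using hessian_has_derivative[OF assms] by simp
    qed
  qed (simp add: matrix_B_def fun_eq_iff algebra_simps)
  have "(pi_L k has_derivative ?D) (at (y, x, \<omega>))"
    unfolding e by (intro has_derivative_Pair q b) (auto intro!: derivative_eq_intros)
  from frechet_derivative_at[OF this] show ?thesis by simp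
qed

text \<open>With \<open>\<delta>z\<close> the variation of \<open>xT\<close>, the vector \<open>B A \<delta>z\<close> and the last coordinate of \<open>A \<delta>z\<close> are coordinates in which
  the differential of \<open>pi_L\<close> involves the last one only through the variation of \<open>xT \<bullet> A xT\<close>, with a
  coefficient proportional to \<open>tangency\<close>.\<close>

definition outer_L :: "nat \<Rightarrow> 'm::{finite,linorder} param \<Rightarrow> 'm param \<Rightarrow> 'm space \<times> 'm space" where
  "outer_L k p h =
    ((fst h, 2 * (fst (xT (fst p) (fst (snd p))) \<bullet> fst (fst (snd h))) + 2 * inverse (cyl_height (fst p)) * snd (fst (snd h))),
     ((2 * snd (snd h)) *\<^sub>R matrix_B (fst p) (diag_A k (xT (fst p) (fst (snd p))))
      + (2 * snd (snd p)) *\<^sub>R (fst (fst (snd h)) + snd (diag_A k (xT (fst p) (fst (snd p)))) *\<^sub>R hessian (fst p) (fst h)),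
      snd (snd h)))"

definition inner_L :: "nat \<Rightarrow> 'm::{finite,linorder} param \<Rightarrow> 'm param \<Rightarrow> 'm param" where
  "inner_L k p h = (fst h, (matrix_B (fst p) (left_variation k (fst p) h), snd (left_variation k (fst p) h)), snd (snd h))"

lemma stretch_last: "stretch (0, (0, 1), 0) c (a, (w, r), s) = (a, (w, c * r), s)"
  by (simp add: stretch_def inner_prod_def algebra_simps)

lemma pi_L_factored:
  fixes p :: "'m::{finite,linorder} param"
  assumes "p \<in> chart"
  shows "frechet_derivative (pi_L k) (at p) h = outer_L k p (stretch (0, (0, 1), 0) (tangency p) (inner_L k p h))"
proof -
  obtain y x \<omega> where p: "p = (y, x, \<omega>)" by (cases p)
  have y: "y \<in> Omega" using assms by (auto simp: p chart_iff)
  let ?z = "xT y x" and ?d = "left_variation k y h"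
  have "?z \<bullet> ?d = fst ?z \<bullet> fst ?d + snd ?z * snd ?d" by (simp add: inner_prod_def)
  also have "\<dots> = fst ?z \<bullet> matrix_B y ?d + (snd ?z - grad cyl_height y \<bullet> fst ?z) * snd ?d"
    by (simp add: matrix_B_def inner_add_right inner_commute algebra_simps)
  also have "\<dots> = fst ?z \<bullet> matrix_B y ?d + inverse (cyl_height y) * (tangency p * snd ?d)"
    unfolding xT_defect[OF y, of x \<omega>] p by (simp add: inverse_eq_divide)
  finally show ?thesis
    unfolding p pi_L_derivative[OF assms[unfolded p]]
    by (simp add: outer_L_def inner_L_def p stretch_last algebra_simps)
qed

lemma outer_L_facts:
  fixes p :: "'m::{finite,linorder} param"
  assumes "p \<in> chart"
  shows "linear (outer_L k p)" "inj (outer_L k p)" "(\<lambda>p. outer_L k p h) differentiable (at p)"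
proof -
  obtain y x \<omega> where p: "p = (y, x, \<omega>)" by (cases p)
  have y: "y \<in> Omega" and \<omega>: "\<omega> \<noteq> 0" using assms by (auto simp: p chart_iff)
  have q: "cyl_height y > 0" by (rule cyl_height_pos[OF y])
  show l: "linear (outer_L k p)"
    by (intro linearI) (simp_all add: outer_L_def p linear_add[OF linear_hessian[OF y]]
        linear_cmul[OF linear_hessian[OF y]] inner_add_right algebra_simps)
  have "h = 0" if "outer_L k p h = 0" for h
  proof -
    obtain a w r s where h: "h = (a, (w, r), s)" by (metis prod.collapse)
    have "a = 0" "s = 0" using that by (simp_all add: outer_L_def h zero_prod_def)
    moreover from this have "w = 0"
      using that \<omega> linear_0[OF linear_hessian[OF y]] by (simp add: outer_L_def h p zero_prod_def)
    moreover from this have "r = 0" using that q by (simp add: outer_L_def h p zero_prod_def)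
    ultimately show ?thesis by (simp add: h zero_prod_def)
  qed
  then show "inj (outer_L k p)" using linear_injective_0[OF l] by blast
  have "smooth_on chart (\<lambda>p. hessian (fst p) v)" for v :: "(real, 'm) vec"
    unfolding hessian_def
    by (rule smooth_on_compose[OF smooth_on_deriv[OF smooth_on_grad_cyl_height] smooth_on_chart_coordinates(1) chart_fst])
  then have "smooth_on chart (\<lambda>p. outer_L k p h)"
    unfolding outer_L_def matrix_B_def
    by (intro smooth_on_Pair smooth_on_const open_chart smooth_on_add smooth_on_scaleR smooth_on_mult smooth_on_inner
        smooth_on_chart_coordinates smooth_on_fst[OF smooth_on_chart_xT] smooth_on_fst[OF smooth_on_chart_diag_A]
        smooth_on_snd[OF smooth_on_chart_diag_A] smooth_on_chart_grad smooth_on_chart_inverse_cyl_height)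
  then show "(\<lambda>p. outer_L k p h) differentiable (at p)" using smooth_on_differentiable assms by blast
qed

lemma inner_L_facts:
  fixes p :: "'m::{finite,linorder} param"
  assumes "p \<in> chart"
  shows "linear (inner_L k p)" "inj (inner_L k p)" "(\<lambda>p. inner_L k p h) differentiable (at p)"
proof -
  show l: "linear (inner_L k p)"
    by (intro linearI) (simp_all add: inner_L_def linear_add[OF linear_left_variation] linear_add[OF linear_matrix_B]
        linear_cmul[OF linear_left_variation] linear_cmul[OF linear_matrix_B])
  have "h = 0" if "inner_L k p h = 0" for h
  proof -
    have 0: "fst h = 0" "snd (snd h) = 0" using that by (simp_all add: inner_L_def zero_prod_def)
    have "snd (left_variation k (fst p) h) = 0" using that by (simp add: inner_L_def zero_prod_def)
    moreover from this have "fst (left_variation k (fst p) h) = 0"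
      using that by (simp add: inner_L_def zero_prod_def matrix_B_def)
    ultimately have "left_variation k (fst p) h = 0" by (simp add: prod_eq_iff)
    then have "fst (snd h) = 0"
      by (simp add: left_variation_def 0 linear_0[OF linear_lift])
    with 0 show ?thesis by (simp add: prod_eq_iff)
  qed
  then show "inj (inner_L k p)" using linear_injective_0[OF l] by blast
  have v: "smooth_on chart (\<lambda>p. left_variation k (fst p) h)"
    unfolding left_variation_def lift_def
    by (intro smooth_on_linear_compose[OF _ bounded_linear_diag_A] smooth_on_diff smooth_on_Pair smooth_on_const
        smooth_on_inner smooth_on_chart_grad open_chart)
  have "smooth_on chart (\<lambda>p. inner_L k p h)"
    unfolding inner_L_def matrix_B_def
    by (intro smooth_on_Pair smooth_on_const open_chart smooth_on_add smooth_on_scaleR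
        smooth_on_fst[OF v] smooth_on_snd[OF v] smooth_on_chart_grad)
  then show "(\<lambda>p. inner_L k p h) differentiable (at p)" using smooth_on_differentiable assms by blast
qed

lemma basis_last: "(0, (0, 1), 0) \<in> (Basis :: 'm::{finite,linorder} param set)"
  by (auto simp: Basis_prod_def zero_prod_def)

lemma jacobian_pi_L:
  fixes p :: "'m::{finite,linorder} param"
  assumes "p \<in> chart"
  shows "jacobian_det (pi_L k) p = 0 \<longleftrightarrow> tangency p = 0"
    and "tangency p = 0 \<Longrightarrow> \<exists>c. c \<noteq> 0 \<and> frechet_derivative (jacobian_det (pi_L k)) (at p) = (\<lambda>w. c * tangency' p w)"
  using jacobian_det_factored[OF DIM_param basis_last open_chart pi_L_factored outer_L_facts inner_L_facts assms]
    tangency_has_derivative[OF assms] by blast+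

text \<open>On the singular set the kernel of the differential of \<open>pi_L\<close> is spanned by the following field, the
  normal reflected by \<open>A\<close>.\<close>

definition normal :: "(real, 'm::{finite,linorder}) vec \<Rightarrow> 'm space" where
  "normal y = (tail y, cyl_height y)"

definition kernel_field :: "nat \<Rightarrow> 'm::{finite,linorder} param \<Rightarrow> 'm param" where
  "kernel_field k p = (0, diag_A k (normal (fst p)), 0)"

lemma matrix_B_eq_0_iff:
  assumes "y \<in> Omega"
  shows "matrix_B y v = 0 \<longleftrightarrow> v = (snd v / cyl_height y) *\<^sub>R normal y"
proof -
  have q: "cyl_height y > 0" by (rule cyl_height_pos[OF assms])
  have "matrix_B y v = fst v - (snd v / cyl_height y) *\<^sub>R tail y"
    by (simp add: matrix_B_def grad_cyl_height[OF assms])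
  then show ?thesis using q by (auto simp: normal_def prod_eq_iff)
qed

lemma xT_inner_normal:
  assumes "y \<in> Omega"
  shows "xT y x \<bullet> normal y = tangency (y, x, \<omega>)"
proof -
  have q: "cyl_height y > 0" by (rule cyl_height_pos[OF assms])
  have "xT y x \<bullet> normal y = cyl_height y * (snd (xT y x) - grad cyl_height y \<bullet> fst (xT y x))"
    using q by (simp add: normal_def inner_prod_def grad_cyl_height[OF assms] inner_commute algebra_simps)
  then show ?thesis using q xT_defect[OF assms, of x \<omega>] by simp
qed

lemma ker_deriv_pi_L:
  fixes p :: "'m::{finite,linorder} param"
  assumes p: "p \<in> chart" and t: "tangency p = 0"
  shows "w \<in> ker_deriv (pi_L k) p \<longleftrightarrow> (\<exists>r. w = r *\<^sub>R kernel_field k p)"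
proof -
  obtain y x \<omega> where pe: "p = (y, x, \<omega>)" by (cases p)
  have y: "y \<in> Omega" and \<omega>: "\<omega> \<noteq> 0" using p by (auto simp: pe chart_iff)
  have q: "cyl_height y > 0" by (rule cyl_height_pos[OF y])
  have h0: "hessian y 0 = 0" by (rule linear_0[OF linear_hessian[OF y]])
  note D = pi_L_derivative[OF p[unfolded pe], of k]
  show ?thesis
  proof
    assume "w \<in> ker_deriv (pi_L k) p"
    then have *: "frechet_derivative (pi_L k) (at (y, x, \<omega>)) w = 0" by (simp add: ker_deriv_def pe)
    then have 0: "fst w = 0" "snd (snd w) = 0" unfolding D by (simp_all add: zero_prod_def)
    then have "matrix_B y (left_variation k y w) = 0"
      using * \<omega> unfolding D by (simp add: zero_prod_def h0)
    then have "left_variation k y w = (snd (left_variation k y w) / cyl_height y) *\<^sub>R normal y"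
      unfolding matrix_B_eq_0_iff[OF y] .
    then obtain r where "left_variation k y w = r *\<^sub>R normal y" by blast
    then have "diag_A k (fst (snd w)) = r *\<^sub>R normal y"
      by (simp add: left_variation_def 0 linear_0[OF linear_lift])
    then have "fst (snd w) = r *\<^sub>R diag_A k (normal y)"
      by (metis diag_A_diag_A linear_cmul linear_diag_A)
    then show "\<exists>r. w = r *\<^sub>R kernel_field k p"
      using 0 by (intro exI[of _ r]) (simp add: kernel_field_def pe prod_eq_iff)
  next
    assume "\<exists>r. w = r *\<^sub>R kernel_field k p"
    then obtain r where w: "w = r *\<^sub>R kernel_field k p" ..
    have v: "left_variation k y (kernel_field k p) = normal y"
      by (simp add: left_variation_def kernel_field_def pe linear_0[OF linear_lift])
    have "matrix_B y (normal y) = 0"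
      unfolding matrix_B_eq_0_iff[OF y] using q by (simp add: normal_def)
    then have "frechet_derivative (pi_L k) (at p) (kernel_field k p) = 0"
      unfolding pe D using v t xT_inner_normal[OF y, of x \<omega>]
      by (simp add: kernel_field_def pe h0 zero_prod_def)
    moreover have "linear (frechet_derivative (pi_L k) (at p))"
      using linear_frechet_derivative[OF smooth_on_differentiable[OF smooth_on_pi_L p]] .
    ultimately show "w \<in> ker_deriv (pi_L k) p"
      by (simp add: ker_deriv_def w linear_cmul)
  qed
qed

text \<open>The derivative of \<open>tangency\<close> along the kernel field is the quadratic form of \<open>A\<close> at the normal, a function
  of \<open>y\<close> alone.\<close>

definition normal_form :: "nat \<Rightarrow> (real, 'm::{finite,linorder}) vec \<Rightarrow> real" where
  "normal_form k y = tail y \<bullet> signature k (tail y) + tail y \<bullet> tail y - 1"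

lemma tangency'_kernel_field:
  fixes p :: "'m::{finite,linorder} param"
  assumes "p \<in> chart" "k \<le> CARD('m)"
  shows "tangency' p (kernel_field k p) = normal_form k (fst p)"
  using cyl_height_square[OF chart_fst[OF assms(1)]] tail_inner_tail[of "fst p" "signature k (tail (fst p))"]
  by (simp add: tangency'_def kernel_field_def diag_A_eq[OF assms(2)] normal_def normal_form_def
      linear_0[OF linear_tail] algebra_simps)

lemma coord_index_le: "coord_index (i :: 'm::{finite,linorder}) \<le> CARD('m)"
  unfolding coord_index_def by (rule card_mono) auto

text \<open>When \<open>A\<close> is the identity, this derivative is the squared length of the unit normal.\<close>

lemma tangency'_kernel_field_identity:
  fixes p :: "'m::{finite,linorder} param"
  assumes "p \<in> chart" "k > CARD('m)"
  shows "tangency' p (kernel_field k p) = 1"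
proof -
  have "diag_entry k (coord_index i) = 1" for i :: 'm
    using coord_index_le[of i] assms(2) by (simp add: diag_entry_def)
  then have "diag_A k v = v" for v :: "'m space"
    using assms(2) by (simp add: diag_A_def diag_entry_def prod_eq_iff vec_eq_iff)
  then show ?thesis
    using cyl_height_square[OF chart_fst[OF assms(1)]]
    by (simp add: tangency'_def kernel_field_def normal_def linear_0[OF linear_tail])
qed

lemma normal_form_has_derivative:
  "((\<lambda>p. normal_form k (fst p)) has_derivative
    (\<lambda>h. 2 * ((signature k (tail (fst p)) + tail (fst p)) \<bullet> tail (fst h)))) (at p)"
proof -
  have t: "((\<lambda>p. tail (fst p)) has_derivative (\<lambda>h. tail (fst h))) (at p)"
    by (rule bounded_linear.has_derivative[OF bounded_linear_tail has_derivative_fst[OF has_derivative_ident]])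
  have s: "((\<lambda>p. signature k (tail (fst p))) has_derivative (\<lambda>h. signature k (tail (fst h)))) (at p)"
    by (rule bounded_linear.has_derivative[OF bounded_linear_signature t])
  have "((\<lambda>p. normal_form k (fst p)) has_derivative
      (\<lambda>h. (tail (fst p) \<bullet> signature k (tail (fst h)) + tail (fst h) \<bullet> signature k (tail (fst p)))
        + (tail (fst p) \<bullet> tail (fst h) + tail (fst h) \<bullet> tail (fst p)) - 0)) (at p)"
    unfolding normal_form_def
    by (intro has_derivative_diff has_derivative_add has_derivative_inner t s has_derivative_const)
  then show ?thesis
  proof (rule has_derivative_eq_rhs, intro ext)
    fix h
    show "(tail (fst p) \<bullet> signature k (tail (fst h)) + tail (fst h) \<bullet> signature k (tail (fst p)))
        + (tail (fst p) \<bullet> tail (fst h) + tail (fst h) \<bullet> tail (fst p)) - 0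
        = 2 * ((signature k (tail (fst p)) + tail (fst p)) \<bullet> tail (fst h))"
      using signature_inner[of k "tail (fst p)" "tail (fst h)"]
        inner_commute[of "tail (fst h)" "signature k (tail (fst p))"] inner_commute[of "tail (fst h)" "tail (fst p)"]
      by (simp add: inner_add_left)
  qed
qed

lemma tangency'_solvable:
  assumes "p \<in> chart"
  obtains b where "tangency' p (a, b, 0) = 0"
proof -
  have q: "cyl_height (fst p) > 0" by (rule cyl_height_pos[OF chart_fst[OF assms]])
  have "tangency' p (a, (0, - tangency' p (a, 0, 0) / cyl_height (fst p)), 0) = 0"
    using q by (simp add: tangency'_def zero_prod_def[symmetric] fst_zero snd_zero)
  then show thesis using that by blast
qed

text \<open>A point of the singular set is a fold point unless \<open>tangency\<close> is stationary along the kernel field.  Its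
  derivative along that field depends on \<open>y\<close> only, so that a zero is simple as soon as the gradient in \<open>y\<close> is
  nonzero: a given variation of \<open>y\<close> is made tangent to the singular set by moving \<open>x\<close>
  vertically.\<close>

theorem cusp_singularity_pi_L: "cusp_singularity (param_domain k :: 'm::{finite,linorder} param set) (pi_L k)"
  unfolding cusp_singularity_def
proof (intro conjI exI[of _ chart] ballI impI param_domain_subset_chart smooth_on_pi_L)
  fix p :: "'m param"
  assume "p \<in> param_domain k" and 0: "jacobian_det (pi_L k) p = 0"
  then have chart: "p \<in> chart" using param_domain_subset_chart by blast
  have t: "tangency p = 0" using 0 jacobian_pi_L(1)[OF chart] by blast
  obtain c where c: "c \<noteq> 0" and jac: "frechet_derivative (jacobian_det (pi_L k)) (at p) = (\<lambda>w. c * tangency' p w)"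
    using jacobian_pi_L(2)[OF chart t] by blast
  have S1: "p \<in> S1 (pi_L k)"
    using 0 not_zero_multiple_tangency'[OF chart c] by (simp add: S1_def jac)
  have ker: "kernel_field k x \<in> ker_deriv (pi_L k) x" if "x \<in> chart" "tangency x = 0" for x :: "'m param"
    unfolding ker_deriv_pi_L[OF that] by (rule exI[of _ 1]) simp
  show "fold_point (pi_L k) p \<or> cusp_point (pi_L k) p"
  proof (cases "tangency' p (kernel_field k p) = 0")
    case False
    have "fold_point (pi_L k) p"
      by (rule fold_pointI[OF S1 ker[OF chart t] smooth_on_differentiable[OF smooth_on_pi_L chart] jac
            linear_tangency'[OF chart] c False])
    then show ?thesis ..
  next
    case tk: True
    then have k: "k \<le> CARD('m)" using tangency'_kernel_field_identity[OF chart, of k] by (cases "k \<le> CARD('m)") auto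
    have nf: "normal_form k (fst p) = 0" using tk tangency'_kernel_field[OF chart k] by simp
    have sub: "ker_deriv (pi_L k) p \<subseteq> tangent_S1 (pi_L k) p"
    proof
      fix w assume "w \<in> ker_deriv (pi_L k) p"
      then obtain r where "w = r *\<^sub>R kernel_field k p" unfolding ker_deriv_pi_L[OF chart t] ..
      then show "w \<in> tangent_S1 (pi_L k) p"
        using tk by (simp add: tangent_S1_def jac linear_cmul[OF linear_tangency'[OF chart]])
    qed
    have smooth_v: "smooth_on chart (kernel_field k :: 'm param \<Rightarrow> 'm param)"
      unfolding kernel_field_def normal_def
      by (intro smooth_on_Pair smooth_on_const open_chart smooth_on_linear_compose[OF _ bounded_linear_diag_A]
          smooth_on_linear_compose[OF _ bounded_linear_tail] smooth_on_chart_coordinates smooth_on_chart_cyl_height)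
    have fields: "kernel_field k x \<noteq> 0 \<and> kernel_field k x \<in> ker_deriv (pi_L k) x \<and> tangency x = 0 \<and>
        frechet_derivative tangency (at x) \<noteq> (\<lambda>_. 0)" if "x \<in> chart \<inter> S1 (pi_L k)" for x :: "'m param"
    proof -
      have x: "x \<in> chart" and tx: "tangency x = 0"
        using that jacobian_pi_L(1)[of x k] by (auto simp: S1_def)
      have "normal (fst x) \<noteq> 0"
        using cyl_height_pos[OF chart_fst[OF x]] by (simp add: normal_def prod_eq_iff)
      then have "fst (snd (kernel_field k x)) \<noteq> 0" by (simp add: kernel_field_def)
      then have "kernel_field k x \<noteq> 0" by force
      moreover have "frechet_derivative tangency (at x) \<noteq> (\<lambda>_. 0)"
        using not_zero_multiple_tangency'[OF x, of 1] by (simp add: frechet_derivative_tangency[OF x])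
      ultimately show ?thesis using ker[OF x tx] tx by blast
    qed
    let ?d = "signature k (tail (fst p)) + tail (fst p)"
    have td: "tail ?d = ?d" by (simp add: linear_add[OF linear_tail] tail_signature)
    \<comment> \<open>Where the form vanishes, this direction has squared length \<open>2\<close>.\<close>
    have "?d \<bullet> ?d = 2 * (tail (fst p) \<bullet> signature k (tail (fst p)) + tail (fst p) \<bullet> tail (fst p))"
      using signature_inner[of k "tail (fst p)" "signature k (tail (fst p))"]
        inner_commute[of "signature k (tail (fst p))" "tail (fst p)"]
      by (simp add: inner_add_left inner_add_right)
    then have dd: "?d \<bullet> ?d = 2" using nf by (simp add: normal_form_def)
    obtain b where b: "tangency' p (?d, b, 0) = 0" using tangency'_solvable[OF chart] .
    have "frechet_derivative (\<lambda>x. frechet_derivative tangency (at x) (kernel_field k x)) (at p)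
        = frechet_derivative (\<lambda>p. normal_form k (fst p)) (at p)"
      by (rule frechet_derivative_cong_open[OF open_chart chart])
        (simp add: frechet_derivative_tangency tangency'_kernel_field[OF _ k])
    also have "\<dots> = (\<lambda>h. 2 * (?d \<bullet> tail (fst h)))"
      by (rule frechet_derivative_at[OF normal_form_has_derivative, symmetric])
    finally have fd: "frechet_derivative (\<lambda>x. frechet_derivative tangency (at x) (kernel_field k x)) (at p) (?d, b, 0) = 4"
      by (simp add: td dd)
    have "cusp_point (pi_L k) p"
      unfolding cusp_point_def
    proof (intro conjI S1 sub exI[of _ chart] exI[of _ "kernel_field k"] exI[of _ tangency] chart smooth_v
        smooth_on_tangency ballI bexI[of _ "(?d, b, 0)"])
      show "frechet_derivative tangency (at p) (kernel_field k p) = 0"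
        by (simp add: frechet_derivative_tangency[OF chart] tk)
      show "frechet_derivative (\<lambda>x. frechet_derivative tangency (at x) (kernel_field k x)) (at p) (?d, b, 0) \<noteq> 0"
        by (simp only: fd)
      show "(?d, b, 0) \<in> tangent_S1 (pi_L k) p" by (simp add: tangent_S1_def jac b)
    qed (use fields in blast)+
    then show ?thesis ..
  qed
qed (rule DIM_param)

section \<open>The canonical relation\<close>

text \<open>The parameters can be read off the image by a linear projection.  It is a continuous inverse, and by
  the chain rule a left inverse of the differential.\<close>

theorem smooth_parametrization_canonical_relation:
  "smooth_parametrization (\<lambda>p. (pi_L k p, pi_R k p)) (param_domain k)
    (canonical_relation (source :: 'm::{finite,linorder} space set) (- half_cylinder) (psi k) (amplitude k))"
  unfolding smooth_parametrization_def
proof (intro conjI ballI)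
  let ?F = "\<lambda>p :: 'm param. (pi_L k p, pi_R k p)"
  let ?D = "param_domain k :: 'm param set"
  let ?M = "canonical_relation (source :: 'm space set) (- half_cylinder) (psi k) (amplitude k)"
  have smooth: "smooth_on chart ?F" by (intro smooth_on_Pair smooth_on_pi_L smooth_on_pi_R)
  show "\<exists>W. ?D \<subseteq> W \<and> smooth_on W ?F" using param_domain_subset_chart smooth by blast
  let ?G = "\<lambda>m :: ('m space \<times> 'm space) \<times> ('m space \<times> 'm space). (fst (fst (fst m)), fst (snd m), snd (snd (fst m)))"
  have G: "?G (?F p) = p" for p by (cases p) (simp add: pi_L_def pi_R_def)
  have image: "?F ` ?D = ?M"
  proof
    show "?F ` ?D \<subseteq> ?M"
    proof
      fix m assume "m \<in> ?F ` ?D"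
      then obtain y x \<omega> where m: "m = ?F (y, x, \<omega>)" and D: "(y, x, \<omega>) \<in> ?D" by auto
      have y: "y \<in> Omega" and x: "x \<notin> half_cylinder" and \<omega>: "\<omega> \<noteq> 0" and t: "quad k (y, x) > 0"
        using D by (auto simp: param_domain_def quad_def)
      let ?u = "(y, quad k (y, x))"
      have c: "(?u, x, \<omega>) \<in> cone_over (source \<times> - half_cylinder)"
        using y x \<omega> t by (simp add: cone_over_def)
      have "amplitude k (?u, x, \<omega>) \<noteq> 0"
        using xT_eq_0_iff[OF y x] \<omega> by (simp add: amplitude_eq)
      then have "(?u, x, \<omega>) \<in> closure {p \<in> cone_over (source \<times> - half_cylinder). amplitude k p \<noteq> 0}"
        using c by (intro closure_subset[THEN subsetD]) simp
      moreover have "m = ((?u, grad (\<lambda>u. psi k (u, x, \<omega>)) ?u), (x, - grad (\<lambda>v. psi k (?u, v, \<omega>)) x))"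
        using y by (simp add: m grad_psi_u grad_psi_x pi_L_def pi_R_def quad_def)
      moreover have "grad (\<lambda>\<theta>. psi k (?u, x, \<theta>)) \<omega> = 0" by (simp add: grad_psi_omega)
      ultimately show "m \<in> ?M" using c unfolding canonical_relation_def by blast
    qed
    show "?M \<subseteq> ?F ` ?D"
    proof
      fix m assume "m \<in> ?M"
      then obtain u x \<omega> where m: "m = ((u, grad (\<lambda>u. psi k (u, x, \<omega>)) u), (x, - grad (\<lambda>v. psi k (u, v, \<omega>)) x))"
        and c: "(u, x, \<omega>) \<in> cone_over (source \<times> - half_cylinder)" and g: "grad (\<lambda>\<theta>. psi k (u, x, \<theta>)) \<omega> = 0"
        unfolding canonical_relation_def by blast
      obtain y t where u: "u = (y, t)" by (cases u)
      have y: "y \<in> Omega" and x: "x \<notin> half_cylinder" and \<omega>: "\<omega> \<noteq> 0" and t: "t > 0"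
        using c by (auto simp: cone_over_def u)
      have q: "t = quad k (y, x)" using g by (simp add: grad_psi_omega u)
      have "m = ?F (y, x, \<omega>)"
        using y by (simp add: m u q grad_psi_u grad_psi_x pi_L_def pi_R_def quad_def)
      moreover have "(y, x, \<omega>) \<in> ?D" using y x \<omega> t q by (simp add: param_domain_def quad_def)
      ultimately show "m \<in> ?F ` ?D" by blast
    qed
  qed
  show "\<exists>\<Psi>. homeomorphism ?D ?M ?F \<Psi>"
  proof (intro exI[of _ ?G] homeomorphismI)
    show "continuous_on ?D ?F"
      using continuous_on_subset[OF smooth_on_continuous_on[OF smooth] param_domain_subset_chart] .
    show "continuous_on ?M ?G" by (intro continuous_intros)
    show "?F ` ?D \<subseteq> ?M" using image by simp
    show "?G ` ?M \<subseteq> ?D" unfolding image[symmetric] image_image G by simp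
    show "?G (?F p) = p" for p by (rule G)
    show "?F (?G m) = m" if "m \<in> ?M" for m
    proof -
      obtain p where "m = ?F p" using \<open>m \<in> ?M\<close> image by blast
      then show ?thesis using G[of p] by simp
    qed
  qed
  fix p :: "'m param" assume "p \<in> ?D"
  then have "p \<in> chart" using param_domain_subset_chart by blast
  then have d: "(?F has_derivative frechet_derivative ?F (at p)) (at p)"
    by (rule smooth_on_has_derivative[OF smooth])
  have bG: "bounded_linear ?G"
    by (intro bounded_linear_Pair bounded_linear_fst_comp bounded_linear_snd_comp bounded_linear_fst bounded_linear_snd
        bounded_linear_ident)
  have "((\<lambda>p. ?G (?F p)) has_derivative (\<lambda>h. ?G (frechet_derivative ?F (at p) h))) (at p)"
    by (rule bounded_linear.has_derivative[OF bG d])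
  then have "((\<lambda>p. p) has_derivative (\<lambda>h. ?G (frechet_derivative ?F (at p) h))) (at p)"
    by (simp only: G)
  then have "(\<lambda>h. ?G (frechet_derivative ?F (at p) h)) = (\<lambda>h. h)"
    using has_derivative_unique has_derivative_ident by blast
  then show "inj (frechet_derivative ?F (at p))"
    by (intro inj_on_inverseI[where g = ?G]) (simp only: fun_eq_iff)
qed

theorem theorem6p1:
  fixes n k :: nat and U V :: "'m::{finite,linorder} space set"
  assumes "n = CARD('m) + 1" and "n \<ge> 3" and "k \<in> {2..n - 1}"
    and "U = Omega \<times> {0<..}" and "V = - half_cylinder"
  shows "fourier_integral_operator U V (psi k) (amplitude k) (Radon k) \<and>
    smooth_parametrization (\<lambda>p. (pi_L k p, pi_R k p)) (param_domain k)
      (canonical_relation U V (psi k) (amplitude k)) \<and>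
    cusp_singularity (param_domain k) (pi_L k) \<and>
    fold_singularity (param_domain k) (pi_R k)"
  unfolding assms(4,5)
  by (intro conjI fourier_integral_operator_Radon smooth_parametrization_canonical_relation
      cusp_singularity_pi_L fold_singularity_pi_R)

end
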